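(* Let $\mathbf T\equiv(T_1,T_2)\in\mathcal{TC}$, i.e. $\mathbf T$ is a $2$-variable weighted shift that is a commuting pair of subnormal operators and whose core is of tensor form. Then $$(T_1,T_2^2)\in\mathfrak H_\infty\iff (T_1^2,T_2)\in\mathfrak H_\infty\iff (T_1,T_2)\in\mathfrak H_\infty .$$
   Context: For bounded families of positive numbers $\alpha_{\mathbf k},\beta_{\mathbf k}$ ($\mathbf k\in\mathbb{Z}_+^2$), the $2$-variable weighted shift $\mathbf T\equiv(T_1,T_2)$ on $\ell^2(\mathbb{Z}_+^2)$ with canonical orthonormal basis $\{e_{\mathbf k}\}$ is defined by $T_1e_{\mathbf k}=\alpha_{\mathbf k}e_{\mathbf k+(1,0)}$, $T_2e_{\mathbf k}=\beta_{\mathbf k}e_{\mathbf k+(0,1)}$. $\mathfrak H_0$ is the class of commuting pairs of subnormal operators on Hilbert space; $\mathfrak H_\infty$ is the class of subnormal pairs, i.e. pairs that are the restriction of a commuting pair of normal operators to a common invariant subspace. The core $c(\mathbf T)$ is the restriction of $\mathbf T$ to the closed span of $\{e_{(k_1,k_2)}:k_1\ge 1,k_2\ge 1\}$, regarded as a $2$-variable weighted shift. A $2$-variable weighted shift is of tensor form if it is of the form $(I\otimes W_\alpha,W_\beta\otimes I)$ for unilateral weighted shifts $W_\alpha,W_\beta$, i.e. its weights $\alpha_{(k_1,k_2)}$ depend only on $k_1$ and its weights $\beta_{(k_1,k_2)}$ depend only on $k_2$. $\mathcal{TC}$ is the class of all $2$-variable weighted shifts $\mathbf T\in\mathfrak H_0$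 such that $c(\mathbf T)$ is of tensor form. *)

theory Defs
  imports "HOL-Analysis.Analysis" "HOL-Algebra.Algebraic_Closure_Type"
begin

section \<open>Hilbert spaces and bounded operators\<close>

text \<open>
  Subnormality quantifies existentially over Hilbert spaces, so Hilbert spaces are carrier-based
  structures rather than types.  The fields \<open>mult\<close> and \<open>one\<close> inherited from the record of modules
  play no role.
\<close>

record 'a cinner_space = "(complex, 'a) module" +
  hinner :: "'a \<Rightarrow> 'a \<Rightarrow> complex"

definition hnorm :: "'a cinner_space \<Rightarrow> 'a \<Rightarrow> real" where
  "hnorm H x = sqrt (Re (hinner H x x))"

locale hilbert_space =
  module "ring_of_type_algebra :: complex ring" H
  for H :: "'a cinner_space" (structure) +
  assumes hinner_add_left:
      "\<lbrakk>x \<in> carrier H; y \<in> carrier H; z \<in> carrier H\<rbrakk>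
        \<Longrightarrow> hinner H (x \<oplus>\<^bsub>H\<^esub> y) z = hinner H x z + hinner H y z"
    and hinner_smult_left:
      "\<lbrakk>x \<in> carrier H; y \<in> carrier H\<rbrakk> \<Longrightarrow> hinner H (c \<odot>\<^bsub>H\<^esub> x) y = c * hinner H x y"
    and hinner_commute:
      "\<lbrakk>x \<in> carrier H; y \<in> carrier H\<rbrakk> \<Longrightarrow> hinner H y x = cnj (hinner H x y)"
    and hinner_nonneg:
      "x \<in> carrier H \<Longrightarrow> 0 \<le> Re (hinner H x x)"
    and hinner_definite:
      "\<lbrakk>x \<in> carrier H; hinner H x x = 0\<rbrakk> \<Longrightarrow> x = \<zero>\<^bsub>H\<^esub>"
    and hilbert_complete:
      "\<lbrakk>\<And>n::nat. u n \<in> carrier H;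
        \<And>e. 0 < e \<Longrightarrow> \<exists>N. \<forall>m\<ge>N. \<forall>n\<ge>N. hnorm H (u m \<ominus>\<^bsub>H\<^esub> u n) < e\<rbrakk>
        \<Longrightarrow> \<exists>l\<in>carrier H. (\<lambda>n. hnorm H (u n \<ominus>\<^bsub>H\<^esub> l)) \<longlonglongrightarrow> 0"

definition linear_map :: "'a cinner_space \<Rightarrow> 'b cinner_space \<Rightarrow> ('a \<Rightarrow> 'b) \<Rightarrow> bool" where
  "linear_map H K T \<longleftrightarrow>
     T \<in> carrier H \<rightarrow> carrier K \<and>
     (\<forall>x\<in>carrier H. \<forall>y\<in>carrier H. T (x \<oplus>\<^bsub>H\<^esub> y) = T x \<oplus>\<^bsub>K\<^esub> T y) \<and>
     (\<forall>c. \<forall>x\<in>carrier H. T (c \<odot>\<^bsub>H\<^esub> x) = c \<odot>\<^bsub>K\<^esub> T x)"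

definition isometry :: "'a cinner_space \<Rightarrow> 'b cinner_space \<Rightarrow> ('a \<Rightarrow> 'b) \<Rightarrow> bool" where
  "isometry H K V \<longleftrightarrow>
     linear_map H K V \<and> (\<forall>x\<in>carrier H. hnorm K (V x) = hnorm H x)"

definition bounded_operator :: "'a cinner_space \<Rightarrow> ('a \<Rightarrow> 'a) \<Rightarrow> bool" where
  "bounded_operator H T \<longleftrightarrow>
     linear_map H H T \<and> (\<exists>C. \<forall>x\<in>carrier H. hnorm H (T x) \<le> C * hnorm H x)"

definition is_adjoint :: "'a cinner_space \<Rightarrow> ('a \<Rightarrow> 'a) \<Rightarrow> ('a \<Rightarrow> 'a) \<Rightarrow> bool" where
  "is_adjoint H T S \<longleftrightarrow>
     bounded_operator H S \<and>
     (\<forall>x\<in>carrier H. \<forall>y\<in>carrier H. hinner H (T x) y = hinner H x (S y))"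

definition commuting :: "'a cinner_space \<Rightarrow> ('a \<Rightarrow> 'a) \<Rightarrow> ('a \<Rightarrow> 'a) \<Rightarrow> bool" where
  "commuting H S T \<longleftrightarrow> (\<forall>x\<in>carrier H. S (T x) = T (S x))"

definition normal_operator :: "'a cinner_space \<Rightarrow> ('a \<Rightarrow> 'a) \<Rightarrow> bool" where
  "normal_operator H N \<longleftrightarrow>
     bounded_operator H N \<and> (\<exists>S. is_adjoint H N S \<and> commuting H N S)"

section \<open>Subnormality\<close>

text \<open>
  The type argument \<open>'k\<close> is the universe from which the elements of the larger Hilbert space are
  drawn; HOL cannot quantify over it inside a formula, so it stays a parameter and theorems are
  stated for arbitrary \<open>'k\<close>.  The smaller space is identified with its image under an isometry
  \<open>V\<close>; the intertwining relations make this image invariant and say that the operators are the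
  restrictions of their extensions to it.
\<close>

definition subnormal :: "'k itself \<Rightarrow> 'h cinner_space \<Rightarrow> ('h \<Rightarrow> 'h) \<Rightarrow> bool" where
  "subnormal _ H T \<longleftrightarrow>
     bounded_operator H T \<and>
     (\<exists>(K :: 'k cinner_space) V N.
        hilbert_space K \<and> isometry H K V \<and> normal_operator K N \<and>
        (\<forall>x\<in>carrier H. N (V x) = V (T x)))"

definition H_zero ::
  "'k itself \<Rightarrow> 'h cinner_space \<Rightarrow> (('h \<Rightarrow> 'h) \<times> ('h \<Rightarrow> 'h)) set" where
  "H_zero k H =
     {(T1, T2). commuting H T1 T2 \<and> subnormal k H T1 \<and> subnormal k H T2}"

definition H_infinity ::
  "'k itself \<Rightarrow> 'h cinner_space \<Rightarrow> (('h \<Rightarrow> 'h) \<times> ('h \<Rightarrow> 'h)) set" where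
  "H_infinity _ H =
     {(T1, T2). bounded_operator H T1 \<and> bounded_operator H T2 \<and>
       (\<exists>(K :: 'k cinner_space) V N1 N2.
          hilbert_space K \<and> isometry H K V \<and>
          normal_operator K N1 \<and> normal_operator K N2 \<and> commuting K N1 N2 \<and>
          (\<forall>x\<in>carrier H. N1 (V x) = V (T1 x) \<and> N2 (V x) = V (T2 x)))}"

section \<open>Two-variable weighted shifts\<close>

definition ell2 :: "('i \<Rightarrow> complex) cinner_space" where
  "ell2 = \<lparr>carrier = {f. (\<lambda>k. (cmod (f k))\<^sup>2) summable_on UNIV},
           monoid.mult = (\<lambda>_ _. undefined), one = undefined,
           zero = (\<lambda>_. 0), add = (\<lambda>f g k. f k + g k),
           smult = (\<lambda>c f k. c * f k),
           hinner = (\<lambda>f g. \<Sum>\<^sub>\<infinity>k. f k * cnj (g k))\<rparr>"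

lemma ell2_simps:
  "carrier ell2 = {f. (\<lambda>k. (cmod (f k))\<^sup>2) summable_on UNIV}"
  "zero ell2 = (\<lambda>_. 0)"
  "add ell2 = (\<lambda>f g k. f k + g k)"
  "smult ell2 = (\<lambda>c f k. c * f k)"
  "hinner ell2 = (\<lambda>f g. \<Sum>\<^sub>\<infinity>k. f k * cnj (g k))"
  by (simp_all add: ell2_def)

lemma ell2_bound_summable:
  fixes f g h :: "'i \<Rightarrow> complex"
  assumes f: "(\<lambda>k. (cmod (f k))\<^sup>2) summable_on UNIV"
    and g: "(\<lambda>k. (cmod (g k))\<^sup>2) summable_on UNIV"
    and le: "\<And>k. (cmod (h k))\<^sup>2 \<le> a * (cmod (f k))\<^sup>2 + b * (cmod (g k))\<^sup>2"
  shows "(\<lambda>k. (cmod (h k))\<^sup>2) summable_on UNIV"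
proof (rule summable_on_comparison_test)
  show "(\<lambda>k. a * (cmod (f k))\<^sup>2 + b * (cmod (g k))\<^sup>2) summable_on UNIV"
    by (intro summable_on_add summable_on_cmult_right f g)
qed (use le in auto)

lemma cmod_add_sq_le: "(cmod (x + y))\<^sup>2 \<le> 2 * (cmod x)\<^sup>2 + 2 * (cmod y)\<^sup>2"
proof -
  have "(cmod (x + y))\<^sup>2 \<le> (cmod x + cmod y)\<^sup>2"
    by (intro power_mono norm_triangle_ineq) auto
  also have "\<dots> \<le> 2 * (cmod x)\<^sup>2 + 2 * (cmod y)\<^sup>2"
    using sum_squares_bound[of "cmod x" "cmod y"] by (simp add: power2_sum)
  finally show ?thesis .
qed

lemma ell2_add_summable:
  fixes f g :: "'i \<Rightarrow> complex"
  assumes "(\<lambda>k. (cmod (f k))\<^sup>2) summable_on UNIV" "(\<lambda>k. (cmod (g k))\<^sup>2) summable_on UNIV"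
  shows "(\<lambda>k. (cmod (f k + g k))\<^sup>2) summable_on UNIV"
  by (rule ell2_bound_summable[OF assms cmod_add_sq_le])

lemma ell2_smult_summable:
  fixes f :: "'i \<Rightarrow> complex"
  assumes "(\<lambda>k. (cmod (f k))\<^sup>2) summable_on UNIV"
  shows "(\<lambda>k. (cmod (c * f k))\<^sup>2) summable_on UNIV"
  by (rule ell2_bound_summable[OF assms assms, where a = "(cmod c)\<^sup>2" and b = 0])
    (simp add: norm_mult power_mult_distrib)

lemma ell2_hinner_summable:
  fixes f g :: "'i \<Rightarrow> complex"
  assumes f: "(\<lambda>k. (cmod (f k))\<^sup>2) summable_on UNIV"
    and g: "(\<lambda>k. (cmod (g k))\<^sup>2) summable_on UNIV"
  shows "(\<lambda>k. f k * cnj (g k)) summable_on UNIV"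
proof (rule abs_summable_summable, rule summable_on_comparison_test)
  show "(\<lambda>k. (cmod (f k))\<^sup>2 + (cmod (g k))\<^sup>2) summable_on UNIV"
    by (intro summable_on_add f g)
  show "cmod (f k * cnj (g k)) \<le> (cmod (f k))\<^sup>2 + (cmod (g k))\<^sup>2" for k
  proof -
    have "0 \<le> cmod (f k) * cmod (g k)" by simp
    then have "cmod (f k) * cmod (g k) \<le> (cmod (f k))\<^sup>2 + (cmod (g k))\<^sup>2"
      using sum_squares_bound[of "cmod (f k)" "cmod (g k)"] by linarith
    then show ?thesis by (simp add: norm_mult)
  qed
qed auto

lemma ell2_hinner_self:
  fixes f :: "'i \<Rightarrow> complex"
  assumes "f \<in> carrier ell2"
  shows "hinner ell2 f f = of_real (\<Sum>\<^sub>\<infinity>k. (cmod (f k))\<^sup>2)"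
proof -
  have "((\<lambda>k. of_real ((cmod (f k))\<^sup>2) :: complex) has_sum
      of_real (\<Sum>\<^sub>\<infinity>k. (cmod (f k))\<^sup>2)) UNIV"
    using assms by (intro has_sum_of_real has_sum_infsum) (simp add: ell2_simps)
  then have "(\<Sum>\<^sub>\<infinity>k. of_real ((cmod (f k))\<^sup>2) :: complex) =
      of_real (\<Sum>\<^sub>\<infinity>k. (cmod (f k))\<^sup>2)"
    by (rule infsumI)
  then show ?thesis by (simp only: ell2_simps complex_norm_square)
qed

lemma ell2_hnorm:
  "f \<in> carrier ell2 \<Longrightarrow> hnorm ell2 f = sqrt (\<Sum>\<^sub>\<infinity>k. (cmod (f k))\<^sup>2)"
  by (simp add: hnorm_def ell2_hinner_self)

lemma abelian_group_ell2: "abelian_group (ell2 :: ('i \<Rightarrow> complex) cinner_space)"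
proof (rule abelian_groupI)
  fix x :: "'i \<Rightarrow> complex"
  assume "x \<in> carrier ell2"
  then show "\<exists>y\<in>carrier ell2. y \<oplus>\<^bsub>ell2\<^esub> x = \<zero>\<^bsub>ell2\<^esub>"
    by (intro bexI[of _ "\<lambda>k. - x k"]) (auto simp: ell2_simps)
qed (auto simp: ell2_simps ell2_add_summable fun_eq_iff)

lemma module_ell2:
  "module (ring_of_type_algebra :: complex ring) (ell2 :: ('i \<Rightarrow> complex) cinner_space)"
  by (rule moduleI[OF cring_from_type_algebra abelian_group_ell2])
    (auto simp: ell2_simps ring_of_type_algebra_def ell2_smult_summable algebra_simps fun_eq_iff)

lemma ell2_minus:
  assumes "f \<in> carrier ell2" "g \<in> carrier ell2"
  shows "f \<ominus>\<^bsub>ell2\<^esub> g = (\<lambda>k. f k - g k)"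
proof -
  interpret abelian_group ell2 by (rule abelian_group_ell2)
  have "\<ominus>\<^bsub>ell2\<^esub> g = (\<lambda>k. - g k)"
    by (rule minus_equality) (use assms in \<open>auto simp: ell2_simps\<close>)
  then show ?thesis
    by (simp add: a_minus_def ell2_simps fun_eq_iff)
qed

lemma ell2_sum_le_hnorm:
  assumes "f \<in> carrier ell2" "finite F"
  shows "(\<Sum>k\<in>F. (cmod (f k))\<^sup>2) \<le> (hnorm ell2 f)\<^sup>2"
proof -
  have "(\<Sum>k\<in>F. (cmod (f k))\<^sup>2) \<le> (\<Sum>\<^sub>\<infinity>k. (cmod (f k))\<^sup>2)"
    using assms by (intro finite_sum_le_infsum) (auto simp: ell2_simps)
  also have "\<dots> = (hnorm ell2 f)\<^sup>2"
    by (simp add: ell2_hnorm[OF assms(1)] infsum_nonneg)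
  finally show ?thesis .
qed

lemma ell2_complete:
  fixes u :: "nat \<Rightarrow> 'i \<Rightarrow> complex"
  assumes u: "\<And>n. u n \<in> carrier ell2"
    and cauchy: "\<And>e. 0 < e \<Longrightarrow> \<exists>N. \<forall>m\<ge>N. \<forall>n\<ge>N. hnorm ell2 (u m \<ominus>\<^bsub>ell2\<^esub> u n) < e"
  shows "\<exists>l\<in>carrier ell2. (\<lambda>n. hnorm ell2 (u n \<ominus>\<^bsub>ell2\<^esub> l)) \<longlonglongrightarrow> 0"
proof -
  interpret abelian_group "ell2 :: ('i \<Rightarrow> complex) cinner_space" by (rule abelian_group_ell2)
  have d: "u m \<ominus>\<^bsub>ell2\<^esub> u n \<in> carrier ell2" for m n using u by simp
  have hnn: "0 \<le> hnorm ell2 f" if "f \<in> carrier ell2" for f :: "'i \<Rightarrow> complex"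
    by (simp add: ell2_hnorm[OF that] infsum_nonneg)
  have le: "(\<Sum>k\<in>F. (cmod (u m k - u n k))\<^sup>2) \<le> (hnorm ell2 (u m \<ominus>\<^bsub>ell2\<^esub> u n))\<^sup>2"
    if "finite F" for m n F
    using ell2_sum_le_hnorm[OF d that, of m n] by (simp add: ell2_minus[OF u u])
  have "Cauchy (\<lambda>n. u n k)" for k
  proof (rule metric_CauchyI)
    fix e :: real
    assume "0 < e"
    then obtain N where N: "\<forall>m\<ge>N. \<forall>n\<ge>N. hnorm ell2 (u m \<ominus>\<^bsub>ell2\<^esub> u n) < e" using cauchy by blast
    have "dist (u m k) (u n k) < e" if "m \<ge> N" "n \<ge> N" for m n
    proof -
      have "(cmod (u m k - u n k))\<^sup>2 \<le> (hnorm ell2 (u m \<ominus>\<^bsub>ell2\<^esub> u n))\<^sup>2"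
        using le[of "{k}" m n] by simp
      then have "cmod (u m k - u n k) \<le> hnorm ell2 (u m \<ominus>\<^bsub>ell2\<^esub> u n)"
        using hnn[OF d] by (rule power2_le_imp_le)
      then show ?thesis using N that by (force simp: dist_norm)
    qed
    then show "\<exists>N. \<forall>m\<ge>N. \<forall>n\<ge>N. dist (u m k) (u n k) < e" by blast
  qed
  then have l': "(\<lambda>n. u n k) \<longlonglongrightarrow> lim (\<lambda>n. u n k)" for k
    by (simp add: Cauchy_convergent_iff convergent_LIMSEQ_iff)
  define l where "l k = lim (\<lambda>n. u n k)" for k
  have l: "(\<lambda>n. u n k) \<longlonglongrightarrow> l k" for k
    unfolding l_def by (rule l')
  have fin: "(\<Sum>k\<in>F. (cmod (u n k - l k))\<^sup>2) \<le> e\<^sup>2"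
    if F: "finite F" and N: "\<forall>m\<ge>N. \<forall>n\<ge>N. hnorm ell2 (u m \<ominus>\<^bsub>ell2\<^esub> u n) < e" and n: "n \<ge> N"
    for F N n e
  proof (rule LIMSEQ_le_const2)
    show "(\<lambda>m. \<Sum>k\<in>F. (cmod (u n k - u m k))\<^sup>2) \<longlonglongrightarrow> (\<Sum>k\<in>F. (cmod (u n k - l k))\<^sup>2)"
      by (intro tendsto_intros l)
    have "(\<Sum>k\<in>F. (cmod (u n k - u m k))\<^sup>2) \<le> e\<^sup>2" if "m \<ge> N" for m
    proof -
      have "(hnorm ell2 (u n \<ominus>\<^bsub>ell2\<^esub> u m))\<^sup>2 \<le> e\<^sup>2"
        by (rule power_mono[OF less_imp_le hnn[OF d]]) (use N n that in blast)
      then show ?thesis using le[OF F, where m = n and n = m] by linarith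
    qed
    then show "\<exists>M. \<forall>m\<ge>M. (\<Sum>k\<in>F. (cmod (u n k - u m k))\<^sup>2) \<le> e\<^sup>2" by blast
  qed
  have diff: "(\<lambda>k. (cmod (u n k - l k))\<^sup>2) summable_on UNIV \<and>
      (\<Sum>\<^sub>\<infinity>k. (cmod (u n k - l k))\<^sup>2) \<le> e\<^sup>2"
    if "\<forall>m\<ge>N. \<forall>n\<ge>N. hnorm ell2 (u m \<ominus>\<^bsub>ell2\<^esub> u n) < e" "n \<ge> N" for N n e
  proof
    show s: "(\<lambda>k. (cmod (u n k - l k))\<^sup>2) summable_on UNIV"
      by (rule nonneg_bdd_above_summable_on)
        (auto intro!: bdd_aboveI2[where M = "e\<^sup>2"] fin[OF _ that])
    show "(\<Sum>\<^sub>\<infinity>k. (cmod (u n k - l k))\<^sup>2) \<le> e\<^sup>2"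
      by (rule infsum_le_finite_sums[OF s]) (use fin[OF _ that] in auto)
  qed
  obtain N1 where N1: "\<forall>m\<ge>N1. \<forall>n\<ge>N1. hnorm ell2 (u m \<ominus>\<^bsub>ell2\<^esub> u n) < 1"
    using cauchy[of 1] by auto
  have "(\<lambda>k. (cmod (l k))\<^sup>2) summable_on UNIV"
  proof (rule ell2_bound_summable)
    show "(\<lambda>k. (cmod (u N1 k))\<^sup>2) summable_on UNIV" using u[of N1] by (simp add: ell2_simps)
    show "(\<lambda>k. (cmod (u N1 k - l k))\<^sup>2) summable_on UNIV" using diff[OF N1] by blast
    show "(cmod (l k))\<^sup>2 \<le> 2 * (cmod (u N1 k))\<^sup>2 + 2 * (cmod (u N1 k - l k))\<^sup>2" for k
      using cmod_add_sq_le[of "u N1 k" "- (u N1 k - l k)"] by (simp only: norm_minus_cancel) simp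
  qed
  then have lc: "l \<in> carrier ell2" by (simp add: ell2_simps)
  have "(\<lambda>n. hnorm ell2 (u n \<ominus>\<^bsub>ell2\<^esub> l)) \<longlonglongrightarrow> 0"
  proof (rule LIMSEQ_I)
    fix r :: real
    assume r: "0 < r"
    then obtain N where N: "\<forall>m\<ge>N. \<forall>n\<ge>N. hnorm ell2 (u m \<ominus>\<^bsub>ell2\<^esub> u n) < r / 2"
      using cauchy[of "r / 2"] by auto
    have "norm (hnorm ell2 (u n \<ominus>\<^bsub>ell2\<^esub> l) - 0) < r" if "n \<ge> N" for n
    proof -
      have "hnorm ell2 (u n \<ominus>\<^bsub>ell2\<^esub> l) \<le> r / 2"
        unfolding ell2_hnorm[OF minus_closed[OF u lc]] unfolding ell2_minus[OF u lc]
        by (rule real_le_lsqrt) (use diff[OF N that] r in auto)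
      then show ?thesis using hnn[OF minus_closed[OF u lc], of n] r by simp
    qed
    then show "\<exists>N. \<forall>n\<ge>N. norm (hnorm ell2 (u n \<ominus>\<^bsub>ell2\<^esub> l) - 0) < r" by blast
  qed
  with lc show ?thesis by blast
qed

lemma hilbert_space_ell2: "hilbert_space (ell2 :: ('i \<Rightarrow> complex) cinner_space)"
proof (intro hilbert_space.intro module_ell2 hilbert_space_axioms.intro ell2_complete)
  fix x y z :: "'i \<Rightarrow> complex" and c
  assume x: "x \<in> carrier ell2" and y: "y \<in> carrier ell2"
  show "hinner ell2 (x \<oplus>\<^bsub>ell2\<^esub> y) z = hinner ell2 x z + hinner ell2 y z" if "z \<in> carrier ell2"
    using x y that
    by (simp add: ell2_simps algebra_simps infsum_add[symmetric] ell2_hinner_summable)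
  show "hinner ell2 (c \<odot>\<^bsub>ell2\<^esub> x) y = c * hinner ell2 x y"
    using x y by (simp add: ell2_simps mult.assoc infsum_cmult_right ell2_hinner_summable)
  show "hinner ell2 y x = cnj (hinner ell2 x y)"
  proof -
    have "(\<Sum>\<^sub>\<infinity>k. y k * cnj (x k)) = (\<Sum>\<^sub>\<infinity>k. cnj (x k * cnj (y k)))"
      by (simp add: mult.commute del: infsum_cnj)
    then show ?thesis by (simp only: ell2_simps infsum_cnj)
  qed
next
  fix x :: "'i \<Rightarrow> complex"
  assume x: "x \<in> carrier ell2"
  show "0 \<le> Re (hinner ell2 x x)"
    by (simp add: ell2_hinner_self[OF x] infsum_nonneg)
  assume "hinner ell2 x x = 0"
  then have "hnorm ell2 x = 0" by (simp add: hnorm_def)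
  then have "(cmod (x k))\<^sup>2 \<le> 0" for k
    using ell2_sum_le_hnorm[OF x, of "{k}"] by simp
  then show "x = \<zero>\<^bsub>ell2\<^esub>" by (simp add: ell2_simps fun_eq_iff)
qed

definition basis_vec :: "'i \<Rightarrow> 'i \<Rightarrow> complex" where
  "basis_vec k = (\<lambda>j. if j = k then 1 else 0)"

type_synonym weights = "nat \<times> nat \<Rightarrow> real"

definition weight_family :: "weights \<Rightarrow> bool" where
  "weight_family \<alpha> \<longleftrightarrow> (\<forall>k. 0 < \<alpha> k) \<and> bounded (range \<alpha>)"

definition shift1 :: "weights \<Rightarrow> (nat \<times> nat \<Rightarrow> complex) \<Rightarrow> (nat \<times> nat \<Rightarrow> complex)" where
  "shift1 \<alpha> f = (\<lambda>(k1, k2).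
     if k1 = 0 then 0 else of_real (\<alpha> (k1 - 1, k2)) * f (k1 - 1, k2))"

definition shift2 :: "weights \<Rightarrow> (nat \<times> nat \<Rightarrow> complex) \<Rightarrow> (nat \<times> nat \<Rightarrow> complex)" where
  "shift2 \<beta> f = (\<lambda>(k1, k2).
     if k2 = 0 then 0 else of_real (\<beta> (k1, k2 - 1)) * f (k1, k2 - 1))"

lemma shift1_basis_vec:
  "shift1 \<alpha> (basis_vec (k1, k2)) = (\<lambda>j. of_real (\<alpha> (k1, k2)) * basis_vec (k1 + 1, k2) j)"
  by (auto simp: shift1_def basis_vec_def fun_eq_iff)

lemma shift2_basis_vec:
  "shift2 \<beta> (basis_vec (k1, k2)) = (\<lambda>j. of_real (\<beta> (k1, k2)) * basis_vec (k1, k2 + 1) j)"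
  by (auto simp: shift2_def basis_vec_def fun_eq_iff)

text \<open>
  The core is regarded as a 2-variable weighted shift by identifying the basis vector at
  \<open>(k1 + 1, k2 + 1)\<close> with the one at \<open>(k1, k2)\<close>; this identification is \<open>core_embed\<close>.
\<close>

definition core_weights :: "weights \<Rightarrow> weights" where
  "core_weights \<alpha> = (\<lambda>(k1, k2). \<alpha> (k1 + 1, k2 + 1))"

definition core_embed :: "(nat \<times> nat \<Rightarrow> complex) \<Rightarrow> (nat \<times> nat \<Rightarrow> complex)" where
  "core_embed f = (\<lambda>(k1, k2). if k1 = 0 \<or> k2 = 0 then 0 else f (k1 - 1, k2 - 1))"

lemma shift1_core_embed: "shift1 \<alpha> (core_embed f) = core_embed (shift1 (core_weights \<alpha>) f)"
  by (auto simp: shift1_def core_embed_def core_weights_def fun_eq_iff gr0_conv_Suc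
      split: nat_diff_split)

lemma shift2_core_embed: "shift2 \<beta> (core_embed f) = core_embed (shift2 (core_weights \<beta>) f)"
  by (auto simp: shift2_def core_embed_def core_weights_def fun_eq_iff gr0_conv_Suc
      split: nat_diff_split)

definition tensor_form :: "weights \<Rightarrow> weights \<Rightarrow> bool" where
  "tensor_form \<alpha> \<beta> \<longleftrightarrow>
     (\<forall>k1 k2 l. \<alpha> (k1, k2) = \<alpha> (k1, l)) \<and> (\<forall>k1 k2 l. \<beta> (k1, k2) = \<beta> (l, k2))"

definition tensor_core_class ::
  "'k itself \<Rightarrow> (((nat \<times> nat \<Rightarrow> complex) \<Rightarrow> (nat \<times> nat \<Rightarrow> complex)) \<times>
                ((nat \<times> nat \<Rightarrow> complex) \<Rightarrow> (nat \<times> nat \<Rightarrow> complex))) set" where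
  "tensor_core_class k =
     {(shift1 \<alpha>, shift2 \<beta>) | \<alpha> \<beta>.
        weight_family \<alpha> \<and> weight_family \<beta> \<and>
        (shift1 \<alpha>, shift2 \<beta>) \<in> H_zero k ell2 \<and>
        tensor_form (core_weights \<alpha>) (core_weights \<beta>)}"

end

theory Submission
  imports Defs "HOL-Complex_Analysis.Cauchy_Integral_Formula"
begin

text \<open>
  Let \<open>\<gamma>(a,b) = \<parallel>T\<^sub>1\<^sup>a T\<^sub>2\<^sup>b e\<^sub>0\<parallel>\<^sup>2\<close> be the moments of the shift.  A commuting normal extension
  \<open>(N, M)\<close> of \<open>(T\<^sub>1, T\<^sub>2\<^sup>2)\<close> represents \<open>\<gamma>(a,2j)\<close> as \<open>\<parallel>N\<^sup>a M\<^sup>j x\<^sub>0\<parallel>\<^sup>2\<close>.  By Fuglede's theorem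
  \<open>N\<close> commutes with \<open>Q = (M*M)\<^bsup>1/4\<^esup>\<close>, so that \<open>\<gamma>(a,b) = \<parallel>N\<^sup>a Q\<^sup>b x\<^sub>0\<parallel>\<^sup>2\<close> for even \<open>b\<close>.  For fixed \<open>a\<close>
  both sides are moments in \<open>b\<close> of compactly supported measures on the half line (the left one
  because \<open>T\<^sub>2\<close> is subnormal), and such measures are determined by their even moments; hence the
  equality holds for all \<open>b\<close>.  Attaching independent phases to \<open>N\<close> and \<open>Q\<close>, i.e. tensoring
  them with bilateral shifts, yields a commuting normal extension of \<open>(T\<^sub>1, T\<^sub>2)\<close>.  It is cut down
  to a separable subspace in order to fit into the given universe.
\<close>

section \<open>Hilbert space preliminaries\<close>

text \<open>The overview speaks of measures and roots, but only vectors, inner products and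
  polynomials occur. A measure is replaced by the functional p -> Re <p(T) x, x> of an operator 0
  \<le> T \<le> 1, and its positivity is tested on a cone generated by squares times 1, t and 1 - t.
  One iteration for the square root, run inside this cone, yields both the operator roots and the
  determinacy by even moments.

  The two hypotheses live on unrelated Hilbert spaces: the extension of T2 knows nothing of T1 and
  is linked with that of (T1, T2^2) only through scalar moments, one a at a time, at the vectors
  T1^a e0. These give the norms of N^a Q^b x0 but not the angles between them, whereas basis vectors
  must go to orthogonal vectors. The phases repair exactly this: they separate the vectors and leave
  their norms alone.

  Fuglede's theorem enters because commuting with M does not by itself give commuting with the
  adjoint of M, from which Q is built. The phases enlarge the type of the space, so the result has
  to be brought back to the given universe.\<close>

context hilbert_space
begin

lemma scal_closed [simp, intro]: "x \<in> carrier H \<Longrightarrow> c \<odot>\<^bsub>H\<^esub> x \<in> carrier H"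
  by (rule smult_closed) (simp_all add: ring_of_type_algebra_def)

lemma hinner_add_right:
  assumes "x \<in> carrier H" "y \<in> carrier H" "z \<in> carrier H"
  shows "hinner H z (x \<oplus>\<^bsub>H\<^esub> y) = hinner H z x + hinner H z y"
  using assms by (metis hinner_add_left hinner_commute a_closed complex_cnj_add)

lemma hinner_smult_right:
  assumes "x \<in> carrier H" "y \<in> carrier H"
  shows "hinner H y (c \<odot>\<^bsub>H\<^esub> x) = cnj c * hinner H y x"
  using assms by (metis hinner_smult_left hinner_commute scal_closed complex_cnj_mult)

lemma hinner_zero_left [simp]: "x \<in> carrier H \<Longrightarrow> hinner H \<zero>\<^bsub>H\<^esub> x = 0"
  using hinner_add_left[of "\<zero>\<^bsub>H\<^esub>" "\<zero>\<^bsub>H\<^esub>" x] by simp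

lemma hinner_zero_right [simp]: "x \<in> carrier H \<Longrightarrow> hinner H x \<zero>\<^bsub>H\<^esub> = 0"
  using hinner_commute[of "\<zero>\<^bsub>H\<^esub>" x] by simp

lemma hinner_minus_left:
  assumes "x \<in> carrier H" "y \<in> carrier H" "z \<in> carrier H"
  shows "hinner H (x \<ominus>\<^bsub>H\<^esub> y) z = hinner H x z - hinner H y z"
proof -
  have "hinner H ((x \<ominus>\<^bsub>H\<^esub> y) \<oplus>\<^bsub>H\<^esub> y) z = hinner H (x \<ominus>\<^bsub>H\<^esub> y) z + hinner H y z"
    using assms by (intro hinner_add_left) auto
  moreover have "(x \<ominus>\<^bsub>H\<^esub> y) \<oplus>\<^bsub>H\<^esub> y = x"
    using assms by (simp add: a_minus_def a_assoc l_neg)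
  ultimately show ?thesis by simp
qed

lemma hinner_minus_right:
  assumes "x \<in> carrier H" "y \<in> carrier H" "z \<in> carrier H"
  shows "hinner H z (x \<ominus>\<^bsub>H\<^esub> y) = hinner H z x - hinner H z y"
  using assms by (metis hinner_minus_left hinner_commute minus_closed complex_cnj_diff)

lemmas hinner_simps = hinner_add_left hinner_add_right hinner_smult_left hinner_smult_right
  hinner_minus_left hinner_minus_right

lemma hinner_self: "x \<in> carrier H \<Longrightarrow> hinner H x x = of_real ((hnorm H x)\<^sup>2)"
proof -
  assume x: "x \<in> carrier H"
  have "Im (hinner H x x) = 0"
    using arg_cong[OF hinner_commute[OF x x], of Im] by simp
  then show ?thesis
    using hinner_nonneg[OF x] by (simp add: complex_eq_iff hnorm_def)
qed

lemma hnorm_nonneg [simp]: "x \<in> carrier H \<Longrightarrow> 0 \<le> hnorm H x"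
  using hinner_nonneg by (simp add: hnorm_def)

lemma hnorm_sq: "x \<in> carrier H \<Longrightarrow> (hnorm H x)\<^sup>2 = Re (hinner H x x)"
  using hinner_self by simp

lemma hnorm_zero [simp]: "hnorm H \<zero>\<^bsub>H\<^esub> = 0"
  by (simp add: hnorm_def)

lemma hnorm_eq_zero: "x \<in> carrier H \<Longrightarrow> hnorm H x = 0 \<Longrightarrow> x = \<zero>\<^bsub>H\<^esub>"
  using hinner_definite hinner_self by simp

lemma hnorm_smult: "x \<in> carrier H \<Longrightarrow> hnorm H (c \<odot>\<^bsub>H\<^esub> x) = cmod c * hnorm H x"
proof -
  assume x: "x \<in> carrier H"
  have "complex_of_real ((hnorm H (c \<odot>\<^bsub>H\<^esub> x))\<^sup>2) = of_real ((cmod c * hnorm H x)\<^sup>2)"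
    unfolding hinner_self[symmetric, OF scal_closed[OF x]] power_mult_distrib of_real_mult
      hinner_self[symmetric, OF x] complex_norm_square
    using x by (simp add: hinner_simps algebra_simps)
  then have "(hnorm H (c \<odot>\<^bsub>H\<^esub> x))\<^sup>2 = (cmod c * hnorm H x)\<^sup>2"
    using of_real_eq_iff by blast
  then show ?thesis
    using x by (simp add: power2_eq_iff_nonneg)
qed

text \<open>Vector identities below are mostly proved by pairing with an arbitrary vector: module
  algebra becomes complex arithmetic, within reach of \<open>algebra_simps\<close>.\<close>

lemma hinner_ext:
  assumes "x \<in> carrier H" "y \<in> carrier H"
    and "\<And>z. z \<in> carrier H \<Longrightarrow> hinner H x z = hinner H y z"
  shows "x = y"
proof -
  have "hinner H (x \<ominus>\<^bsub>H\<^esub> y) (x \<ominus>\<^bsub>H\<^esub> y) = 0"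
    using assms by (simp add: hinner_minus_left)
  then have "x \<ominus>\<^bsub>H\<^esub> y = \<zero>\<^bsub>H\<^esub>"
    using assms hinner_definite by blast
  then show ?thesis
    using assms(1,2) minus_closed r_neg1 by (metis a_minus_def add.inv_closed minus_equality minus_minus)
qed

lemma hinner_cauchy_schwarz:
  assumes x: "x \<in> carrier H" and y: "y \<in> carrier H"
  shows "cmod (hinner H x y) \<le> hnorm H x * hnorm H y"
proof (cases "hnorm H y = 0")
  case True
  then show ?thesis using hnorm_eq_zero[OF y True] x by simp
next
  case False
  define c where "c = hinner H x y / hinner H y y"
  have yy: "hinner H y y \<noteq> 0" using False hinner_self[OF y] by simp
  have "hinner H (x \<ominus>\<^bsub>H\<^esub> c \<odot>\<^bsub>H\<^esub> y) (x \<ominus>\<^bsub>H\<^esub> c \<odot>\<^bsub>H\<^esub> y) =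
      hinner H x x - cnj c * hinner H x y"
    using x y yy by (simp add: hinner_simps algebra_simps c_def
        hinner_commute[OF x y] hinner_self[OF y])
  also have "cnj c * hinner H x y = of_real ((cmod (hinner H x y))\<^sup>2 / (hnorm H y)\<^sup>2)"
    unfolding c_def by (simp add: hinner_self[OF y] mult.commute flip: complex_norm_square of_real_power of_real_divide)
  finally have "hinner H (x \<ominus>\<^bsub>H\<^esub> c \<odot>\<^bsub>H\<^esub> y) (x \<ominus>\<^bsub>H\<^esub> c \<odot>\<^bsub>H\<^esub> y) =
      of_real ((hnorm H x)\<^sup>2 - (cmod (hinner H x y))\<^sup>2 / (hnorm H y)\<^sup>2)"
    by (simp add: hinner_self[OF x])
  then have "0 \<le> (hnorm H x)\<^sup>2 - (cmod (hinner H x y))\<^sup>2 / (hnorm H y)\<^sup>2"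
    using hinner_nonneg[of "x \<ominus>\<^bsub>H\<^esub> c \<odot>\<^bsub>H\<^esub> y"] x y by simp
  then have "(cmod (hinner H x y))\<^sup>2 \<le> (hnorm H x * hnorm H y)\<^sup>2"
    using False by (simp add: field_simps power_mult_distrib)
  then show ?thesis
    by (rule power2_le_imp_le) (use x y in simp)
qed

lemma hnorm_triangle:
  assumes x: "x \<in> carrier H" and y: "y \<in> carrier H"
  shows "hnorm H (x \<oplus>\<^bsub>H\<^esub> y) \<le> hnorm H x + hnorm H y"
proof -
  have "Re (hinner H x y) \<le> hnorm H x * hnorm H y"
    using hinner_cauchy_schwarz[OF x y] complex_Re_le_cmod order_trans by blast
  moreover have "Re (hinner H y x) = Re (hinner H x y)"
    using hinner_commute[OF x y] by simp
  ultimately have "(hnorm H (x \<oplus>\<^bsub>H\<^esub> y))\<^sup>2 \<le> (hnorm H x + hnorm H y)\<^sup>2"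
    using x y by (simp add: hnorm_sq hinner_simps power2_sum)
  then show ?thesis
    by (rule power2_le_imp_le) (use x y in simp)
qed

lemma minus_eq_add_smult:
  assumes "x \<in> carrier H" "y \<in> carrier H"
  shows "x \<ominus>\<^bsub>H\<^esub> y = x \<oplus>\<^bsub>H\<^esub> (-1) \<odot>\<^bsub>H\<^esub> y"
  using assms by (intro hinner_ext) (auto simp: hinner_simps)

lemma hnorm_minus_commute:
  assumes "x \<in> carrier H" "y \<in> carrier H"
  shows "hnorm H (x \<ominus>\<^bsub>H\<^esub> y) = hnorm H (y \<ominus>\<^bsub>H\<^esub> x)"
proof -
  have "hinner H (x \<ominus>\<^bsub>H\<^esub> y) (x \<ominus>\<^bsub>H\<^esub> y) = hinner H (y \<ominus>\<^bsub>H\<^esub> x) (y \<ominus>\<^bsub>H\<^esub> x)"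
    using assms by (simp add: hinner_simps)
  then show ?thesis by (simp add: hnorm_def)
qed

lemma hnorm_triangle_minus3:
  assumes x: "x \<in> carrier H" and y: "y \<in> carrier H" and z: "z \<in> carrier H"
  shows "hnorm H (x \<ominus>\<^bsub>H\<^esub> z) \<le> hnorm H (x \<ominus>\<^bsub>H\<^esub> y) + hnorm H (y \<ominus>\<^bsub>H\<^esub> z)"
proof -
  have "x \<ominus>\<^bsub>H\<^esub> z = (x \<ominus>\<^bsub>H\<^esub> y) \<oplus>\<^bsub>H\<^esub> (y \<ominus>\<^bsub>H\<^esub> z)"
    using assms by (intro hinner_ext) (auto simp: hinner_simps)
  then show ?thesis
    using hnorm_triangle[of "x \<ominus>\<^bsub>H\<^esub> y" "y \<ominus>\<^bsub>H\<^esub> z"] assms by simp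
qed

section \<open>Linear maps, bounded operators and their powers\<close>

lemma linear_mapD:
  assumes "linear_map H K T"
  shows "x \<in> carrier H \<Longrightarrow> T x \<in> carrier K"
    and "x \<in> carrier H \<Longrightarrow> y \<in> carrier H \<Longrightarrow> T (x \<oplus>\<^bsub>H\<^esub> y) = T x \<oplus>\<^bsub>K\<^esub> T y"
    and "x \<in> carrier H \<Longrightarrow> T (c \<odot>\<^bsub>H\<^esub> x) = c \<odot>\<^bsub>K\<^esub> T x"
  using assms by (auto simp: linear_map_def)

lemma linear_map_minus:
  assumes "linear_map H H T" "x \<in> carrier H" "y \<in> carrier H"
  shows "T (x \<ominus>\<^bsub>H\<^esub> y) = T x \<ominus>\<^bsub>H\<^esub> T y"
  using assms by (simp add: minus_eq_add_smult linear_mapD[OF assms(1)])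

lemma bounded_operatorD:
  assumes "bounded_operator H T"
  shows "linear_map H H T" "x \<in> carrier H \<Longrightarrow> T x \<in> carrier H"
    and "\<exists>C>0. \<forall>x\<in>carrier H. hnorm H (T x) \<le> C * hnorm H x"
proof -
  show lin: "linear_map H H T" using assms by (simp add: bounded_operator_def)
  show "x \<in> carrier H \<Longrightarrow> T x \<in> carrier H" using lin linear_mapD by blast
  obtain C where C: "\<forall>x\<in>carrier H. hnorm H (T x) \<le> C * hnorm H x"
    using assms by (auto simp: bounded_operator_def)
  have "hnorm H (T x) \<le> max C 1 * hnorm H x" if "x \<in> carrier H" for x
    by (rule order_trans[OF C[rule_format, OF that]]) (simp add: mult_right_mono that)
  then show "\<exists>C>0. \<forall>x\<in>carrier H. hnorm H (T x) \<le> C * hnorm H x"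
    by (intro exI[of _ "max C 1"]) auto
qed

text \<open>The adjoint relation moves \<open>T\<close> off a linear combination, where the inner
  product is additive and homogeneous. Operators given by an adjoint relation are thereby linear for
  free.\<close>

lemma linear_map_if_adjoint:
  assumes T: "\<And>x. x \<in> carrier H \<Longrightarrow> T x \<in> carrier H"
    and S: "\<And>x. x \<in> carrier H \<Longrightarrow> S x \<in> carrier H"
    and adj: "\<And>x y. x \<in> carrier H \<Longrightarrow> y \<in> carrier H \<Longrightarrow> hinner H (T x) y = hinner H x (S y)"
  shows "linear_map H H T"
  unfolding linear_map_def
proof (intro conjI ballI allI)
  show "T \<in> carrier H \<rightarrow> carrier H" using T by auto
qed (rule hinner_ext; use T S adj in \<open>simp add: hinner_simps\<close>)+

lemma bounded_operator_compose:
  assumes S: "bounded_operator H S" and T: "bounded_operator H T"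
  shows "bounded_operator H (\<lambda>x. S (T x))"
proof -
  obtain C where C: "C > 0" "\<forall>x\<in>carrier H. hnorm H (S x) \<le> C * hnorm H x"
    using bounded_operatorD(3)[OF S] by blast
  obtain D where D: "D > 0" "\<forall>x\<in>carrier H. hnorm H (T x) \<le> D * hnorm H x"
    using bounded_operatorD(3)[OF T] by blast
  have "hnorm H (S (T x)) \<le> (C * D) * hnorm H x" if x: "x \<in> carrier H" for x
  proof -
    have "hnorm H (S (T x)) \<le> C * hnorm H (T x)" using C bounded_operatorD(2)[OF T x] by blast
    also have "\<dots> \<le> C * (D * hnorm H x)" using C D x by (intro mult_left_mono) auto
    finally show ?thesis by simp
  qed
  then show ?thesis
    using bounded_operatorD(1)[OF S] bounded_operatorD(1)[OF T]
    by (auto simp: bounded_operator_def linear_map_def Pi_iff)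
qed

lemma bounded_operator_id: "bounded_operator H (\<lambda>x. x)"
  by (auto simp: bounded_operator_def linear_map_def intro!: exI[of _ 1])

lemma bounded_operator_funpow: "bounded_operator H T \<Longrightarrow> bounded_operator H (T ^^ n)"
proof (induction n)
  case 0
  then show ?case using bounded_operator_id by (simp add: id_def)
next
  case (Suc n)
  then show ?case using bounded_operator_compose[of T "T ^^ n"] by (simp add: comp_def)
qed

lemma bounded_operator_smult:
  assumes "bounded_operator H T"
  shows "bounded_operator H (\<lambda>x. c \<odot>\<^bsub>H\<^esub> T x)"
proof -
  obtain C where C: "\<forall>x\<in>carrier H. hnorm H (T x) \<le> C * hnorm H x"
    using assms by (auto simp: bounded_operator_def)
  have "hnorm H (c \<odot>\<^bsub>H\<^esub> T x) \<le> (cmod c * C) * hnorm H x" if "x \<in> carrier H" for x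
    using C that by (simp add: hnorm_smult bounded_operatorD(2)[OF assms] mult.assoc mult_left_mono)
  moreover have "linear_map H H (\<lambda>x. c \<odot>\<^bsub>H\<^esub> T x)"
    unfolding linear_map_def
    by (auto intro!: hinner_ext simp: hinner_simps bounded_operatorD(2)[OF assms]
        linear_mapD(2,3)[OF bounded_operatorD(1)[OF assms]] algebra_simps)
  ultimately show ?thesis unfolding bounded_operator_def by blast
qed

lemma funpow_closed:
  "\<lbrakk>\<And>x. x \<in> carrier H \<Longrightarrow> T x \<in> carrier H; x \<in> carrier H\<rbrakk> \<Longrightarrow> (T ^^ n) x \<in> carrier H"
  by (induction n) auto

lemma funpow_commute_carrier:
  assumes "\<And>x. x \<in> carrier H \<Longrightarrow> T x \<in> carrier H"
    and "\<And>x. x \<in> carrier H \<Longrightarrow> S (T x) = T (S x)"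
    and "\<And>x. x \<in> carrier H \<Longrightarrow> S x \<in> carrier H" and "x \<in> carrier H"
  shows "S ((T ^^ n) x) = (T ^^ n) (S x)"
  using assms(4) by (induction n) (auto simp: assms funpow_closed)

lemma funpow_adjoint:
  assumes "\<And>x. x \<in> carrier H \<Longrightarrow> T x \<in> carrier H"
    and "\<And>x. x \<in> carrier H \<Longrightarrow> S x \<in> carrier H"
    and "\<And>x y. x \<in> carrier H \<Longrightarrow> y \<in> carrier H \<Longrightarrow> hinner H (T x) y = hinner H x (S y)"
    and "x \<in> carrier H" "y \<in> carrier H"
  shows "hinner H ((T ^^ n) x) y = hinner H x ((S ^^ n) y)"
  using assms(4,5)
proof (induction n arbitrary: y)
  case (Suc n)
  then show ?case
    using assms(1-3) by (simp add: funpow_closed) (metis funpow_swap1)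
qed auto

lemma hnorm_funpow_le:
  assumes "\<And>x. x \<in> carrier H \<Longrightarrow> T x \<in> carrier H"
    and "\<And>x. x \<in> carrier H \<Longrightarrow> hnorm H (T x) \<le> C * hnorm H x" "C \<ge> 0" "x \<in> carrier H"
  shows "hnorm H ((T ^^ n) x) \<le> C ^ n * hnorm H x"
proof (induction n)
  case (Suc n)
  have "hnorm H (T ((T ^^ n) x)) \<le> C * hnorm H ((T ^^ n) x)"
    using assms by (simp add: funpow_closed)
  also have "\<dots> \<le> C * (C ^ n * hnorm H x)" using Suc assms by (intro mult_left_mono) auto
  finally show ?case by simp
qed auto

end

section \<open>The theorem of Fuglede\<close>

context hilbert_space
begin

lemma linear_map_funpow: "linear_map H H T \<Longrightarrow> linear_map H H (T ^^ n)"
proof (induction n)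
  case (Suc n)
  then show ?case by (auto simp: linear_map_def Pi_iff)
qed (auto simp: linear_map_def)

lemma funpow_compose_commute:
  assumes P: "\<And>x. x \<in> carrier H \<Longrightarrow> P x \<in> carrier H"
    and Q: "\<And>x. x \<in> carrier H \<Longrightarrow> Q x \<in> carrier H"
    and comm: "\<And>x. x \<in> carrier H \<Longrightarrow> P (Q x) = Q (P x)" and x: "x \<in> carrier H"
  shows "((\<lambda>x. P (Q x)) ^^ n) x = (P ^^ n) ((Q ^^ n) x)"
proof (induction n)
  case (Suc n)
  have "Q ((P ^^ n) ((Q ^^ n) x)) = (P ^^ n) (Q ((Q ^^ n) x))"
    by (rule funpow_commute_carrier) (use assms in \<open>auto intro: funpow_closed\<close>)
  then show ?case using Suc by simp
qed auto

text \<open>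
  Rosenblum's argument, with \<open>exp X\<close> replaced by the polynomial \<open>(1 + X/n)\<^sup>n\<close>: the function
  \<open>\<zeta> \<mapsto> (1 + \<zeta>S/n)\<^sup>n A (1 - \<zeta>S/n)\<^sup>n\<close> is a polynomial whose derivative at \<open>0\<close> is \<open>SA - AS\<close> for every \<open>n\<close>,
  and on each disc its bound tends to that of \<open>A\<close> as \<open>n\<close> grows, so Cauchy's inequality applies.
  Normality of \<open>N\<close> enters through \<open>\<parallel>F \<mu> x\<parallel> = \<parallel>E (cnj \<mu>) x\<parallel>\<close>, which gives
  \<open>\<parallel>E \<mu> (F (- cnj \<mu>) x)\<parallel> = \<parallel>E (- \<mu>) (E \<mu> x)\<parallel> = \<parallel>x - \<mu>\<^sup>2 N\<^sup>2 x\<parallel>\<close>.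
\<close>

theorem fuglede:
  assumes N: "bounded_operator H N" and S: "bounded_operator H S"
    and adj: "\<And>x y. x \<in> carrier H \<Longrightarrow> y \<in> carrier H \<Longrightarrow> hinner H (N x) y = hinner H x (S y)"
    and NS: "\<And>x. x \<in> carrier H \<Longrightarrow> N (S x) = S (N x)"
    and A: "bounded_operator H A"
    and AN: "\<And>x. x \<in> carrier H \<Longrightarrow> A (N x) = N (A x)"
    and x: "x \<in> carrier H"
  shows "A (S x) = S (A x)"
proof -
  note cl [simp] = bounded_operatorD(2)[OF N] bounded_operatorD(2)[OF S] bounded_operatorD(2)[OF A]
  note lN = bounded_operatorD(1)[OF N] and lS = bounded_operatorD(1)[OF S]
    and lA = bounded_operatorD(1)[OF A]
  note lin = linear_mapD(2,3)[OF lN] linear_mapD(2,3)[OF lS] linear_mapD(2,3)[OF lA]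
  have adj': "hinner H (S x) y = hinner H x (N y)" if "x \<in> carrier H" "y \<in> carrier H" for x y
    using that adj by (metis hinner_commute cl(1,2))
  obtain c1 c2 where c12: "c1 > 0" "c2 > 0"
    "\<forall>x\<in>carrier H. hnorm H (N x) \<le> c1 * hnorm H x" "\<forall>x\<in>carrier H. hnorm H (S x) \<le> c2 * hnorm H x"
    using bounded_operatorD(3)[OF N] bounded_operatorD(3)[OF S] by blast
  define c where "c = max c1 c2"
  have c0: "c \<ge> 0" using c12 by (simp add: c_def)
  have cN: "hnorm H (N x) \<le> c * hnorm H x" if "x \<in> carrier H" for x
    by (rule order_trans[OF c12(3)[rule_format, OF that]]) (simp add: c_def mult_right_mono that)
  have cS: "hnorm H (S x) \<le> c * hnorm H x" if "x \<in> carrier H" for x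
    by (rule order_trans[OF c12(4)[rule_format, OF that]]) (simp add: c_def mult_right_mono that)
  obtain a where a0: "a > 0" and a: "\<And>x. x \<in> carrier H \<Longrightarrow> hnorm H (A x) \<le> a * hnorm H x"
    using bounded_operatorD(3)[OF A] by blast

  \<comment> \<open>With \<open>\<mu>\<close> divided by n, the n-th powers of these factors imitate
    exp(\<mu>N) and exp(\<mu>S).\<close>
  define E where "E \<mu> x = x \<oplus>\<^bsub>H\<^esub> \<mu> \<odot>\<^bsub>H\<^esub> N x" for \<mu> x
  define F where "F \<mu> x = x \<oplus>\<^bsub>H\<^esub> \<mu> \<odot>\<^bsub>H\<^esub> S x" for \<mu> x
  have Ecl [simp]: "E \<mu> x \<in> carrier H" and Fcl [simp]: "F \<mu> x \<in> carrier H"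
    if "x \<in> carrier H" for \<mu> x
    using that by (auto simp: E_def F_def)
  have Epcl [simp]: "(E \<mu> ^^ k) x \<in> carrier H" and Fpcl [simp]: "(F \<mu> ^^ k) x \<in> carrier H"
    if "x \<in> carrier H" for \<mu> x k
    using that by (auto intro: funpow_closed)
  have EF_adj: "hinner H (E \<mu> x) y = hinner H x (F (cnj \<mu>) y)"
    and FE_adj: "hinner H (F \<mu> x) y = hinner H x (E (cnj \<mu>) y)"
    if "x \<in> carrier H" "y \<in> carrier H" for x y \<mu>
    using that by (simp_all add: E_def F_def hinner_simps adj adj')
  have lE: "linear_map H H (E \<mu>)" for \<mu>
    by (rule linear_map_if_adjoint[of _ "F (cnj \<mu>)"]) (auto simp: EF_adj)
  have lF: "linear_map H H (F \<mu>)" for \<mu>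
    by (rule linear_map_if_adjoint[of _ "E (cnj \<mu>)"]) (auto simp: FE_adj)
  have EF: "E \<mu> (F \<nu> x) = F \<nu> (E \<mu> x)" if "x \<in> carrier H" for \<mu> \<nu> x
    using that by (intro hinner_ext) (auto simp: E_def F_def hinner_simps lin NS algebra_simps)
  have FF: "F \<mu> (F \<nu> x) = F \<nu> (F \<mu> x)" if "x \<in> carrier H" for \<mu> \<nu> x
    using that by (intro hinner_ext) (auto simp: F_def hinner_simps lin algebra_simps)
  have AE: "A (E \<mu> x) = E \<mu> (A x)" if "x \<in> carrier H" for \<mu> x
    using that by (simp add: E_def lin AN)
  have EEm: "E (- \<mu>) (E \<mu> x) = x \<oplus>\<^bsub>H\<^esub> (- (\<mu>\<^sup>2)) \<odot>\<^bsub>H\<^esub> N (N x)"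
    and FFm: "F \<mu> (F (- \<mu>) x) = x \<oplus>\<^bsub>H\<^esub> (- (\<mu>\<^sup>2)) \<odot>\<^bsub>H\<^esub> S (S x)" if "x \<in> carrier H" for \<mu> x
    using that by (auto intro!: hinner_ext
        simp: E_def F_def hinner_simps lin algebra_simps power2_eq_square)
  have norm_FE: "hnorm H (F \<mu> x) = hnorm H (E (cnj \<mu>) x)" if "x \<in> carrier H" for \<mu> x
  proof -
    have "hinner H (F \<mu> x) (F \<mu> x) = hinner H (E (cnj \<mu>) x) (E (cnj \<mu>) x)"
      using that by (simp add: FE_adj EF_adj EF)
    then show ?thesis by (simp add: hnorm_def)
  qed
  have NNb: "hnorm H (\<mu>\<^sup>2 \<odot>\<^bsub>H\<^esub> N (N x)) \<le> (cmod \<mu> * c)\<^sup>2 * hnorm H x"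
    and SSb: "hnorm H (\<mu>\<^sup>2 \<odot>\<^bsub>H\<^esub> S (S x)) \<le> (cmod \<mu> * c)\<^sup>2 * hnorm H x" if "x \<in> carrier H" for \<mu> x
  proof -
    have "hnorm H (N (N x)) \<le> c * (c * hnorm H x)" "hnorm H (S (S x)) \<le> c * (c * hnorm H x)"
      using that c0 by (auto intro!: order_trans[OF cN] order_trans[OF cS] mult_left_mono cN cS)
    then have "(cmod \<mu>)\<^sup>2 * hnorm H (N (N x)) \<le> (cmod \<mu>)\<^sup>2 * (c * (c * hnorm H x))"
      "(cmod \<mu>)\<^sup>2 * hnorm H (S (S x)) \<le> (cmod \<mu>)\<^sup>2 * (c * (c * hnorm H x))"
      by (auto intro!: mult_left_mono)
    then show "hnorm H (\<mu>\<^sup>2 \<odot>\<^bsub>H\<^esub> N (N x)) \<le> (cmod \<mu> * c)\<^sup>2 * hnorm H x"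
      "hnorm H (\<mu>\<^sup>2 \<odot>\<^bsub>H\<^esub> S (S x)) \<le> (cmod \<mu> * c)\<^sup>2 * hnorm H x"
      using that by (simp_all add: hnorm_smult norm_power norm_mult power_mult_distrib power2_eq_square mult_ac)
  qed
  have neg: "(- k) \<odot>\<^bsub>H\<^esub> x = (-1) \<odot>\<^bsub>H\<^esub> (k \<odot>\<^bsub>H\<^esub> x)" if "x \<in> carrier H" for k x
    using that by (intro hinner_ext) (auto simp: hinner_simps)
  have Wb: "hnorm H (E \<mu> (F (- cnj \<mu>) x)) \<le> (1 + (cmod \<mu> * c)\<^sup>2) * hnorm H x"
    if "x \<in> carrier H" for \<mu> x
  proof -
    have "hnorm H (E \<mu> (F (- cnj \<mu>) x)) = hnorm H (E (- \<mu>) (E \<mu> x))"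
      using that by (simp add: EF norm_FE)
    also have "\<dots> \<le> hnorm H x + (cmod \<mu> * c)\<^sup>2 * hnorm H x"
      unfolding EEm[OF that]
      by (rule order_trans[OF hnorm_triangle])
        (use that NNb[OF that, of \<mu>] in \<open>auto simp: neg[of "N (N x)"] hnorm_smult\<close>)
    finally show ?thesis by (simp add: algebra_simps)
  qed
  have Zd: "hnorm H (x \<ominus>\<^bsub>H\<^esub> F \<mu> (F (- \<mu>) x)) \<le> (cmod \<mu> * c)\<^sup>2 * hnorm H x"
    if "x \<in> carrier H" for \<mu> x
  proof -
    have "x \<ominus>\<^bsub>H\<^esub> F \<mu> (F (- \<mu>) x) = \<mu>\<^sup>2 \<odot>\<^bsub>H\<^esub> S (S x)"
      using that by (intro hinner_ext) (auto simp: FFm hinner_simps)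
    then show ?thesis using SSb[OF that] by simp
  qed
  have Zb: "hnorm H (F \<mu> (F (- \<mu>) x)) \<le> (1 + (cmod \<mu> * c)\<^sup>2) * hnorm H x"
    if "x \<in> carrier H" for \<mu> x
    unfolding FFm[OF that]
    by (rule order_trans[OF hnorm_triangle])
      (use that SSb[OF that, of \<mu>] in \<open>auto simp: neg[of "S (S x)"] hnorm_smult algebra_simps\<close>)
  \<comment> \<open>\<open>F \<mu>\<close> and \<open>F (- \<mu>)\<close> are inverse to each other
    only up to the term \<mu>^2 S^2. Telescoping measures how far k such products drift from the
    identity; for |\<mu>| = \<rho>/n and k = n the drift is O(1/n).\<close>
  have Zpd: "hnorm H (x \<ominus>\<^bsub>H\<^esub> ((\<lambda>x. F \<mu> (F (- \<mu>) x)) ^^ k) x) \<le>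
      k * (cmod \<mu> * c)\<^sup>2 * (1 + (cmod \<mu> * c)\<^sup>2) ^ k * hnorm H x" if x: "x \<in> carrier H" for \<mu> x k
  proof (induction k)
    case 0
    then show ?case using x hnorm_zero by (simp add: a_minus_def r_neg)
  next
    case (Suc k)
    let ?Z = "\<lambda>x. F \<mu> (F (- \<mu>) x)" and ?d = "(cmod \<mu> * c)\<^sup>2"
    have Zk: "(?Z ^^ k) x \<in> carrier H" by (rule funpow_closed) (use x in auto)
    have "hnorm H (x \<ominus>\<^bsub>H\<^esub> (?Z ^^ Suc k) x) \<le>
        hnorm H (x \<ominus>\<^bsub>H\<^esub> (?Z ^^ k) x) + hnorm H ((?Z ^^ k) x \<ominus>\<^bsub>H\<^esub> ?Z ((?Z ^^ k) x))"
      using hnorm_triangle_minus3[of x "(?Z ^^ k) x" "?Z ((?Z ^^ k) x)"] x Zk by simp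
    also have "\<dots> \<le> k * ?d * (1 + ?d) ^ k * hnorm H x + ?d * hnorm H ((?Z ^^ k) x)"
      by (intro add_mono Suc Zd Zk)
    also have "\<dots> \<le> k * ?d * (1 + ?d) ^ k * hnorm H x + ?d * ((1 + ?d) ^ k * hnorm H x)"
      by (intro add_left_mono mult_left_mono hnorm_funpow_le Zb) (use x in auto)
    also have "\<dots> = Suc k * ?d * (1 + ?d) ^ k * hnorm H x"
      by (simp add: algebra_simps)
    also have "\<dots> \<le> Suc k * ?d * (1 + ?d) ^ Suc k * hnorm H x"
      by (intro mult_right_mono mult_left_mono power_increasing) (use x in auto)
    finally show ?case .
  qed
  have Eb: "hnorm H (E \<mu> x) \<le> (1 + cmod \<mu> * c) * hnorm H x"
    and Fb: "hnorm H (F \<mu> x) \<le> (1 + cmod \<mu> * c) * hnorm H x" if "x \<in> carrier H" for \<mu> x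
  proof -
    have "cmod \<mu> * hnorm H (N x) \<le> cmod \<mu> * (c * hnorm H x)"
      "cmod \<mu> * hnorm H (S x) \<le> cmod \<mu> * (c * hnorm H x)"
      using that cN cS by (auto intro!: mult_left_mono)
    then show "hnorm H (E \<mu> x) \<le> (1 + cmod \<mu> * c) * hnorm H x"
      "hnorm H (F \<mu> x) \<le> (1 + cmod \<mu> * c) * hnorm H x"
      unfolding E_def F_def
      by (auto intro!: order_trans[OF hnorm_triangle] simp: that hnorm_smult algebra_simps)
  qed

  \<comment> \<open>\<open>f n n n\<close> is a matrix entry of the polynomial described above, with
    (1 + \<zeta>S/n)^n carried to the second slot as a power of \<open>E\<close>. That slot is
    conjugate linear, which the \<open>cnj\<close> in the argument of \<open>E\<close> compensates,
    so \<open>f\<close> is holomorphic in \<zeta>. Separate exponents \<open>j\<close> and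
    \<open>k\<close> let \<open>f_k\<close> and \<open>f_j\<close> peel off one factor at a
    time.\<close>
  define f where "f n j k x y \<zeta> = hinner H (A ((F (- (\<zeta> / of_nat n)) ^^ k) x)) ((E (cnj (\<zeta> / of_nat n)) ^^ j) y)"
    for n j k :: nat and x y \<zeta>
  have lEp: "linear_map H H (E \<mu> ^^ j)" and lFp: "linear_map H H (F \<mu> ^^ j)" for \<mu> j
    using lE lF linear_map_funpow by auto
  have f_k: "f n j (Suc k) x y \<zeta> = f n j k x y \<zeta> - \<zeta> / of_nat n * f n j k (S x) y \<zeta>"
    if "x \<in> carrier H" "y \<in> carrier H" for n j k x y \<zeta>
    using that unfolding f_def
    by (simp add: funpow_Suc_right F_def[of _ x] linear_mapD(2,3)[OF lFp] lin hinner_simps del: funpow.simps)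
  have f_j: "f n (Suc j) k x y \<zeta> = f n j k x y \<zeta> + \<zeta> / of_nat n * f n j k x (N y) \<zeta>"
    if "x \<in> carrier H" "y \<in> carrier H" for n j k x y \<zeta>
    using that unfolding f_def
    by (simp add: funpow_Suc_right E_def[of _ y] linear_mapD(2,3)[OF lEp] lin hinner_simps del: funpow.simps)
  have f_0: "f n j k x y 0 = hinner H (A x) y" if "x \<in> carrier H" "y \<in> carrier H" for n j k x y
    using that by (induction j) (induction k, auto simp: f_k f_j, simp add: f_def)
  have deriv_f: "\<exists>f'. (\<forall>\<zeta>. (f n j k x y has_field_derivative f' \<zeta>) (at \<zeta>)) \<and>
      f' 0 = (of_nat j * hinner H (A x) (N y) - of_nat k * hinner H (A (S x)) y) / of_nat n"
    if "x \<in> carrier H" "y \<in> carrier H" for n j k x y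
    using that
  proof (induction j arbitrary: y)
    case 0
    then show ?case
    proof (induction k arbitrary: x)
      case 0
      have "f n 0 0 x y = (\<lambda>_. hinner H (A x) y)" by (simp add: f_def fun_eq_iff)
      then show ?case by (intro exI[of _ "\<lambda>_. 0"]) simp
    next
      case (Suc k)
      obtain g where g: "\<And>\<zeta>. (f n 0 k x y has_field_derivative g \<zeta>) (at \<zeta>)"
        "g 0 = (of_nat 0 * hinner H (A x) (N y) - of_nat k * hinner H (A (S x)) y) / of_nat n"
        using Suc by blast
      obtain h where h: "\<And>\<zeta>. (f n 0 k (S x) y has_field_derivative h \<zeta>) (at \<zeta>)"
        using Suc.IH[of "S x"] Suc.prems by auto
      have "(f n 0 (Suc k) x y has_field_derivative
          g \<zeta> - (1 / of_nat n * f n 0 k (S x) y \<zeta> + \<zeta> / of_nat n * h \<zeta>)) (at \<zeta>)" for \<zeta>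
        using DERIV_diff[OF g(1) DERIV_mult[OF DERIV_cdivide[OF DERIV_ident] h]] Suc.prems
        by (simp add: f_k[OF Suc.prems, abs_def] mult.commute)
      then show ?case
        using Suc.prems g(2)
        by (intro exI[of _ "\<lambda>\<zeta>. g \<zeta> - (1 / of_nat n * f n 0 k (S x) y \<zeta> + \<zeta> / of_nat n * h \<zeta>)"])
          (auto simp: f_0 diff_divide_distrib add_divide_distrib algebra_simps)
    qed
  next
    case (Suc j)
    obtain g where g: "\<And>\<zeta>. (f n j k x y has_field_derivative g \<zeta>) (at \<zeta>)"
      "g 0 = (of_nat j * hinner H (A x) (N y) - of_nat k * hinner H (A (S x)) y) / of_nat n"
      using Suc by blast
    obtain h where h: "\<And>\<zeta>. (f n j k x (N y) has_field_derivative h \<zeta>) (at \<zeta>)"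
      using Suc.IH[of "N y"] Suc.prems by auto
    have "(f n (Suc j) k x y has_field_derivative
        g \<zeta> + (1 / of_nat n * f n j k x (N y) \<zeta> + \<zeta> / of_nat n * h \<zeta>)) (at \<zeta>)" for \<zeta>
      using DERIV_add[OF g(1) DERIV_mult[OF DERIV_cdivide[OF DERIV_ident] h]] Suc.prems
      by (simp add: f_j[OF Suc.prems, abs_def] mult.commute)
    then show ?case
      using Suc.prems g(2)
      by (intro exI[of _ "\<lambda>\<zeta>. g \<zeta> + (1 / of_nat n * f n j k x (N y) \<zeta> + \<zeta> / of_nat n * h \<zeta>)"])
        (auto simp: f_0 diff_divide_distrib add_divide_distrib algebra_simps)
  qed

  have bound: "cmod (f n n n x y \<zeta>) \<le>
      (a * ((1 + (\<rho> * c / n)\<^sup>2) ^ n)\<^sup>2 +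
        a * (exp (\<rho> * c))\<^sup>2 * (n * (\<rho> * c / n)\<^sup>2 * (1 + (\<rho> * c / n)\<^sup>2) ^ n)) * (hnorm H x * hnorm H y)"
    if x: "x \<in> carrier H" and y: "y \<in> carrier H" and \<zeta>: "cmod \<zeta> = \<rho>" and n: "n > 0" for n x y \<zeta> \<rho>
  proof -
    define \<mu> where "\<mu> = cnj (\<zeta> / of_nat n)"
    have cm: "cnj \<mu> = \<zeta> / of_nat n" by (simp add: \<mu>_def)
    have mu: "cmod \<mu> = \<rho> / n" using \<zeta> by (simp add: \<mu>_def norm_divide)
    have d: "(cmod \<mu> * c)\<^sup>2 = (\<rho> * c / n)\<^sup>2" by (simp add: mu)
    let ?W = "\<lambda>x. E \<mu> (F (- cnj \<mu>) x)" and ?W' = "\<lambda>x. F (- cnj \<mu>) (E \<mu> x)"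
    let ?Z = "\<lambda>x. F (cnj \<mu>) (F (- cnj \<mu>) x)"
    let ?u = "(F (- cnj \<mu>) ^^ n) x" and ?v = "(E \<mu> ^^ n) y"
    have fe: "f n n n x y \<zeta> = hinner H (A ?u) ?v"
      unfolding f_def cm[symmetric] by simp
    have W1: "(?W ^^ n) x = (E \<mu> ^^ n) ?u"
      by (rule funpow_compose_commute) (auto simp: x EF)
    have W2: "(?W' ^^ n) y = (F (- cnj \<mu>) ^^ n) ?v"
      by (rule funpow_compose_commute) (auto simp: y EF)
    have Z1: "(?Z ^^ n) ?v = (F (cnj \<mu>) ^^ n) ((F (- cnj \<mu>) ^^ n) ?v)"
      by (rule funpow_compose_commute) (auto simp: y FF)
    have "hinner H (A ((?W ^^ n) x)) ((?W' ^^ n) y) = hinner H ((E \<mu> ^^ n) (A ?u)) ((F (- cnj \<mu>) ^^ n) ?v)"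
      unfolding W1 W2
      by (subst funpow_commute_carrier[of "E \<mu>" A]) (auto simp: x AE)
    also have "\<dots> = hinner H (A ?u) ((F (cnj \<mu>) ^^ n) ((F (- cnj \<mu>) ^^ n) ?v))"
      by (rule funpow_adjoint) (auto simp: EF_adj x y)
    finally have g: "hinner H (A ((?W ^^ n) x)) ((?W' ^^ n) y) = hinner H (A ?u) ((?Z ^^ n) ?v)"
      by (simp add: Z1)
    have Zc: "(?Z ^^ n) ?v \<in> carrier H" by (rule funpow_closed) (auto simp: y)
    have Wc: "(?W ^^ n) x \<in> carrier H" "(?W' ^^ n) y \<in> carrier H"
      using x y by (auto intro!: funpow_closed)
    \<comment> \<open>Because \<open>E\<close> commutes with \<open>A\<close>, its powers can be
      inserted around \<open>A\<close>; they complete the factors to \<open>?W\<close> and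
      \<open>?W'\<close>, whose norms are at most 1 + O(1/n^2). For true exponentials
      \<open>?Z\<close> would be the identity and the second summand would vanish.\<close>
    have split: "f n n n x y \<zeta> =
        hinner H (A ((?W ^^ n) x)) ((?W' ^^ n) y) + hinner H (A ?u) (?v \<ominus>\<^bsub>H\<^esub> (?Z ^^ n) ?v)"
      unfolding fe g using x y Zc by (simp add: hinner_minus_right)
    have e: "(1 + cmod \<mu> * c) ^ n \<le> exp (\<rho> * c)"
    proof -
      have "(1 + cmod \<mu> * c) ^ n \<le> exp (cmod \<mu> * c) ^ n"
        by (intro power_mono exp_ge_add_one_self) (use c0 in simp)
      also have "\<dots> = exp (\<rho> * c)"
        using n by (simp add: mu flip: exp_of_nat_mult)
      finally show ?thesis .
    qed
    have u: "hnorm H ?u \<le> exp (\<rho> * c) * hnorm H x"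
    proof -
      have "hnorm H ?u \<le> (1 + cmod \<mu> * c) ^ n * hnorm H x"
        by (rule hnorm_funpow_le) (use Fb[of _ "- cnj \<mu>"] x c0 in auto)
      also have "\<dots> \<le> exp (\<rho> * c) * hnorm H x" by (intro mult_right_mono e) (use x in simp)
      finally show ?thesis .
    qed
    have v: "hnorm H ?v \<le> exp (\<rho> * c) * hnorm H y"
    proof -
      have "hnorm H ?v \<le> (1 + cmod \<mu> * c) ^ n * hnorm H y"
        by (rule hnorm_funpow_le) (use Eb[of _ \<mu>] y c0 in auto)
      also have "\<dots> \<le> exp (\<rho> * c) * hnorm H y" by (intro mult_right_mono e) (use y in simp)
      finally show ?thesis .
    qed
    have w1: "hnorm H ((?W ^^ n) x) \<le> (1 + (\<rho> * c / n)\<^sup>2) ^ n * hnorm H x"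
      by (rule hnorm_funpow_le) (use Wb[of _ \<mu>] x d in auto)
    have w2: "hnorm H ((?W' ^^ n) y) \<le> (1 + (\<rho> * c / n)\<^sup>2) ^ n * hnorm H y"
      by (rule hnorm_funpow_le) (use Wb[of _ \<mu>] y d in \<open>auto simp: EF\<close>)
    have "cmod (hinner H (A ((?W ^^ n) x)) ((?W' ^^ n) y)) \<le>
        hnorm H (A ((?W ^^ n) x)) * hnorm H ((?W' ^^ n) y)"
      using Wc by (intro hinner_cauchy_schwarz) auto
    also have "\<dots> \<le> (a * hnorm H ((?W ^^ n) x)) * hnorm H ((?W' ^^ n) y)"
      using Wc by (intro mult_right_mono a) auto
    also have "\<dots> \<le> (a * ((1 + (\<rho> * c / n)\<^sup>2) ^ n * hnorm H x)) * ((1 + (\<rho> * c / n)\<^sup>2) ^ n * hnorm H y)"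
      using a0 Wc x y by (intro mult_mono mult_left_mono w1 w2) auto
    finally have p1: "cmod (hinner H (A ((?W ^^ n) x)) ((?W' ^^ n) y)) \<le>
       a * ((1 + (\<rho> * c / n)\<^sup>2) ^ n)\<^sup>2 * (hnorm H x * hnorm H y)"
      by (simp add: power2_eq_square mult_ac)
    have "cmod (hinner H (A ?u) (?v \<ominus>\<^bsub>H\<^esub> (?Z ^^ n) ?v)) \<le>
        hnorm H (A ?u) * hnorm H (?v \<ominus>\<^bsub>H\<^esub> (?Z ^^ n) ?v)"
      using x y Zc by (intro hinner_cauchy_schwarz) auto
    also have "\<dots> \<le> (a * hnorm H ?u) * (n * (cmod (cnj \<mu>) * c)\<^sup>2 * (1 + (cmod (cnj \<mu>) * c)\<^sup>2) ^ n * hnorm H ?v)"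
      using x y Zc a0 by (intro mult_mono a Zpd) auto
    also have "\<dots> \<le> (a * (exp (\<rho> * c) * hnorm H x)) * (n * (cmod (cnj \<mu>) * c)\<^sup>2 * (1 + (cmod (cnj \<mu>) * c)\<^sup>2) ^ n * (exp (\<rho> * c) * hnorm H y))"
      using x y a0 by (intro mult_mono mult_left_mono u v) auto
    also have "\<dots> = a * (exp (\<rho> * c))\<^sup>2 * (n * (\<rho> * c / n)\<^sup>2 * (1 + (\<rho> * c / n)\<^sup>2) ^ n) * (hnorm H x * hnorm H y)"
      unfolding complex_mod_cnj d by (simp only: power2_eq_square mult_ac)
    finally have p2: "cmod (hinner H (A ?u) (?v \<ominus>\<^bsub>H\<^esub> (?Z ^^ n) ?v)) \<le> \<dots>" .
    show ?thesis
      unfolding split distrib_right[of _ _ "hnorm H x * hnorm H y"]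
      by (rule order_trans[OF norm_triangle_ineq add_mono[OF p1 p2]])
  qed
  have key: "\<rho> * cmod (hinner H (A x) (N y) - hinner H (A (S x)) y) \<le> a * (hnorm H x * hnorm H y)"
    if x: "x \<in> carrier H" and y: "y \<in> carrier H" and \<rho>: "\<rho> > 0" for x y \<rho>
  proof -
    let ?D = "hinner H (A x) (N y) - hinner H (A (S x)) y"
    let ?B = "\<lambda>n::nat. (a * ((1 + (\<rho> * c / n)\<^sup>2) ^ n)\<^sup>2 +
        a * (exp (\<rho> * c))\<^sup>2 * (n * (\<rho> * c / n)\<^sup>2 * (1 + (\<rho> * c / n)\<^sup>2) ^ n)) * (hnorm H x * hnorm H y)"
    have 1: "\<rho> * cmod ?D \<le> ?B n" if n: "n > 0" for n
    proof -
      obtain f' where f': "\<And>\<zeta>. (f n n n x y has_field_derivative f' \<zeta>) (at \<zeta>)"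
         "f' 0 = (of_nat n * hinner H (A x) (N y) - of_nat n * hinner H (A (S x)) y) / of_nat n"
        using deriv_f[OF x y] by blast
      have "f' 0 = ?D" using n f'(2) by (simp add: field_simps)
      then have D: "(deriv ^^ 1) (f n n n x y) 0 = ?D" using DERIV_imp_deriv[OF f'(1)] by simp
      have "cmod ((deriv ^^ 1) (f n n n x y) 0) \<le> fact 1 * ?B n / \<rho> ^ 1"
      proof (rule Cauchy_inequality)
        show "f n n n x y holomorphic_on ball 0 \<rho>"
          using f'(1) by (meson DERIV_subset field_differentiable_def holomorphic_on_def subset_UNIV)
        show "continuous_on (cball 0 \<rho>) (f n n n x y)"
          using f'(1) DERIV_isCont continuous_at_imp_continuous_on by blast
        show "cmod (f n n n x y z) \<le> ?B n" if "cmod (0 - z) = \<rho>" for z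
          by (rule bound[OF x y _ n]) (use that in simp)
      qed (rule \<rho>)
      then show ?thesis unfolding D using \<rho> by (simp add: field_simps)
    qed
    have l2: "(\<lambda>n::nat. n * (\<rho> * c / n)\<^sup>2) \<longlonglongrightarrow> 0"
    proof -
      have "real n * (\<rho> * c / n)\<^sup>2 = (\<rho> * c)\<^sup>2 / n" for n :: nat
        by (cases "n = 0") (simp_all add: power2_eq_square)
      then show ?thesis using lim_const_over_n[of "(\<rho> * c)\<^sup>2"] by simp
    qed
    have l1: "(\<lambda>n::nat. (1 + (\<rho> * c / n)\<^sup>2) ^ n) \<longlonglongrightarrow> 1"
    proof (rule tendsto_sandwich[of "\<lambda>_. 1" _ _ "\<lambda>n::nat. exp (n * (\<rho> * c / n)\<^sup>2)"])
      show "\<forall>\<^sub>F n::nat in sequentially. (1 + (\<rho> * c / n)\<^sup>2) ^ n \<le> exp (n * (\<rho> * c / n)\<^sup>2)"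
        unfolding exp_of_nat_mult by (intro always_eventually allI power_mono exp_ge_add_one_self) simp
      show "(\<lambda>n::nat. exp (n * (\<rho> * c / n)\<^sup>2)) \<longlonglongrightarrow> 1"
        using tendsto_exp[OF l2] by simp
    qed (auto intro!: always_eventually one_le_power)
    have "?B \<longlonglongrightarrow> (a * 1\<^sup>2 + a * (exp (\<rho> * c))\<^sup>2 * (0 * 1)) * (hnorm H x * hnorm H y)"
      by (intro tendsto_intros l1 l2)
    then have "?B \<longlonglongrightarrow> a * (hnorm H x * hnorm H y)" by simp
    then show ?thesis
      by (rule LIMSEQ_le_const) (use 1 in \<open>auto intro!: exI[of _ 1]\<close>)
  qed
  have "hinner H (A (S x)) y = hinner H (S (A x)) y" if y: "y \<in> carrier H" for y
  proof (rule ccontr)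
    assume "hinner H (A (S x)) y \<noteq> hinner H (S (A x)) y"
    then have D: "cmod (hinner H (A x) (N y) - hinner H (A (S x)) y) > 0" (is "?d > 0")
      using x y by (simp add: adj')
    \<comment> \<open>At this radius \<open>key\<close> would read s + 1 \<le> s, where s is its
      right-hand side.\<close>
    let ?r = "(a * (hnorm H x * hnorm H y) + 1) / ?d"
    have "?r > 0" using D a0 x y by (intro divide_pos_pos add_nonneg_pos) auto
    then have "?r * ?d \<le> a * (hnorm H x * hnorm H y)" using key[OF x y] by blast
    then show False using D by simp
  qed
  then show ?thesis using x by (intro hinner_ext) auto
qed

end

section \<open>Positive polynomials on the unit interval\<close>

lemma real_poly_eqI: "(\<And>x. poly p x = poly q x) \<Longrightarrow> p = (q :: real poly)"
  by (simp add: poly_eq_poly_eq_iff[symmetric] fun_eq_iff)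

text \<open>
  A multiplicative cone of polynomials that are nonnegative on the unit interval for an algebraic
  reason, which therefore remain nonnegative when evaluated at an operator \<open>0 \<le> T \<le> 1\<close>.
\<close>

inductive_set unit_cone :: "real poly set" where
  square: "g \<in> {1, [:0, 1:], [:1, -1:]} \<Longrightarrow> q * q * g \<in> unit_cone"
| add: "p \<in> unit_cone \<Longrightarrow> q \<in> unit_cone \<Longrightarrow> p + q \<in> unit_cone"

lemma unit_cone_gens: "1 \<in> unit_cone" "[:0, 1:] \<in> unit_cone" "[:1, -1:] \<in> unit_cone"
  "0 \<in> unit_cone"
  using unit_cone.square[of 1 1] unit_cone.square[of "[:0, 1:]" 1] unit_cone.square[of "[:1, -1:]" 1]
    unit_cone.square[of 1 0] by simp_all

lemma unit_cone_square: "q * q \<in> unit_cone"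
  using unit_cone.square[of 1 q] by simp

lemma unit_cone_mult_gens:
  fixes g h :: "real poly"
  assumes "g \<in> {1, [:0, 1:], [:1, -1:]}" "h \<in> {1, [:0, 1:], [:1, -1:]}"
  shows "q * q * (g * h) \<in> unit_cone"
proof -
  let ?t = "[:0, 1:] :: real poly" and ?s = "[:1, -1:] :: real poly"
  \<comment> \<open>The one product of generators that is not already a square times a generator is
    t (1 - t). Multiplying by t + (1 - t) = 1 turns it into t^2 (1 - t) + (1 - t)^2 t.\<close>
  have st: "q * q * (?t * ?s) \<in> unit_cone"
  proof -
    have "q * q * (?t * ?s) = (q * ?t) * (q * ?t) * ?s + (q * ?s) * (q * ?s) * ?t"
    proof -
      have "?t + ?s = 1" by (simp add: one_pCons)
      then have "q * q * (?t * ?s) = q * q * (?t * ?s) * (?t + ?s)" by simp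
      then show ?thesis by (simp only: algebra_simps)
    qed
    then show ?thesis by (auto intro!: unit_cone.intros simp del: mult_pCons_left mult_pCons_right)
  qed
  have sq: "q * q * (g * g) \<in> unit_cone" for g
    using unit_cone_square[of "q * g"] by (simp only: mult_ac)
  from assms show ?thesis
    using st sq[of ?t] sq[of ?s] unit_cone.square[of 1 q] unit_cone.square[of ?t q]
      unit_cone.square[of ?s q]
    by (elim insertE emptyE) (simp_all only: mult_1_right mult_1_left insert_iff mult.commute[of ?s ?t] simp_thms)
qed

lemma unit_cone_mult: "p \<in> unit_cone \<Longrightarrow> q \<in> unit_cone \<Longrightarrow> p * q \<in> unit_cone"
proof (induction p rule: unit_cone.induct)
  case (square g r)
  note g = square(1)
  from square(2) show ?case
  proof (induction q rule: unit_cone.induct)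
    case (square h s)
    have "r * r * g * (s * s * h) = (r * s) * (r * s) * (g * h)" by (simp only: mult_ac)
    then show ?case using unit_cone_mult_gens[OF g square] by (simp only:)
  next
    case (add p q)
    then show ?case using unit_cone.add by (simp only: distrib_left)
  qed
next
  case (add p q)
  then show ?case using unit_cone.add by (simp only: distrib_right)
qed

lemma unit_cone_const: "c \<ge> 0 \<Longrightarrow> [:c:] \<in> unit_cone"
  using unit_cone_square[of "[:sqrt c:]"] by simp

lemma unit_cone_smult: "c \<ge> 0 \<Longrightarrow> p \<in> unit_cone \<Longrightarrow> Polynomial.smult c p \<in> unit_cone"
  using unit_cone_mult[OF unit_cone_const, of c p] by simp

lemma unit_cone_power: "p \<in> unit_cone \<Longrightarrow> p ^ n \<in> unit_cone"
  by (induction n) (auto intro: unit_cone_gens unit_cone_mult)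

text \<open>Visser's iteration, increasing on the unit interval to the square root of the variable.\<close>

fun sqrt_approx :: "real poly \<Rightarrow> nat \<Rightarrow> real poly" where
  "sqrt_approx t 0 = 0"
| "sqrt_approx t (Suc n) = sqrt_approx t n + Polynomial.smult (1/2) (t - sqrt_approx t n * sqrt_approx t n)"

text \<open>The three memberships support each other in one induction. For consecutive iterates y
  and z, 1 - z = ((1 - t) + (1 - y)^2) / 2, and the next increment is (z - y) ((1 - y) + (1 - z)) /
  2. Monotonicity is phrased by the cone and not pointwise so that it passes to operators.\<close>

lemma sqrt_approx_cone:
  assumes t: "t \<in> unit_cone" "1 - t \<in> unit_cone"
  shows "sqrt_approx t n \<in> unit_cone \<and> 1 - sqrt_approx t n \<in> unit_cone \<and>
    sqrt_approx t (Suc n) - sqrt_approx t n \<in> unit_cone"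
proof (induction n)
  case 0
  then show ?case using t by (auto simp: unit_cone_gens intro: unit_cone_smult)
next
  case (Suc n)
  define y where "y = sqrt_approx t n"
  define z where "z = sqrt_approx t (Suc n)"
  have z: "z = y + Polynomial.smult (1/2) (t - y * y)" by (simp add: z_def y_def)
  have y: "y \<in> unit_cone" "1 - y \<in> unit_cone" "z - y \<in> unit_cone"
    using Suc by (simp_all add: y_def z_def del: sqrt_approx.simps)
  have zc: "z \<in> unit_cone" using unit_cone.add[OF y(1) y(3)] by simp
  have "1 - z = Polynomial.smult (1/2) ((1 - t) + (1 - y) * (1 - y))"
    unfolding z by (rule real_poly_eqI) (simp add: algebra_simps)
  then have zc1: "1 - z \<in> unit_cone"
    using unit_cone_smult[OF _ unit_cone.add[OF t(2) unit_cone_square]] by simp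
  have "sqrt_approx t (Suc (Suc n)) - z = Polynomial.smult (1/2) ((z - y) * ((1 - y) + (1 - z)))"
  proof -
    have s: "sqrt_approx t (Suc (Suc n)) = z + Polynomial.smult (1/2) (t - z * z)" by (simp add: z_def)
    show ?thesis unfolding s
      by (rule real_poly_eqI) (simp add: z algebra_simps)
  qed
  then have "sqrt_approx t (Suc (Suc n)) - z \<in> unit_cone"
    using unit_cone_smult[OF _ unit_cone_mult[OF y(3) unit_cone.add[OF y(2) zc1]]] by simp
  then show ?case using zc zc1 by (simp add: z_def del: sqrt_approx.simps)
qed

lemma sqrt_approx_mono:
  assumes t: "t \<in> unit_cone" "1 - t \<in> unit_cone" and "m \<le> n"
  shows "sqrt_approx t n - sqrt_approx t m \<in> unit_cone"
  using \<open>m \<le> n\<close>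
proof (induction rule: dec_induct)
  case base
  then show ?case by (simp add: unit_cone_gens)
next
  case (step k)
  have "(sqrt_approx t k - sqrt_approx t m) + (sqrt_approx t (Suc k) - sqrt_approx t k) \<in> unit_cone"
    using sqrt_approx_cone[OF t, of k] step by (intro unit_cone.add) blast+
  then show ?case by (simp del: sqrt_approx.simps)
qed

text \<open>The error \<open>e\<^sub>n\<close> of the iteration for the square root of \<open>t\<^sup>2\<close> satisfies
  \<open>e\<^sub>n\<^sub>+\<^sub>1 = e\<^sub>n (1 - (t + y\<^sub>n) / 2) \<le> e\<^sub>n (1 - t / 2)\<close>.\<close>

lemma sqrt_approx_square_error:
  defines "t \<equiv> [:0, 1:] :: real poly"
  shows "sqrt_approx (t * t) n \<in> unit_cone \<and> t - sqrt_approx (t * t) n \<in> unit_cone \<and>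
    t * (1 - Polynomial.smult (1/2) t) ^ n - (t - sqrt_approx (t * t) n) \<in> unit_cone"
proof (induction n)
  case 0
  then show ?case by (simp add: t_def unit_cone_gens)
next
  case (Suc n)
  define y where "y = sqrt_approx (t * t) n"
  define z where "z = sqrt_approx (t * t) (Suc n)"
  have z: "z = y + Polynomial.smult (1/2) (t * t - y * y)" by (simp add: z_def y_def)
  have t: "t \<in> unit_cone" "1 - t \<in> unit_cone"
    using unit_cone_gens by (auto simp: t_def one_pCons)
  have y: "y \<in> unit_cone" "t - y \<in> unit_cone"
    "t * (1 - Polynomial.smult (1/2) t) ^ n - (t - y) \<in> unit_cone"
    using Suc by (simp_all add: y_def)
  have "z = y + Polynomial.smult (1/2) ((t - y) * (t + y))" unfolding z by (simp add: algebra_simps)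
  then have zc: "z \<in> unit_cone"
    using t y by (auto intro!: unit_cone.add unit_cone_smult unit_cone_mult)
  have "t - z = (t - y) * ((1 - t) + Polynomial.smult (1/2) (t - y))"
    unfolding z by (rule real_poly_eqI) (simp add: algebra_simps)
  then have tz: "t - z \<in> unit_cone"
    using t y by (auto intro!: unit_cone.add unit_cone_smult unit_cone_mult)
  have h: "1 - Polynomial.smult (1/2) t \<in> unit_cone"
  proof -
    have "1 - Polynomial.smult (1/2) t = (1 - t) + Polynomial.smult (1/2) t"
      by (rule real_poly_eqI) simp
    then show ?thesis using t unit_cone.add[OF t(2) unit_cone_smult[OF _ t(1)]] by (simp only:)
  qed
  have "t * (1 - Polynomial.smult (1/2) t) ^ Suc n - (t - z) =
      (t * (1 - Polynomial.smult (1/2) t) ^ n - (t - y)) * (1 - Polynomial.smult (1/2) t) + Polynomial.smult (1/2) (y * (t - y))"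
    unfolding z by (rule real_poly_eqI) (simp add: algebra_simps)
  then have "t * (1 - Polynomial.smult (1/2) t) ^ Suc n - (t - z) \<in> unit_cone"
    using h y by (auto intro!: unit_cone.add unit_cone_smult unit_cone_mult)
  then show ?case using zc tz by (simp add: z_def del: sqrt_approx.simps)
qed

text \<open>On the unit interval (n + 1) (1 - x) x^n is at most the sum of (1 - x) x^k over k \<le>
  n, that is 1 - x^(n+1); the induction is a form of this inside the cone. With x = 1 - t/2 it makes
  the error bound t (1 - t/2)^n of the iteration uniform, of size 2 / (n + 1).\<close>

lemma geometric_cone_bound:
  assumes "x \<in> unit_cone" "1 - x \<in> unit_cone"
  shows "1 - Polynomial.smult (real (Suc n)) ((1 - x) * x ^ n) \<in> unit_cone"
proof -
  have p: "x ^ k \<in> unit_cone" for k using assms(1) by (rule unit_cone_power)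
  have mono: "x ^ k - x ^ Suc k \<in> unit_cone" for k
    using unit_cone_mult[OF p[of k] assms(2)] by (simp add: algebra_simps)
  have one: "1 - x ^ k \<in> unit_cone" for k
  proof (induction k)
    case (Suc k)
    then show ?case using unit_cone.add[OF Suc mono[of k]] by simp
  qed (simp add: unit_cone_gens)
  show ?thesis
  proof (induction n)
    case 0
    then show ?case using assms by simp
  next
    case (Suc n)
    have "1 - Polynomial.smult (real (Suc (Suc n))) ((1 - x) * x ^ Suc n) =
       (1 - Polynomial.smult (real (Suc n)) ((1 - x) * x ^ n)) * x + (1 - x) * (1 - x ^ Suc n)"
      by (rule real_poly_eqI) (simp add: algebra_simps)
    moreover have "(1 - Polynomial.smult (real (Suc n)) ((1 - x) * x ^ n)) * x + (1 - x) * (1 - x ^ Suc n) \<in> unit_cone"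
      by (intro unit_cone.add unit_cone_mult Suc assms one)
    ultimately show ?case by simp
  qed
qed

text \<open>\<open>L\<close> and \<open>L'\<close> agree on polynomials in u = t^2. The iterates for
  the square root of u are such polynomials and approach t within 2 / (n + 1) in the order of the
  cone, so an odd moment, the value at t u^j, is squeezed to the same limit for both.\<close>

lemma positive_functional_determinate:
  fixes L L' :: "real poly \<Rightarrow> real"
  assumes add: "\<And>p q. L (p + q) = L p + L q" "\<And>p q. L' (p + q) = L' p + L' q"
    and scale: "\<And>c p. L (Polynomial.smult c p) = c * L p" "\<And>c p. L' (Polynomial.smult c p) = c * L' p"
    and pos: "\<And>p. p \<in> unit_cone \<Longrightarrow> 0 \<le> L p" "\<And>p. p \<in> unit_cone \<Longrightarrow> 0 \<le> L' p"
    and even: "\<And>j. L (Polynomial.monom 1 (2 * j)) = L' (Polynomial.monom 1 (2 * j))"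
  shows "L (Polynomial.monom 1 k) = L' (Polynomial.monom 1 k)"
proof (cases "even k")
  case True
  then show ?thesis using even by (auto elim: evenE)
next
  case False
  then obtain j where k: "k = Suc (2 * j)" by (auto elim: oddE)
  define t where "t = ([:0, 1:] :: real poly)"
  have tt: "Polynomial.monom 1 i = t ^ i" for i
    by (simp add: t_def monom_altdef)
  define u where "u = t * t"
  have tu: "Polynomial.monom 1 (2 * i) = u ^ i" for i
    by (simp add: tt u_def power_mult power2_eq_square)
  have L0: "L 0 = 0" "L' 0 = 0" using scale[of 0 0] by simp_all
  have comp: "L (pcompose q u * u ^ i) = L' (pcompose q u * u ^ i)" for q i
  proof (induction q arbitrary: i)
    case (pCons a q)
    have "pcompose (pCons a q) u * u ^ i = Polynomial.smult a (u ^ i) + pcompose q u * u ^ Suc i"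
      by (simp add: pcompose_pCons algebra_simps)
    then show ?case using pCons.IH[of "Suc i"] even[of i] by (simp add: add scale tu)
  qed (simp add: L0)
  \<comment> \<open>The iteration only adds, scales and multiplies, hence commutes with substituting
    u for t. So its iterates at u fall under \<open>comp\<close>.\<close>
  have y: "sqrt_approx u n = pcompose (sqrt_approx t n) u" for n
    by (induction n) (simp_all add: pcompose_add pcompose_smult pcompose_diff pcompose_mult,
        simp add: t_def pcompose_pCons)
  have minus: "L (p - q) = L p - L q" "L' (p - q) = L' p - L' q" for p q
    using add(1)[of "p - q" q] add(2)[of "p - q" q] by simp_all
  have uc: "u ^ j \<in> unit_cone" unfolding u_def by (intro unit_cone_power unit_cone_square)
  have L1: "L (u ^ j) = L' (u ^ j)" using even[of j] by (simp add: tu)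
  have est: "\<bar>L (t * u ^ j) - L' (t * u ^ j)\<bar> \<le> L (u ^ j) * (2 / Suc n)" for n
  proof -
    let ?y = "sqrt_approx u n"
    note err = sqrt_approx_square_error[of n, folded t_def u_def]
    have th: "1 - Polynomial.smult (1/2) t \<in> unit_cone"
    proof -
      have "1 - Polynomial.smult (1/2) t = (1 - t) + Polynomial.smult (1/2) t"
        by (rule real_poly_eqI) simp
      moreover have "1 - t = [:1, -1:]" "t = [:0, 1:]" by (simp_all add: t_def one_pCons)
      ultimately show ?thesis
        using unit_cone_gens by (simp only:) (intro unit_cone.add unit_cone_smult; simp)
    qed
    have "1 - Polynomial.smult (real (Suc n)) ((1 - (1 - Polynomial.smult (1/2) t)) * (1 - Polynomial.smult (1/2) t) ^ n) \<in> unit_cone"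
      using th unit_cone_smult[OF _ unit_cone_gens(2), of "1/2"]
      by (intro geometric_cone_bound) (auto simp: t_def)
    \<comment> \<open>Here x = 1 - t/2 and 1 - x = t/2; the factor 2 / (n + 1) clears the
      coefficient and leaves 2 / (n + 1) - t x^n.\<close>
    then have "Polynomial.smult (2 / Suc n) (1 - Polynomial.smult (real (Suc n))
        ((1 - (1 - Polynomial.smult (1/2) t)) * (1 - Polynomial.smult (1/2) t) ^ n)) \<in> unit_cone"
      by (intro unit_cone_smult) auto
    then have "[:2 / Suc n:] - t * (1 - Polynomial.smult (1/2) t) ^ n \<in> unit_cone"
      by (simp add: smult_diff_right del: of_nat_Suc)
    from unit_cone.add[OF this conjunct2[OF conjunct2[OF err]]]
    have "[:2 / Suc n:] - (t - ?y) \<in> unit_cone"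
      by (simp add: algebra_simps)
    from unit_cone_mult[OF this uc] have up: "Polynomial.smult (2 / Suc n) (u ^ j) - (t - ?y) * u ^ j \<in> unit_cone"
      by (simp only: left_diff_distrib) simp
    have lo: "(t - ?y) * u ^ j \<in> unit_cone" using err uc unit_cone_mult by blast
    have "L ((t - ?y) * u ^ j) = L (t * u ^ j) - L (?y * u ^ j)"
      "L' ((t - ?y) * u ^ j) = L' (t * u ^ j) - L' (?y * u ^ j)"
      by (simp_all only: left_diff_distrib minus)
    moreover have "L (?y * u ^ j) = L' (?y * u ^ j)" unfolding y by (rule comp)
    ultimately have d: "L (t * u ^ j) - L' (t * u ^ j) = L ((t - ?y) * u ^ j) - L' ((t - ?y) * u ^ j)"
      by simp
    have "L ((t - ?y) * u ^ j) \<le> L (u ^ j) * (2 / Suc n)" "L' ((t - ?y) * u ^ j) \<le> L (u ^ j) * (2 / Suc n)"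
      using pos(1)[OF up] pos(2)[OF up] L1 by (simp_all add: minus scale mult.commute)
    then show ?thesis using pos(1)[OF lo] pos(2)[OF lo] unfolding d by linarith
  qed
  have "(\<lambda>n. L (u ^ j) * (2 / Suc n)) \<longlonglongrightarrow> L (u ^ j) * 0"
    by (intro tendsto_mult tendsto_const LIMSEQ_Suc[OF lim_const_over_n])
  then have "\<bar>L (t * u ^ j) - L' (t * u ^ j)\<bar> \<le> L (u ^ j) * 0"
    by (rule LIMSEQ_le_const) (use est in blast)
  moreover have "Polynomial.monom 1 k = t * u ^ j"
    unfolding tu[symmetric] k by (simp add: tt)
  ultimately show ?thesis by simp
qed

section \<open>Square roots of positive operators\<close>

text \<open>Horner's scheme. Real coefficients make the value self-adjoint along with
  \<open>T\<close>.\<close>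

definition poly_op :: "'a cinner_space \<Rightarrow> ('a \<Rightarrow> 'a) \<Rightarrow> real poly \<Rightarrow> 'a \<Rightarrow> 'a" where
  "poly_op H T p x = fold_coeffs (\<lambda>c y. of_real c \<odot>\<^bsub>H\<^esub> x \<oplus>\<^bsub>H\<^esub> T y) p \<zero>\<^bsub>H\<^esub>"

text \<open>The order relations are those of quadratic forms. Linearity and boundedness are
  consequences: \<open>lin\<close> obtains the first from self-adjointness, \<open>bounded\<close>
  the second from T^2 \<le> T \<le> 1.\<close>

locale unit_positive_operator = hilbert_space +
  fixes T :: "'a \<Rightarrow> 'a"
  assumes closed [simp]: "x \<in> carrier H \<Longrightarrow> T x \<in> carrier H"
    and selfadj: "x \<in> carrier H \<Longrightarrow> y \<in> carrier H \<Longrightarrow> hinner H (T x) y = hinner H x (T y)"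
    and nonneg: "x \<in> carrier H \<Longrightarrow> 0 \<le> Re (hinner H (T x) x)"
    and le_one: "x \<in> carrier H \<Longrightarrow> Re (hinner H (T x) x) \<le> Re (hinner H x x)"
begin

abbreviation P where "P \<equiv> poly_op H T"

lemma lin: "linear_map H H T"
  by (rule linear_map_if_adjoint[of _ T]) (auto simp: selfadj)

lemma T_zero: "T \<zero>\<^bsub>H\<^esub> = \<zero>\<^bsub>H\<^esub>"
  by (rule hinner_ext) (auto simp: selfadj)

lemma P_0 [simp]: "P 0 x = \<zero>\<^bsub>H\<^esub>"
  by (simp add: poly_op_def)

lemma P_pCons:
  assumes "x \<in> carrier H"
  shows "P (pCons c p) x = of_real c \<odot>\<^bsub>H\<^esub> x \<oplus>\<^bsub>H\<^esub> T (P p x)"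
\<comment> \<open>\<open>pCons 0 0\<close> is the zero polynomial, on which
  \<open>fold_coeffs\<close> performs no step, so the recursion must be recovered from
  \<open>T_zero\<close>.\<close>
proof (cases "c = 0 \<and> p = 0")
  case True
  then show ?thesis using assms
    by (intro hinner_ext) (auto simp: poly_op_def T_zero hinner_simps)
next
  case False
  then show ?thesis by (auto simp: poly_op_def)
qed

lemma P_closed [simp]: "x \<in> carrier H \<Longrightarrow> P p x \<in> carrier H"
  by (induction p) (auto simp: P_pCons)

lemma P_add: "x \<in> carrier H \<Longrightarrow> P (p + q) x = P p x \<oplus>\<^bsub>H\<^esub> P q x"
proof (induction p q rule: poly_induct2)
  case (pCons c p d q)
  then show ?case
    by (intro hinner_ext) (auto simp: P_pCons hinner_simps linear_mapD[OF lin] algebra_simps)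
qed auto

lemma P_smult: "x \<in> carrier H \<Longrightarrow> P (Polynomial.smult c p) x = of_real c \<odot>\<^bsub>H\<^esub> P p x"
proof (induction p)
  case (pCons d p)
  then show ?case
    by (intro hinner_ext) (auto simp: P_pCons hinner_simps linear_mapD[OF lin] algebra_simps)
qed (auto intro!: hinner_ext simp: hinner_simps)

lemma P_mult: "x \<in> carrier H \<Longrightarrow> P (p * q) x = P p (P q x)"
proof (induction p)
  case (pCons d p)
  then show ?case
    by (intro hinner_ext)
      (auto simp: P_pCons P_add P_smult hinner_simps linear_mapD[OF lin] algebra_simps)
qed auto

lemma P_1 [simp]: "x \<in> carrier H \<Longrightarrow> P 1 x = x"
  by (intro hinner_ext) (auto simp: one_pCons P_pCons T_zero hinner_simps)

lemma P_var: "x \<in> carrier H \<Longrightarrow> P [:0, 1:] x = T x"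
  by (intro hinner_ext) (auto simp: P_pCons T_zero hinner_simps linear_mapD[OF lin])

lemma P_diff: "x \<in> carrier H \<Longrightarrow> P (p - q) x = P p x \<ominus>\<^bsub>H\<^esub> P q x"
  using P_add[of x "p - q" q] by (intro hinner_ext) (auto simp: hinner_simps)

lemma P_monom: "x \<in> carrier H \<Longrightarrow> P (Polynomial.monom 1 n) x = (T ^^ n) x"
proof (induction n)
  case (Suc n)
  then show ?case
    by (intro hinner_ext) (auto simp: monom_Suc P_pCons hinner_simps funpow_closed)
qed (simp add: monom_0 flip: one_pCons)

lemma P_commute:
  assumes S: "linear_map H H S" and comm: "\<And>x. x \<in> carrier H \<Longrightarrow> S (T x) = T (S x)"
    and x: "x \<in> carrier H"
  shows "S (P p x) = P p (S x)"
proof (induction p)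
  case 0
  have "S (0 \<odot>\<^bsub>H\<^esub> x) = 0 \<odot>\<^bsub>H\<^esub> S x" using x linear_mapD(3)[OF S] by blast
  moreover have "0 \<odot>\<^bsub>H\<^esub> y = \<zero>\<^bsub>H\<^esub>" if "y \<in> carrier H" for y
    using that by (intro hinner_ext) (auto simp: hinner_simps)
  ultimately show ?case using x linear_mapD(1)[OF S] by simp
next
  case (pCons c p)
  then show ?case using x
    by (simp add: P_pCons linear_mapD[OF S] comm)
qed

lemma P_selfadj:
  "x \<in> carrier H \<Longrightarrow> y \<in> carrier H \<Longrightarrow> hinner H (P p x) y = hinner H x (P p y)"
proof (induction p arbitrary: x y)
  case (pCons c p)
  have "P p (T y) = T (P p y)" if "y \<in> carrier H" for y
    using P_commute[OF lin _ that] by simp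
  then show ?case using pCons
    by (simp add: P_pCons hinner_simps selfadj)
qed auto

text \<open>A cone element is a sum of terms q^2 g, and <(q^2 g)(T) x, x> = <g(T) y, y> for y = q(T)
  x. Only the generators 1, T and 1 - T remain to be checked, so no spectral theorem is
  involved.\<close>

lemma P_nonneg:
  assumes "p \<in> unit_cone" "x \<in> carrier H"
  shows "0 \<le> Re (hinner H (P p x) x)"
  using assms
proof (induction p rule: unit_cone.induct)
  case (square g q)
  let ?y = "P q x"
  have y: "?y \<in> carrier H" using square by simp
  have "q * q * g = q * (g * q)" by (simp only: mult_ac)
  then have "hinner H (P (q * q * g) x) x = hinner H (P g ?y) ?y"
    using square by (simp only: P_mult P_selfadj P_closed)
  moreover have "0 \<le> Re (hinner H (P g ?y) ?y)"
  proof -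
    have "[:1, -1:] = 1 - [:0, 1::real:]" by (simp add: one_pCons)
    then have "P [:1, -1:] ?y = ?y \<ominus>\<^bsub>H\<^esub> T ?y"
      using y by (simp only: P_diff P_1 P_var)
    then show ?thesis
      using square y nonneg[OF y] le_one[OF y] hinner_nonneg[OF y]
      by (auto simp: P_var hinner_simps)
  qed
  ultimately show ?case by simp
next
  case (add p q)
  then show ?case by (simp add: P_add hinner_simps)
qed

text \<open>Since p (1 - p) lies in the cone, p(T)^2 \<le> p(T). Applied to differences of an
  increasing sequence, this upgrades convergence of quadratic forms to convergence in norm at each
  vector.\<close>

lemma hnorm_P_le:
  assumes p: "p \<in> unit_cone" "1 - p \<in> unit_cone" and x: "x \<in> carrier H"
  shows "(hnorm H (P p x))\<^sup>2 \<le> Re (hinner H (P p x) x)"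
proof -
  have "0 \<le> Re (hinner H (P (p * (1 - p)) x) x)"
    by (intro P_nonneg unit_cone_mult p x)
  also have "p * (1 - p) = p - p * p" by (simp add: algebra_simps)
  also have "Re (hinner H (P (p - p * p) x) x) = Re (hinner H (P p x) x) - Re (hinner H (P p x) (P p x))"
    using x by (simp add: P_diff P_mult hinner_simps P_selfadj)
  finally show ?thesis using x by (simp add: hnorm_sq)
qed

lemma hnorm_P_le_hnorm:
  assumes p: "p \<in> unit_cone" "1 - p \<in> unit_cone" and x: "x \<in> carrier H"
  shows "hnorm H (P p x) \<le> hnorm H x"
proof -
  have "0 \<le> Re (hinner H (P (1 - p) x) x)" by (intro P_nonneg p x)
  then have "(hnorm H (P p x))\<^sup>2 \<le> (hnorm H x)\<^sup>2"
    using hnorm_P_le[OF assms] x by (simp add: P_diff hinner_simps hnorm_sq)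
  then show ?thesis by (rule power2_le_imp_le) (use x in simp)
qed

lemma hnorm_le: "x \<in> carrier H \<Longrightarrow> hnorm H (T x) \<le> hnorm H x"
  using hnorm_P_le_hnorm[of "[:0, 1:]" x] unit_cone_gens by (simp add: P_var one_pCons)

lemma bounded: "bounded_operator H T"
  unfolding bounded_operator_def using lin hnorm_le by (auto intro!: exI[of _ 1])

end

context hilbert_space
begin

lemma hinner_tendsto:
  assumes "\<And>n. u n \<in> carrier H" "l \<in> carrier H" "y \<in> carrier H"
    and "(\<lambda>n. hnorm H (u n \<ominus>\<^bsub>H\<^esub> l)) \<longlonglongrightarrow> 0"
  shows "(\<lambda>n. hinner H (u n) y) \<longlonglongrightarrow> hinner H l y"
proof (rule LIM_zero_cancel, rule tendsto_norm_zero_cancel, rule tendsto_sandwich[of "\<lambda>_. 0"])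
  show "(\<lambda>n. hnorm H (u n \<ominus>\<^bsub>H\<^esub> l) * hnorm H y) \<longlonglongrightarrow> 0"
    using tendsto_mult_right[OF assms(4), of "hnorm H y"] by simp
  have "cmod (hinner H (u n) y - hinner H l y) \<le> hnorm H (u n \<ominus>\<^bsub>H\<^esub> l) * hnorm H y" for n
    using hinner_cauchy_schwarz[of "u n \<ominus>\<^bsub>H\<^esub> l" y] assms by (simp add: hinner_simps)
  then show "\<forall>\<^sub>F n in sequentially. cmod (hinner H (u n) y - hinner H l y) \<le> hnorm H (u n \<ominus>\<^bsub>H\<^esub> l) * hnorm H y"
    by simp
qed auto

end

text \<open>The iterates, evaluated at \<open>T\<close>, increase and stay below the identity, so
  they converge at each vector by \<open>hnorm_P_le\<close>. The fixed point equation of the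
  iteration gives R R = T. Commutation with \<open>S\<close> holds for every polynomial in
  \<open>T\<close> and survives the limit; it is part of the statement because a further root and
  the operator N must commute with R.\<close>

theorem (in unit_positive_operator) sqrt_exists:
  "\<exists>R. unit_positive_operator H R \<and> (\<forall>x\<in>carrier H. R (R x) = T x) \<and>
    (\<forall>S. bounded_operator H S \<longrightarrow> (\<forall>x\<in>carrier H. S (T x) = T (S x)) \<longrightarrow>
      (\<forall>x\<in>carrier H. S (R x) = R (S x)))"
proof -
  define y where "y n = sqrt_approx [:0, 1:] n" for n
  have t: "[:0, 1:] \<in> unit_cone" "1 - [:0, 1::real:] \<in> unit_cone"
    using unit_cone_gens by (auto simp: one_pCons)
  have yc: "y n \<in> unit_cone" "1 - y n \<in> unit_cone" for n
    using sqrt_approx_cone[OF t, of n] by (auto simp: y_def)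
  have ym: "y n - y m \<in> unit_cone" "1 - (y n - y m) \<in> unit_cone" if "m \<le> n" for m n
  proof -
    show "y n - y m \<in> unit_cone" using sqrt_approx_mono[OF t that] by (simp add: y_def)
    show "1 - (y n - y m) \<in> unit_cone"
      using unit_cone.add[OF yc(2)[of n] yc(1)[of m]] by (simp add: algebra_simps)
  qed
  have cauchy: "\<exists>N. \<forall>m\<ge>N. \<forall>n\<ge>N. hnorm H (P (y m) x \<ominus>\<^bsub>H\<^esub> P (y n) x) < e"
    if x: "x \<in> carrier H" and e: "0 < e" for x e
  proof -
    define s where "s n = Re (hinner H (P (y n) x) x)" for n
    have "incseq s"
    proof (rule incseq_SucI)
      fix n
      show "s n \<le> s (Suc n)"
        using P_nonneg[OF ym(1)[of n "Suc n"] x] x by (simp add: P_diff hinner_simps s_def)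
    qed
    moreover have "s n \<le> (hnorm H x)\<^sup>2" for n
      using P_nonneg[OF yc(2)[of n] x] x by (simp add: P_diff hinner_simps s_def hnorm_sq)
    ultimately have "convergent s"
      using incseq_convergent[of s] convergentI by metis
    then have "Cauchy s" by (rule convergent_Cauchy)
    then obtain N where N: "\<And>m n. m \<ge> N \<Longrightarrow> n \<ge> N \<Longrightarrow> dist (s m) (s n) < e\<^sup>2"
      using e metric_CauchyD[of s "e\<^sup>2"] by auto
    have le: "hnorm H (P (y n) x \<ominus>\<^bsub>H\<^esub> P (y m) x) < e" if "m \<ge> N" "n \<ge> m" for m n
    proof -
      have "(hnorm H (P (y n) x \<ominus>\<^bsub>H\<^esub> P (y m) x))\<^sup>2 \<le> s n - s m"
        using hnorm_P_le[OF ym[OF that(2)] x] x by (simp add: P_diff hinner_simps s_def)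
      also have "\<dots> < e\<^sup>2" using N[of n m] that by (auto simp: dist_real_def)
      finally show ?thesis using e by (simp add: power_less_imp_less_base)
    qed
    have "hnorm H (P (y m) x \<ominus>\<^bsub>H\<^esub> P (y n) x) < e" if "m \<ge> N" "n \<ge> N" for m n
      using le[of m n] le[of n m] that x hnorm_minus_commute[of "P (y m) x" "P (y n) x"]
      by (cases "m \<le> n") auto
    then show ?thesis by blast
  qed
  have "\<exists>l. l \<in> carrier H \<and> (\<lambda>n. hnorm H (P (y n) x \<ominus>\<^bsub>H\<^esub> l)) \<longlonglongrightarrow> 0" if "x \<in> carrier H" for x
    using hilbert_complete[of "\<lambda>n. P (y n) x"] cauchy[OF that] that by auto
  then obtain R where R: "\<And>x. x \<in> carrier H \<Longrightarrow> R x \<in> carrier H"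
    and lim: "\<And>x. x \<in> carrier H \<Longrightarrow> (\<lambda>n. hnorm H (P (y n) x \<ominus>\<^bsub>H\<^esub> R x)) \<longlonglongrightarrow> 0"
    by metis
  have limi: "(\<lambda>n. hinner H (P (y n) x) z) \<longlonglongrightarrow> hinner H (R x) z" if "x \<in> carrier H" "z \<in> carrier H" for x z
    by (rule hinner_tendsto) (use that R lim in auto)
  have limi2: "(\<lambda>n. hinner H z (P (y n) x)) \<longlonglongrightarrow> hinner H z (R x)" if "x \<in> carrier H" "z \<in> carrier H" for x z
    using tendsto_cnj[OF limi[OF that]] that R
    by (simp add: hinner_commute[symmetric])
  have "unit_positive_operator H R"
  proof
    fix x z assume x: "x \<in> carrier H"
    show "R x \<in> carrier H" by (rule R[OF x])
    show "hinner H (R x) z = hinner H x (R z)" if z: "z \<in> carrier H"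
      using LIMSEQ_unique[OF limi[OF x z]] limi2[OF z x] P_selfadj[OF x z] by simp
    show "0 \<le> Re (hinner H (R x) x)"
      by (rule LIMSEQ_le_const[OF tendsto_Re[OF limi[OF x x]]]) (use P_nonneg[OF yc(1) x] in auto)
    show "Re (hinner H (R x) x) \<le> Re (hinner H x x)"
      by (rule LIMSEQ_le_const2[OF tendsto_Re[OF limi[OF x x]]])
        (use P_nonneg[OF yc(2) x] x in \<open>auto simp: P_diff hinner_simps\<close>)
  qed
  then interpret R: unit_positive_operator H R .
  have "R (R x) = T x" if x: "x \<in> carrier H" for x
  proof (rule hinner_ext)
    fix z assume z: "z \<in> carrier H"
    have "hinner H (P (y (Suc n)) x) z = hinner H (P (y n) x) z +
        1/2 * (hinner H (T x) z - hinner H (P (y n) x) (P (y n) z))" for n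
      using x z by (simp add: y_def P_add P_smult P_diff P_mult P_var hinner_simps P_selfadj)
    \<comment> \<open>The recursion is solved for its quadratic term: up to a difference of
      consecutive iterates, which vanishes in the limit, it equals <T x, z>.\<close>
    then have e: "hinner H (P (y n) x) (P (y n) z) =
        hinner H (T x) z - 2 * (hinner H (P (y (Suc n)) x) z - hinner H (P (y n) x) z)" for n
      by simp
    have "(\<lambda>n. hinner H (P (y n) x) (P (y n) z)) \<longlonglongrightarrow>
        hinner H (T x) z - 2 * (hinner H (R x) z - hinner H (R x) z)"
      unfolding e by (intro tendsto_intros limi LIMSEQ_Suc[OF limi] x z)
    then have 1: "(\<lambda>n. hinner H (P (y n) x) (P (y n) z)) \<longlonglongrightarrow> hinner H (T x) z" by simp
    \<comment> \<open>The left factor tends to 0 in norm while the right one stays bounded by the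
      norm of z, so the limit of the product may be taken factor by factor.\<close>
    have 2: "(\<lambda>n. hinner H (P (y n) x \<ominus>\<^bsub>H\<^esub> R x) (P (y n) z)) \<longlonglongrightarrow> 0"
    proof (rule tendsto_norm_zero_cancel, rule tendsto_sandwich[of "\<lambda>_. 0"])
      show "(\<lambda>n. hnorm H (P (y n) x \<ominus>\<^bsub>H\<^esub> R x) * hnorm H z) \<longlonglongrightarrow> 0"
        using tendsto_mult_right[OF lim[OF x], of "hnorm H z"] by simp
      have "cmod (hinner H (P (y n) x \<ominus>\<^bsub>H\<^esub> R x) (P (y n) z)) \<le> hnorm H (P (y n) x \<ominus>\<^bsub>H\<^esub> R x) * hnorm H z" for n
        by (rule order_trans[OF hinner_cauchy_schwarz])
          (use x z R in \<open>auto intro!: mult_left_mono hnorm_P_le_hnorm yc\<close>)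
      then show "\<forall>\<^sub>F n in sequentially. cmod (hinner H (P (y n) x \<ominus>\<^bsub>H\<^esub> R x) (P (y n) z))
          \<le> hnorm H (P (y n) x \<ominus>\<^bsub>H\<^esub> R x) * hnorm H z" by simp
    qed auto
    have "hinner H (P (y n) x) (P (y n) z) =
        hinner H (P (y n) x \<ominus>\<^bsub>H\<^esub> R x) (P (y n) z) + hinner H (R x) (P (y n) z)" for n
      using x z R by (simp add: hinner_simps)
    then have "(\<lambda>n. hinner H (P (y n) x) (P (y n) z)) \<longlonglongrightarrow> 0 + hinner H (R x) (R z)"
      using tendsto_add[OF 2 limi2[OF z R[OF x]]] by simp
    then have "hinner H (R x) (R z) = hinner H (T x) z"
      using LIMSEQ_unique[OF 1] by simp
    then show "hinner H (R (R x)) z = hinner H (T x) z"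
      using x z R by (simp add: R.selfadj)
  qed (use x R in auto)
  moreover have "S (R x) = R (S x)"
    if S: "bounded_operator H S" and comm: "\<forall>x\<in>carrier H. S (T x) = T (S x)" and x: "x \<in> carrier H"
    for S x
  proof (rule hinner_ext)
    show Sc: "S (R x) \<in> carrier H" "R (S x) \<in> carrier H"
      using x R bounded_operatorD(2)[OF S] by auto
    note Scl = bounded_operatorD(2)[OF S]
    fix z assume z: "z \<in> carrier H"
    obtain C where C: "C > 0" "\<forall>x\<in>carrier H. hnorm H (S x) \<le> C * hnorm H x"
      using bounded_operatorD(3)[OF S] by blast
    have "(\<lambda>n. hnorm H (S (P (y n) x) \<ominus>\<^bsub>H\<^esub> S (R x))) \<longlonglongrightarrow> 0"
    proof (rule tendsto_sandwich[of "\<lambda>_. 0"])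
      show "(\<lambda>n. C * hnorm H (P (y n) x \<ominus>\<^bsub>H\<^esub> R x)) \<longlonglongrightarrow> 0"
        using tendsto_mult_left[OF lim[OF x], of C] by simp
      have "hnorm H (S (P (y n) x) \<ominus>\<^bsub>H\<^esub> S (R x)) \<le> C * hnorm H (P (y n) x \<ominus>\<^bsub>H\<^esub> R x)" for n
        using C(2) x R linear_map_minus[OF bounded_operatorD(1)[OF S], of "P (y n) x" "R x", symmetric] by simp
      then show "\<forall>\<^sub>F n in sequentially. hnorm H (S (P (y n) x) \<ominus>\<^bsub>H\<^esub> S (R x))
          \<le> C * hnorm H (P (y n) x \<ominus>\<^bsub>H\<^esub> R x)" by simp
    qed (use x R Scl in auto)
    then have "(\<lambda>n. hinner H (S (P (y n) x)) z) \<longlonglongrightarrow> hinner H (S (R x)) z"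
      by (intro hinner_tendsto) (use x R Scl z in auto)
    moreover have "S (P (y n) x) = P (y n) (S x)" for n
      by (rule P_commute) (use x S comm bounded_operatorD(1) in auto)
    ultimately show "hinner H (S (R x)) z = hinner H (R (S x)) z"
      using limi[OF Scl[OF x] z] LIMSEQ_unique by simp
  qed
  ultimately show ?thesis using \<open>unit_positive_operator H R\<close> by blast
qed

section \<open>Square-summable families of vectors\<close>

text \<open>The Hilbert space tensor product of \<open>K\<close> with \<open>ell2\<close> over the
  index type, kept as families of vectors so that bilateral shifts become permutations of the
  index.\<close>

definition ell2_sum :: "'a cinner_space \<Rightarrow> ('i \<Rightarrow> 'a) cinner_space" where
  "ell2_sum K = \<lparr>carrier = {f. (\<forall>i. f i \<in> carrier K) \<and> (\<lambda>i. (hnorm K (f i))\<^sup>2) summable_on UNIV},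
     monoid.mult = (\<lambda>_ _. undefined), one = undefined,
     zero = (\<lambda>_. \<zero>\<^bsub>K\<^esub>), add = (\<lambda>f g i. f i \<oplus>\<^bsub>K\<^esub> g i),
     smult = (\<lambda>c f i. c \<odot>\<^bsub>K\<^esub> f i),
     hinner = (\<lambda>f g. \<Sum>\<^sub>\<infinity>i. hinner K (f i) (g i))\<rparr>"

lemma ell2_sum_simps:
  "carrier (ell2_sum K) = {f. (\<forall>i. f i \<in> carrier K) \<and> (\<lambda>i. (hnorm K (f i))\<^sup>2) summable_on UNIV}"
  "zero (ell2_sum K) = (\<lambda>_. \<zero>\<^bsub>K\<^esub>)"
  "add (ell2_sum K) = (\<lambda>f g i. f i \<oplus>\<^bsub>K\<^esub> g i)"
  "smult (ell2_sum K) = (\<lambda>c f i. c \<odot>\<^bsub>K\<^esub> f i)"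
  "hinner (ell2_sum K) = (\<lambda>f g. \<Sum>\<^sub>\<infinity>i. hinner K (f i) (g i))"
  by (simp_all add: ell2_sum_def)

context hilbert_space
begin

lemma ell2_sum_closed: "f \<in> carrier (ell2_sum H) \<Longrightarrow> f i \<in> carrier H"
  and ell2_sum_summable: "f \<in> carrier (ell2_sum H) \<Longrightarrow> (\<lambda>i. (hnorm H (f i))\<^sup>2) summable_on UNIV"
  by (auto simp: ell2_sum_simps)

lemma ell2_sumI:
  assumes "\<And>i. f i \<in> carrier H" and "g summable_on UNIV" and "\<And>i. (hnorm H (f i))\<^sup>2 \<le> g i"
  shows "f \<in> carrier (ell2_sum H)"
  using assms by (auto simp: ell2_sum_simps intro: summable_on_comparison_test[of g])

lemma hnorm_add_sq_le:
  assumes "x \<in> carrier H" "y \<in> carrier H"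
  shows "(hnorm H (x \<oplus>\<^bsub>H\<^esub> y))\<^sup>2 \<le> 2 * (hnorm H x)\<^sup>2 + 2 * (hnorm H y)\<^sup>2"
proof -
  have "(hnorm H (x \<oplus>\<^bsub>H\<^esub> y))\<^sup>2 \<le> (hnorm H x + hnorm H y)\<^sup>2"
    using assms by (intro power_mono hnorm_triangle) auto
  also have "\<dots> \<le> 2 * (hnorm H x)\<^sup>2 + 2 * (hnorm H y)\<^sup>2"
    using sum_squares_bound[of "hnorm H x" "hnorm H y"] by (simp add: power2_sum)
  finally show ?thesis .
qed

lemma ell2_sum_add_closed:
  assumes "f \<in> carrier (ell2_sum H)" "g \<in> carrier (ell2_sum H)"
  shows "(\<lambda>i. f i \<oplus>\<^bsub>H\<^esub> g i) \<in> carrier (ell2_sum H)"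
  by (rule ell2_sumI[of _ "\<lambda>i. 2 * (hnorm H (f i))\<^sup>2 + 2 * (hnorm H (g i))\<^sup>2"])
    (use assms in \<open>auto intro!: hnorm_add_sq_le summable_on_add summable_on_cmult_right
      simp: ell2_sum_closed ell2_sum_summable\<close>)

lemma ell2_sum_smult_closed:
  assumes "f \<in> carrier (ell2_sum H)"
  shows "(\<lambda>i. c \<odot>\<^bsub>H\<^esub> f i) \<in> carrier (ell2_sum H)"
  by (rule ell2_sumI[of _ "\<lambda>i. (cmod c)\<^sup>2 * (hnorm H (f i))\<^sup>2"])
    (use assms in \<open>auto intro!: summable_on_cmult_right
      simp: ell2_sum_closed ell2_sum_summable hnorm_smult power_mult_distrib\<close>)

lemma ell2_sum_hinner_summable:
  assumes f: "f \<in> carrier (ell2_sum H)" and g: "g \<in> carrier (ell2_sum H)"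
  shows "(\<lambda>i. hinner H (f i) (g i)) summable_on UNIV"
proof (rule abs_summable_summable, rule summable_on_comparison_test)
  show "(\<lambda>i. (hnorm H (f i))\<^sup>2 + (hnorm H (g i))\<^sup>2) summable_on UNIV"
    by (intro summable_on_add ell2_sum_summable f g)
  show "cmod (hinner H (f i) (g i)) \<le> (hnorm H (f i))\<^sup>2 + (hnorm H (g i))\<^sup>2" for i
  proof -
    note c = ell2_sum_closed[OF f, of i] ell2_sum_closed[OF g, of i]
    have "0 \<le> hnorm H (f i) * hnorm H (g i)" using c by simp
    then have "hnorm H (f i) * hnorm H (g i) \<le> (hnorm H (f i))\<^sup>2 + (hnorm H (g i))\<^sup>2"
      using sum_squares_bound[of "hnorm H (f i)" "hnorm H (g i)"] by linarith
    then show ?thesis using hinner_cauchy_schwarz[OF c] by linarith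
  qed
qed auto

lemma ell2_sum_hinner_self:
  assumes f: "f \<in> carrier (ell2_sum H)"
  shows "hinner (ell2_sum H) f f = of_real (\<Sum>\<^sub>\<infinity>i. (hnorm H (f i))\<^sup>2)"
proof -
  have "((\<lambda>i. of_real ((hnorm H (f i))\<^sup>2) :: complex) has_sum
      of_real (\<Sum>\<^sub>\<infinity>i. (hnorm H (f i))\<^sup>2)) UNIV"
    using ell2_sum_summable[OF f] by (intro has_sum_of_real has_sum_infsum)
  from infsumI[OF this] show ?thesis
    by (simp only: ell2_sum_simps hinner_self[OF ell2_sum_closed[OF f]])
qed

lemma ell2_sum_hnorm:
  "f \<in> carrier (ell2_sum H) \<Longrightarrow> hnorm (ell2_sum H) f = sqrt (\<Sum>\<^sub>\<infinity>i. (hnorm H (f i))\<^sup>2)"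
  by (simp add: hnorm_def[of "ell2_sum H"] ell2_sum_hinner_self)

lemma abelian_group_ell2_sum: "abelian_group (ell2_sum H :: ('i \<Rightarrow> 'a) cinner_space)"
proof (rule abelian_groupI)
  fix x y z :: "'i \<Rightarrow> 'a"
  assume x: "x \<in> carrier (ell2_sum H)" and y: "y \<in> carrier (ell2_sum H)"
  note [simp] = ell2_sum_closed[OF x] ell2_sum_closed[OF y]
  show "x \<oplus>\<^bsub>ell2_sum H\<^esub> y \<in> carrier (ell2_sum H)"
    using ell2_sum_add_closed[OF x y] by (simp add: ell2_sum_simps(3))
  show "x \<oplus>\<^bsub>ell2_sum H\<^esub> y = y \<oplus>\<^bsub>ell2_sum H\<^esub> x"
    by (simp add: ell2_sum_simps(3) fun_eq_iff a_comm)
  show "x \<oplus>\<^bsub>ell2_sum H\<^esub> y \<oplus>\<^bsub>ell2_sum H\<^esub> z = x \<oplus>\<^bsub>ell2_sum H\<^esub> (y \<oplus>\<^bsub>ell2_sum H\<^esub> z)"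
    if z: "z \<in> carrier (ell2_sum H)"
    using ell2_sum_closed[OF z] by (simp add: ell2_sum_simps(3) fun_eq_iff a_assoc)
next
  show "\<zero>\<^bsub>ell2_sum H\<^esub> \<in> carrier (ell2_sum H :: ('i \<Rightarrow> 'a) cinner_space)"
    by (simp add: ell2_sum_simps)
next
  fix x :: "'i \<Rightarrow> 'a"
  assume x: "x \<in> carrier (ell2_sum H)"
  note [simp] = ell2_sum_closed[OF x]
  show "\<zero>\<^bsub>ell2_sum H\<^esub> \<oplus>\<^bsub>ell2_sum H\<^esub> x = x"
    by (simp add: ell2_sum_simps(2,3))
  have "(-1) \<odot>\<^bsub>H\<^esub> x i \<oplus>\<^bsub>H\<^esub> x i = \<zero>\<^bsub>H\<^esub>" for i
    by (rule hinner_ext) (auto simp: hinner_simps)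
  then show "\<exists>y\<in>carrier (ell2_sum H). y \<oplus>\<^bsub>ell2_sum H\<^esub> x = \<zero>\<^bsub>ell2_sum H\<^esub>"
    using ell2_sum_smult_closed[OF x, of "-1"]
    by (intro bexI[of _ "\<lambda>i. (-1) \<odot>\<^bsub>H\<^esub> x i"]) (simp_all add: ell2_sum_simps(2,3))
qed

lemma module_ell2_sum:
  "module (ring_of_type_algebra :: complex ring) (ell2_sum H :: ('i \<Rightarrow> 'a) cinner_space)"
proof (rule moduleI[OF cring_from_type_algebra abelian_group_ell2_sum])
  fix a b :: complex and x y :: "'i \<Rightarrow> 'a"
  assume x: "x \<in> carrier (ell2_sum H)"
  note [simp] = ell2_sum_closed[OF x]
  show "a \<odot>\<^bsub>ell2_sum H\<^esub> x \<in> carrier (ell2_sum H)"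
    using ell2_sum_smult_closed[OF x] by (simp add: ell2_sum_simps(4))
  show "(a \<oplus>\<^bsub>ring_of_type_algebra\<^esub> b) \<odot>\<^bsub>ell2_sum H\<^esub> x = a \<odot>\<^bsub>ell2_sum H\<^esub> x \<oplus>\<^bsub>ell2_sum H\<^esub> b \<odot>\<^bsub>ell2_sum H\<^esub> x"
    by (simp add: ell2_sum_simps(3,4) fun_eq_iff ring_of_type_algebra_def)
      (auto intro!: hinner_ext simp: hinner_simps algebra_simps)
  show "(a \<otimes>\<^bsub>ring_of_type_algebra\<^esub> b) \<odot>\<^bsub>ell2_sum H\<^esub> x = a \<odot>\<^bsub>ell2_sum H\<^esub> (b \<odot>\<^bsub>ell2_sum H\<^esub> x)"
    by (simp add: ell2_sum_simps(3,4) fun_eq_iff ring_of_type_algebra_def)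
      (auto intro!: hinner_ext simp: hinner_simps algebra_simps)
  show "\<one>\<^bsub>ring_of_type_algebra\<^esub> \<odot>\<^bsub>ell2_sum H\<^esub> x = x"
    by (simp add: ell2_sum_simps(3,4) fun_eq_iff ring_of_type_algebra_def)
      (auto intro!: hinner_ext simp: hinner_simps algebra_simps)
  show "a \<odot>\<^bsub>ell2_sum H\<^esub> (x \<oplus>\<^bsub>ell2_sum H\<^esub> y) = a \<odot>\<^bsub>ell2_sum H\<^esub> x \<oplus>\<^bsub>ell2_sum H\<^esub> a \<odot>\<^bsub>ell2_sum H\<^esub> y"
    if y: "y \<in> carrier (ell2_sum H)"
    using ell2_sum_closed[OF y] by (simp add: ell2_sum_simps(3,4) fun_eq_iff)
      (auto intro!: hinner_ext simp: hinner_simps algebra_simps)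
qed

lemma ell2_sum_minus:
  fixes f g :: "'i \<Rightarrow> 'a"
  assumes f: "f \<in> carrier (ell2_sum H)" and g: "g \<in> carrier (ell2_sum H)"
  shows "f \<ominus>\<^bsub>ell2_sum H\<^esub> g = (\<lambda>i. f i \<ominus>\<^bsub>H\<^esub> g i)"
proof -
  interpret L: abelian_group "ell2_sum H :: ('i \<Rightarrow> 'a) cinner_space" by (rule abelian_group_ell2_sum)
  note [simp] = ell2_sum_closed[OF f] ell2_sum_closed[OF g]
  have "(-1) \<odot>\<^bsub>H\<^esub> g i \<oplus>\<^bsub>H\<^esub> g i = \<zero>\<^bsub>H\<^esub>" for i
    by (rule hinner_ext) (auto simp: hinner_simps)
  then have "\<ominus>\<^bsub>ell2_sum H\<^esub> g = (\<lambda>i. (-1) \<odot>\<^bsub>H\<^esub> g i)"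
    using ell2_sum_smult_closed[OF g, of "-1"]
    by (intro L.minus_equality g) (simp_all add: ell2_sum_simps(2,3))
  then show ?thesis
    by (simp add: a_minus_def[of "ell2_sum H"] ell2_sum_simps(3) fun_eq_iff minus_eq_add_smult)
qed

lemma ell2_sum_finite_le:
  assumes f: "f \<in> carrier (ell2_sum H)" and "finite F"
  shows "(\<Sum>i\<in>F. (hnorm H (f i))\<^sup>2) \<le> (hnorm (ell2_sum H) f)\<^sup>2"
proof -
  have "(\<Sum>i\<in>F. (hnorm H (f i))\<^sup>2) \<le> (\<Sum>\<^sub>\<infinity>i. (hnorm H (f i))\<^sup>2)"
    using assms by (intro finite_sum_le_infsum ell2_sum_summable) auto
  also have "\<dots> = (hnorm (ell2_sum H) f)\<^sup>2"
    by (simp add: ell2_sum_hnorm[OF f] infsum_nonneg)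
  finally show ?thesis .
qed

lemma hnorm_minus_tendsto:
  assumes "\<And>n. u n \<in> carrier H" "l \<in> carrier H" "x \<in> carrier H"
    and lim: "(\<lambda>n. hnorm H (u n \<ominus>\<^bsub>H\<^esub> l)) \<longlonglongrightarrow> 0"
  shows "(\<lambda>n. hnorm H (x \<ominus>\<^bsub>H\<^esub> u n)) \<longlonglongrightarrow> hnorm H (x \<ominus>\<^bsub>H\<^esub> l)"
proof (rule LIM_zero_cancel, rule tendsto_norm_zero_cancel, rule tendsto_sandwich[of "\<lambda>_. 0"])
  have "\<bar>hnorm H (x \<ominus>\<^bsub>H\<^esub> u n) - hnorm H (x \<ominus>\<^bsub>H\<^esub> l)\<bar> \<le> hnorm H (u n \<ominus>\<^bsub>H\<^esub> l)" for n
    using hnorm_triangle_minus3[of x "u n" l] hnorm_triangle_minus3[of x l "u n"]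
      hnorm_minus_commute[of l "u n"] assms(1-3) by (simp add: abs_le_iff)
  then show "\<forall>\<^sub>F n in sequentially. norm (hnorm H (x \<ominus>\<^bsub>H\<^esub> u n) - hnorm H (x \<ominus>\<^bsub>H\<^esub> l)) \<le> hnorm H (u n \<ominus>\<^bsub>H\<^esub> l)"
    by simp
qed (use lim in auto)

text \<open>Limits are taken coordinatewise; finite partial sums carry the Cauchy bound over to the
  limit family, which gives both its square-summability and the convergence.\<close>

lemma ell2_sum_complete:
  fixes u :: "nat \<Rightarrow> 'i \<Rightarrow> 'a"
  assumes u: "\<And>n. u n \<in> carrier (ell2_sum H)"
    and cauchy: "\<And>e. 0 < e \<Longrightarrow> \<exists>N. \<forall>m\<ge>N. \<forall>n\<ge>N. hnorm (ell2_sum H) (u m \<ominus>\<^bsub>ell2_sum H\<^esub> u n) < e"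
  shows "\<exists>l\<in>carrier (ell2_sum H). (\<lambda>n. hnorm (ell2_sum H) (u n \<ominus>\<^bsub>ell2_sum H\<^esub> l)) \<longlonglongrightarrow> 0"
proof -
  interpret L: abelian_group "ell2_sum H :: ('i \<Rightarrow> 'a) cinner_space" by (rule abelian_group_ell2_sum)
  have d: "u m \<ominus>\<^bsub>ell2_sum H\<^esub> u n \<in> carrier (ell2_sum H)" for m n using u by simp
  have uc [simp]: "u n i \<in> carrier H" for n i using ell2_sum_closed[OF u] .
  have hnn: "0 \<le> hnorm (ell2_sum H) f" if "f \<in> carrier (ell2_sum H)" for f :: "'i \<Rightarrow> 'a"
    by (simp add: ell2_sum_hnorm[OF that] infsum_nonneg)
  have le: "(\<Sum>i\<in>F. (hnorm H (u m i \<ominus>\<^bsub>H\<^esub> u n i))\<^sup>2) \<le> (hnorm (ell2_sum H) (u m \<ominus>\<^bsub>ell2_sum H\<^esub> u n))\<^sup>2"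
    if "finite F" for m n F
    using ell2_sum_finite_le[OF d that, of m n] by (simp add: ell2_sum_minus[OF u u])
  have "\<exists>l\<in>carrier H. (\<lambda>n. hnorm H (u n i \<ominus>\<^bsub>H\<^esub> l)) \<longlonglongrightarrow> 0" for i
  proof (rule hilbert_complete)
    fix e :: real
    assume "0 < e"
    then obtain N where N: "\<forall>m\<ge>N. \<forall>n\<ge>N. hnorm (ell2_sum H) (u m \<ominus>\<^bsub>ell2_sum H\<^esub> u n) < e"
      using cauchy by blast
    have "hnorm H (u m i \<ominus>\<^bsub>H\<^esub> u n i) < e" if "m \<ge> N" "n \<ge> N" for m n
    proof -
      have "(hnorm H (u m i \<ominus>\<^bsub>H\<^esub> u n i))\<^sup>2 \<le> (hnorm (ell2_sum H) (u m \<ominus>\<^bsub>ell2_sum H\<^esub> u n))\<^sup>2"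
        using le[of "{i}" m n] by simp
      then have "hnorm H (u m i \<ominus>\<^bsub>H\<^esub> u n i) \<le> hnorm (ell2_sum H) (u m \<ominus>\<^bsub>ell2_sum H\<^esub> u n)"
        using hnn[OF d] by (rule power2_le_imp_le)
      then show ?thesis using N that by force
    qed
    then show "\<exists>N. \<forall>m\<ge>N. \<forall>n\<ge>N. hnorm H (u m i \<ominus>\<^bsub>H\<^esub> u n i) < e" by blast
  qed auto
  then obtain l where lc [simp]: "\<And>i. l i \<in> carrier H"
    and l: "\<And>i. (\<lambda>n. hnorm H (u n i \<ominus>\<^bsub>H\<^esub> l i)) \<longlonglongrightarrow> 0"
    by metis
  have fin: "(\<Sum>i\<in>F. (hnorm H (u n i \<ominus>\<^bsub>H\<^esub> l i))\<^sup>2) \<le> e\<^sup>2"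
    if F: "finite F" and N: "\<forall>m\<ge>N. \<forall>n\<ge>N. hnorm (ell2_sum H) (u m \<ominus>\<^bsub>ell2_sum H\<^esub> u n) < e" and n: "n \<ge> N"
    for F N n e
  proof (rule LIMSEQ_le_const2)
    show "(\<lambda>m. \<Sum>i\<in>F. (hnorm H (u n i \<ominus>\<^bsub>H\<^esub> u m i))\<^sup>2) \<longlonglongrightarrow> (\<Sum>i\<in>F. (hnorm H (u n i \<ominus>\<^bsub>H\<^esub> l i))\<^sup>2)"
      by (intro tendsto_sum tendsto_power hnorm_minus_tendsto l) auto
    have "(\<Sum>i\<in>F. (hnorm H (u n i \<ominus>\<^bsub>H\<^esub> u m i))\<^sup>2) \<le> e\<^sup>2" if "m \<ge> N" for m
    proof -
      have "(hnorm (ell2_sum H) (u n \<ominus>\<^bsub>ell2_sum H\<^esub> u m))\<^sup>2 \<le> e\<^sup>2"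
        by (rule power_mono[OF less_imp_le hnn[OF d]]) (use N n that in blast)
      then show ?thesis using le[OF F, of n m] by linarith
    qed
    then show "\<exists>M. \<forall>m\<ge>M. (\<Sum>i\<in>F. (hnorm H (u n i \<ominus>\<^bsub>H\<^esub> u m i))\<^sup>2) \<le> e\<^sup>2" by blast
  qed
  have diff: "(\<lambda>i. (hnorm H (u n i \<ominus>\<^bsub>H\<^esub> l i))\<^sup>2) summable_on UNIV \<and>
      (\<Sum>\<^sub>\<infinity>i. (hnorm H (u n i \<ominus>\<^bsub>H\<^esub> l i))\<^sup>2) \<le> e\<^sup>2"
    if "\<forall>m\<ge>N. \<forall>n\<ge>N. hnorm (ell2_sum H) (u m \<ominus>\<^bsub>ell2_sum H\<^esub> u n) < e" "n \<ge> N" for N n e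
  proof
    show s: "(\<lambda>i. (hnorm H (u n i \<ominus>\<^bsub>H\<^esub> l i))\<^sup>2) summable_on UNIV"
      by (rule nonneg_bdd_above_summable_on)
        (auto intro!: bdd_aboveI2[where M = "e\<^sup>2"] fin[OF _ that])
    show "(\<Sum>\<^sub>\<infinity>i. (hnorm H (u n i \<ominus>\<^bsub>H\<^esub> l i))\<^sup>2) \<le> e\<^sup>2"
      by (rule infsum_le_finite_sums[OF s]) (use fin[OF _ that] in auto)
  qed
  obtain M where M: "\<forall>m\<ge>M. \<forall>n\<ge>M. hnorm (ell2_sum H) (u m \<ominus>\<^bsub>ell2_sum H\<^esub> u n) < 1"
    using cauchy[of 1] by auto
  have "(\<lambda>i. u M i \<ominus>\<^bsub>H\<^esub> l i) \<in> carrier (ell2_sum H)"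
    using diff[OF M] by (simp add: ell2_sum_simps)
  then have "(\<lambda>i. u M i \<oplus>\<^bsub>H\<^esub> (-1) \<odot>\<^bsub>H\<^esub> (u M i \<ominus>\<^bsub>H\<^esub> l i)) \<in> carrier (ell2_sum H)"
    by (intro ell2_sum_add_closed u ell2_sum_smult_closed)
  moreover have "u M i \<oplus>\<^bsub>H\<^esub> (-1) \<odot>\<^bsub>H\<^esub> (u M i \<ominus>\<^bsub>H\<^esub> l i) = l i" for i
    by (rule hinner_ext) (auto simp: hinner_simps)
  ultimately have lL: "l \<in> carrier (ell2_sum H)" by simp
  have "(\<lambda>n. hnorm (ell2_sum H) (u n \<ominus>\<^bsub>ell2_sum H\<^esub> l)) \<longlonglongrightarrow> 0"
  proof (rule LIMSEQ_I)
    fix r :: real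
    assume r: "0 < r"
    then obtain N where N: "\<forall>m\<ge>N. \<forall>n\<ge>N. hnorm (ell2_sum H) (u m \<ominus>\<^bsub>ell2_sum H\<^esub> u n) < r / 2"
      using cauchy[of "r / 2"] by auto
    have "norm (hnorm (ell2_sum H) (u n \<ominus>\<^bsub>ell2_sum H\<^esub> l) - 0) < r" if "n \<ge> N" for n
    proof -
      have "hnorm (ell2_sum H) (u n \<ominus>\<^bsub>ell2_sum H\<^esub> l) \<le> r / 2"
        unfolding ell2_sum_hnorm[OF L.minus_closed[OF u lL]] unfolding ell2_sum_minus[OF u lL]
        by (rule real_le_lsqrt) (use diff[OF N that] r in auto)
      then show ?thesis using hnn[OF L.minus_closed[OF u lL], of n] r by simp
    qed
    then show "\<exists>N. \<forall>n\<ge>N. norm (hnorm (ell2_sum H) (u n \<ominus>\<^bsub>ell2_sum H\<^esub> l) - 0) < r" by blast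
  qed
  with lL show ?thesis by blast
qed

lemma hilbert_space_ell2_sum: "hilbert_space (ell2_sum H :: ('i \<Rightarrow> 'a) cinner_space)"
proof (intro hilbert_space.intro module_ell2_sum hilbert_space_axioms.intro ell2_sum_complete)
  fix x y z :: "'i \<Rightarrow> 'a" and c
  assume x: "x \<in> carrier (ell2_sum H)" and y: "y \<in> carrier (ell2_sum H)"
  note [simp] = ell2_sum_closed[OF x] ell2_sum_closed[OF y]
  show "hinner (ell2_sum H) (x \<oplus>\<^bsub>ell2_sum H\<^esub> y) z = hinner (ell2_sum H) x z + hinner (ell2_sum H) y z"
    if z: "z \<in> carrier (ell2_sum H)"
    using ell2_sum_hinner_summable[OF x z] ell2_sum_hinner_summable[OF y z] ell2_sum_closed[OF z]
    by (simp add: ell2_sum_simps(3,5) hinner_simps infsum_add)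
  show "hinner (ell2_sum H) (c \<odot>\<^bsub>ell2_sum H\<^esub> x) y = c * hinner (ell2_sum H) x y"
    using ell2_sum_hinner_summable[OF x y]
    by (simp add: ell2_sum_simps(4,5) hinner_simps infsum_cmult_right)
  show "hinner (ell2_sum H) y x = cnj (hinner (ell2_sum H) x y)"
    by (simp add: ell2_sum_simps(5) hinner_commute[of "x _" "y _"])
next
  fix x :: "'i \<Rightarrow> 'a"
  assume x: "x \<in> carrier (ell2_sum H)"
  show "0 \<le> Re (hinner (ell2_sum H) x x)"
    by (simp add: ell2_sum_hinner_self[OF x] infsum_nonneg)
  assume "hinner (ell2_sum H) x x = 0"
  then have "hnorm (ell2_sum H) x = 0" by (simp add: hnorm_def)
  then have "hnorm H (x i) = 0" for i
    using ell2_sum_finite_le[OF x, of "{i}"] by simp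
  then show "x = \<zero>\<^bsub>ell2_sum H\<^esub>"
    using hnorm_eq_zero ell2_sum_closed[OF x] by (simp add: ell2_sum_simps fun_eq_iff)
qed

end

text \<open>For bijective \<open>p\<close> this is \<open>T\<close> tensored with the permutation
  unitary of \<open>p\<close>. Its adjoint is the lift of the adjoint of \<open>T\<close> along the
  inverse of \<open>p\<close>.\<close>

definition lift_op :: "('a \<Rightarrow> 'a) \<Rightarrow> ('i \<Rightarrow> 'i) \<Rightarrow> ('i \<Rightarrow> 'a) \<Rightarrow> 'i \<Rightarrow> 'a" where
  "lift_op T p f = (\<lambda>i. T (f (p i)))"

context hilbert_space
begin

lemma bounded_operator_lift_op:
  fixes p :: "'i \<Rightarrow> 'i"
  assumes T: "bounded_operator H T" and p: "bij p"
  shows "bounded_operator (ell2_sum H) (lift_op T p)"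
proof -
  interpret L: hilbert_space "ell2_sum H :: ('i \<Rightarrow> 'a) cinner_space" by (rule hilbert_space_ell2_sum)
  obtain C where C: "C > 0" "\<And>x. x \<in> carrier H \<Longrightarrow> hnorm H (T x) \<le> C * hnorm H x"
    using bounded_operatorD(3)[OF T] by blast
  note Tc = bounded_operatorD(2)[OF T]
  have b: "(hnorm H (T x))\<^sup>2 \<le> C\<^sup>2 * (hnorm H x)\<^sup>2" if "x \<in> carrier H" for x
    using power_mono[OF C(2)[OF that], of 2] that Tc by (simp add: power_mult_distrib)
  have s: "(\<lambda>i. C\<^sup>2 * (hnorm H (f (p i)))\<^sup>2) summable_on UNIV"
    if f: "f \<in> carrier (ell2_sum H)" for f
    using summable_on_reindex_bij_betw[of p UNIV UNIV "\<lambda>i. (hnorm H (f i))\<^sup>2"] p ell2_sum_summable[OF f]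
    by (intro summable_on_cmult_right) simp
  have cl: "lift_op T p f \<in> carrier (ell2_sum H)" if f: "f \<in> carrier (ell2_sum H)" for f
    unfolding lift_op_def
    by (rule ell2_sumI[OF _ s[OF f]]) (use b[OF ell2_sum_closed[OF f]] Tc[OF ell2_sum_closed[OF f]] in auto)
  have "hnorm (ell2_sum H) (lift_op T p f) \<le> C * hnorm (ell2_sum H) f" if f: "f \<in> carrier (ell2_sum H)" for f
  proof -
    have "(\<Sum>\<^sub>\<infinity>i. (hnorm H (lift_op T p f i))\<^sup>2) \<le> (\<Sum>\<^sub>\<infinity>i. C\<^sup>2 * (hnorm H (f (p i)))\<^sup>2)"
      using ell2_sum_summable[OF cl[OF f]] s[OF f] ell2_sum_closed[OF f] b
      by (intro infsum_mono) (auto simp: lift_op_def)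
    also have "\<dots> = C\<^sup>2 * (\<Sum>\<^sub>\<infinity>i. (hnorm H (f i))\<^sup>2)"
      using infsum_reindex_bij_betw[of p UNIV UNIV "\<lambda>i. C\<^sup>2 * (hnorm H (f i))\<^sup>2"] p ell2_sum_summable[OF f]
      by (simp add: infsum_cmult_right)
    finally show ?thesis
      unfolding ell2_sum_hnorm[OF cl[OF f]] ell2_sum_hnorm[OF f]
      using C(1) by (metis real_sqrt_le_mono real_sqrt_mult real_sqrt_abs abs_of_pos)
  qed
  moreover have "linear_map (ell2_sum H) (ell2_sum H) (lift_op T p)"
    using cl linear_mapD[OF bounded_operatorD(1)[OF T]]
    by (auto simp: linear_map_def fun_eq_iff ell2_sum_simps(3,4) lift_op_def ell2_sum_closed)
  ultimately show ?thesis unfolding bounded_operator_def by blast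
qed

lemma normal_operator_lift_op:
  fixes p :: "'i \<Rightarrow> 'i"
  assumes N: "normal_operator H N" and p: "bij p"
  shows "normal_operator (ell2_sum H) (lift_op N p)"
proof -
  obtain S where S: "is_adjoint H N S" and NS: "commuting H N S" and bN: "bounded_operator H N"
    using N by (auto simp: normal_operator_def)
  have bS: "bounded_operator H S" and adj: "\<And>x y. x \<in> carrier H \<Longrightarrow> y \<in> carrier H \<Longrightarrow> hinner H (N x) y = hinner H x (S y)"
    using S by (auto simp: is_adjoint_def)
  have ip: "bij (inv_into UNIV p)" using p by (rule bij_imp_bij_inv)
  have "hinner (ell2_sum H) (lift_op N p f) g = hinner (ell2_sum H) f (lift_op S (inv_into UNIV p) g)"
    if f: "f \<in> carrier (ell2_sum H)" and g: "g \<in> carrier (ell2_sum H)" for f g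
  proof -
    have "(\<Sum>\<^sub>\<infinity>i. hinner H (N (f (p i))) (g i)) = (\<Sum>\<^sub>\<infinity>i. hinner H (f (p i)) (S (g (inv_into UNIV p (p i)))))"
      using adj ell2_sum_closed[OF f] ell2_sum_closed[OF g] p by (simp add: bij_is_inj)
    also have "\<dots> = (\<Sum>\<^sub>\<infinity>i. hinner H (f i) (S (g (inv_into UNIV p i))))"
      using infsum_reindex_bij_betw[of p UNIV UNIV "\<lambda>i. hinner H (f i) (S (g (inv_into UNIV p i)))"] p by simp
    finally show ?thesis by (simp add: ell2_sum_simps(5) lift_op_def)
  qed
  then have "is_adjoint (ell2_sum H) (lift_op N p) (lift_op S (inv_into UNIV p))"
    using bounded_operator_lift_op[OF bS ip] by (simp add: is_adjoint_def)
  moreover have "commuting (ell2_sum H) (lift_op N p) (lift_op S (inv_into UNIV p))"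
    using NS p
    by (auto simp: commuting_def lift_op_def fun_eq_iff ell2_sum_closed bij_is_inj bij_is_surj surj_f_inv_f)
  ultimately show ?thesis
    using bounded_operator_lift_op[OF bN p] by (auto simp: normal_operator_def)
qed

end

section \<open>Change of universe\<close>

text \<open>A carrier is tied to its type, so a change of universe means rebuilding the space on an
  encoded copy of a subspace \<open>C\<close>. Operations decode, compute in \<open>K\<close> and
  encode again, which is faithful as far as \<open>\<psi>\<close> is injective on
  \<open>C\<close>.\<close>

definition transport_space :: "'a cinner_space \<Rightarrow> 'a set \<Rightarrow> ('a \<Rightarrow> 'b) \<Rightarrow> 'b cinner_space" where
  "transport_space K C \<psi> = \<lparr>carrier = \<psi> ` C,
     monoid.mult = (\<lambda>_ _. undefined), one = undefined,
     zero = \<psi> \<zero>\<^bsub>K\<^esub>, add = (\<lambda>x y. \<psi> (inv_into C \<psi> x \<oplus>\<^bsub>K\<^esub> inv_into C \<psi> y)),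
     smult = (\<lambda>c x. \<psi> (c \<odot>\<^bsub>K\<^esub> inv_into C \<psi> x)),
     hinner = (\<lambda>x y. hinner K (inv_into C \<psi> x) (inv_into C \<psi> y))\<rparr>"

lemma transport_simps:
  "carrier (transport_space K C \<psi>) = \<psi> ` C"
  "zero (transport_space K C \<psi>) = \<psi> \<zero>\<^bsub>K\<^esub>"
  "add (transport_space K C \<psi>) = (\<lambda>x y. \<psi> (inv_into C \<psi> x \<oplus>\<^bsub>K\<^esub> inv_into C \<psi> y))"
  "smult (transport_space K C \<psi>) = (\<lambda>c x. \<psi> (c \<odot>\<^bsub>K\<^esub> inv_into C \<psi> x))"
  "hinner (transport_space K C \<psi>) = (\<lambda>x y. hinner K (inv_into C \<psi> x) (inv_into C \<psi> y))"
  by (simp_all add: transport_space_def)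

definition orthogonal_complement :: "'a cinner_space \<Rightarrow> 'a set \<Rightarrow> 'a set" where
  "orthogonal_complement H Z = {x \<in> carrier H. \<forall>z\<in>Z. hinner H x z = 0}"

text \<open>Presenting \<open>C\<close> as an orthogonal complement makes it closed: membership
  consists of equations that survive limits by \<open>hinner_tendsto\<close>, and this gives
  completeness of the copy.\<close>

locale transported_subspace = hilbert_space +
  fixes Z C :: "'a set" and \<psi> :: "'a \<Rightarrow> 'b"
  assumes C_eq: "C = orthogonal_complement H Z" and Z: "Z \<subseteq> carrier H" and inj: "inj_on \<psi> C"
begin

abbreviation K where "K \<equiv> transport_space H C \<psi>"
abbreviation g where "g \<equiv> inv_into C \<psi>"

lemma C_carrier [simp]: "x \<in> C \<Longrightarrow> x \<in> carrier H"
  unfolding C_eq orthogonal_complement_def by blast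

lemma C_closed [simp]:
  "\<zero>\<^bsub>H\<^esub> \<in> C" "x \<in> C \<Longrightarrow> y \<in> C \<Longrightarrow> x \<oplus>\<^bsub>H\<^esub> y \<in> C" "x \<in> C \<Longrightarrow> c \<odot>\<^bsub>H\<^esub> x \<in> C"
  "x \<in> C \<Longrightarrow> y \<in> C \<Longrightarrow> x \<ominus>\<^bsub>H\<^esub> y \<in> C"
  using Z unfolding C_eq orthogonal_complement_def by (auto simp: hinner_simps subset_iff)

lemma g_\<psi> [simp]: "x \<in> C \<Longrightarrow> g (\<psi> x) = x"
  using inj by simp

lemma hinner_\<psi>: "x \<in> C \<Longrightarrow> y \<in> C \<Longrightarrow> hinner K (\<psi> x) (\<psi> y) = hinner H x y"
  by (simp add: transport_simps)

lemma hnorm_\<psi>: "x \<in> C \<Longrightarrow> hnorm K (\<psi> x) = hnorm H x"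
  by (simp add: hnorm_def hinner_\<psi>)

lemma add_\<psi>: "x \<in> C \<Longrightarrow> y \<in> C \<Longrightarrow> \<psi> x \<oplus>\<^bsub>K\<^esub> \<psi> y = \<psi> (x \<oplus>\<^bsub>H\<^esub> y)"
  and smult_\<psi>: "x \<in> C \<Longrightarrow> c \<odot>\<^bsub>K\<^esub> \<psi> x = \<psi> (c \<odot>\<^bsub>H\<^esub> x)"
  by (simp_all add: transport_simps)

lemma abelian_group_K: "abelian_group K"
proof (rule abelian_groupI)
  fix x assume "x \<in> carrier K"
  then obtain x' where x: "x = \<psi> x'" "x' \<in> C" by (auto simp: transport_simps)
  have "(-1) \<odot>\<^bsub>H\<^esub> x' \<oplus>\<^bsub>H\<^esub> x' = \<zero>\<^bsub>H\<^esub>"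
    using x(2) by (intro hinner_ext) (auto simp: hinner_simps)
  then show "\<exists>y\<in>carrier K. y \<oplus>\<^bsub>K\<^esub> x = \<zero>\<^bsub>K\<^esub>"
    using x by (intro bexI[of _ "\<psi> ((-1) \<odot>\<^bsub>H\<^esub> x')"]) (auto simp: transport_simps)
qed (auto simp: transport_simps a_assoc a_comm a_lcomm)

lemma module_K: "module (ring_of_type_algebra :: complex ring) K"
proof (rule moduleI[OF cring_from_type_algebra abelian_group_K])
  fix a b :: complex and x y
  assume "x \<in> carrier K"
  then obtain x' where x: "x = \<psi> x'" "x' \<in> C" by (auto simp: transport_simps)
  note x(2) [simp]
  show "a \<odot>\<^bsub>K\<^esub> x \<in> carrier K" using x by (simp add: transport_simps)
  have "(a + b) \<odot>\<^bsub>H\<^esub> x' = a \<odot>\<^bsub>H\<^esub> x' \<oplus>\<^bsub>H\<^esub> b \<odot>\<^bsub>H\<^esub> x'"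
    by (intro hinner_ext) (auto simp: hinner_simps algebra_simps)
  then show "(a \<oplus>\<^bsub>ring_of_type_algebra\<^esub> b) \<odot>\<^bsub>K\<^esub> x = a \<odot>\<^bsub>K\<^esub> x \<oplus>\<^bsub>K\<^esub> b \<odot>\<^bsub>K\<^esub> x"
    using x by (simp add: smult_\<psi> add_\<psi> ring_of_type_algebra_def)
  have "(a * b) \<odot>\<^bsub>H\<^esub> x' = a \<odot>\<^bsub>H\<^esub> (b \<odot>\<^bsub>H\<^esub> x')"
    by (intro hinner_ext) (auto simp: hinner_simps algebra_simps)
  then show "(a \<otimes>\<^bsub>ring_of_type_algebra\<^esub> b) \<odot>\<^bsub>K\<^esub> x = a \<odot>\<^bsub>K\<^esub> (b \<odot>\<^bsub>K\<^esub> x)"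
    using x by (simp add: smult_\<psi> add_\<psi> ring_of_type_algebra_def)
  have "1 \<odot>\<^bsub>H\<^esub> x' = x'"
    by (intro hinner_ext) (auto simp: hinner_simps algebra_simps)
  then show "\<one>\<^bsub>ring_of_type_algebra\<^esub> \<odot>\<^bsub>K\<^esub> x = x"
    using x by (simp add: smult_\<psi> add_\<psi> ring_of_type_algebra_def)
  assume "y \<in> carrier K"
  then obtain y' where y: "y = \<psi> y'" "y' \<in> C" by (auto simp: transport_simps)
  have "a \<odot>\<^bsub>H\<^esub> (x' \<oplus>\<^bsub>H\<^esub> y') = a \<odot>\<^bsub>H\<^esub> x' \<oplus>\<^bsub>H\<^esub> a \<odot>\<^bsub>H\<^esub> y'"
    using y by (intro hinner_ext) (auto simp: hinner_simps algebra_simps)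
  then show "a \<odot>\<^bsub>K\<^esub> (x \<oplus>\<^bsub>K\<^esub> y) = a \<odot>\<^bsub>K\<^esub> x \<oplus>\<^bsub>K\<^esub> a \<odot>\<^bsub>K\<^esub> y"
    using x y by (simp add: smult_\<psi> add_\<psi>)
qed

lemma minus_\<psi>:
  assumes "x \<in> C" "y \<in> C"
  shows "\<psi> x \<ominus>\<^bsub>K\<^esub> \<psi> y = \<psi> (x \<ominus>\<^bsub>H\<^esub> y)"
proof -
  interpret L: abelian_group K by (rule abelian_group_K)
  have "(-1) \<odot>\<^bsub>H\<^esub> y \<oplus>\<^bsub>H\<^esub> y = \<zero>\<^bsub>H\<^esub>"
    using assms by (intro hinner_ext) (auto simp: hinner_simps)
  then have "\<ominus>\<^bsub>K\<^esub> \<psi> y = \<psi> ((-1) \<odot>\<^bsub>H\<^esub> y)"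
    using assms by (intro L.minus_equality) (auto simp: transport_simps)
  then show ?thesis
    using assms by (simp add: a_minus_def[of K] add_\<psi> minus_eq_add_smult)
qed

lemma hilbert_space_K: "hilbert_space K"
proof (intro hilbert_space.intro module_K hilbert_space_axioms.intro)
  fix u :: "nat \<Rightarrow> 'b"
  assume u: "\<And>n. u n \<in> carrier K"
    and cauchy: "\<And>e. 0 < e \<Longrightarrow> \<exists>N. \<forall>m\<ge>N. \<forall>n\<ge>N. hnorm K (u m \<ominus>\<^bsub>K\<^esub> u n) < e"
  define v where "v n = g (u n)" for n
  have v [simp]: "v n \<in> C" and u_eq: "u n = \<psi> (v n)" for n
    using u[of n] by (auto simp: v_def transport_simps)
  have "\<exists>l\<in>carrier H. (\<lambda>n. hnorm H (v n \<ominus>\<^bsub>H\<^esub> l)) \<longlonglongrightarrow> 0"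
    by (rule hilbert_complete) (use cauchy in \<open>simp_all add: u_eq minus_\<psi> hnorm_\<psi>\<close>)
  then obtain l where l: "l \<in> carrier H" "(\<lambda>n. hnorm H (v n \<ominus>\<^bsub>H\<^esub> l)) \<longlonglongrightarrow> 0" by blast
  have "hinner H l z = 0" if z: "z \<in> Z" for z
  proof -
    have "(\<lambda>n. hinner H (v n) z) \<longlonglongrightarrow> hinner H l z"
      by (rule hinner_tendsto) (use l z Z in auto)
    moreover have "hinner H (v n) z = 0" for n
      using v[of n] z unfolding C_eq orthogonal_complement_def by blast
    ultimately show ?thesis by (simp add: LIMSEQ_const_iff)
  qed
  then have "l \<in> C" using l unfolding C_eq orthogonal_complement_def by blast
  then show "\<exists>l\<in>carrier K. (\<lambda>n. hnorm K (u n \<ominus>\<^bsub>K\<^esub> l)) \<longlonglongrightarrow> 0"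
    using l by (intro bexI[of _ "\<psi> l"]) (simp_all add: u_eq minus_\<psi> hnorm_\<psi>, simp add: transport_simps)
next
  fix x
  assume "x \<in> carrier K" and x0: "hinner K x x = 0"
  then obtain x' where x: "x = \<psi> x'" "x' \<in> C" by (auto simp: transport_simps)
  then have "x' = \<zero>\<^bsub>H\<^esub>" using x0 by (intro hinner_definite) (simp_all add: hinner_\<psi>)
  then show "x = \<zero>\<^bsub>K\<^esub>" using x by (simp add: transport_simps)
qed (auto simp: transport_simps hinner_simps hinner_commute[symmetric] intro: hinner_nonneg)

lemma bounded_operator_transport:
  assumes T: "bounded_operator H T" and C: "\<And>x. x \<in> C \<Longrightarrow> T x \<in> C"
  shows "bounded_operator K (\<lambda>x. \<psi> (T (g x)))"
proof -
  obtain D where D: "\<forall>x\<in>carrier H. hnorm H (T x) \<le> D * hnorm H x"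
    using T by (auto simp: bounded_operator_def)
  have "hnorm K (\<psi> (T (g x))) \<le> D * hnorm K x" if "x \<in> carrier K" for x
    using that D C by (auto simp: transport_simps(1) hnorm_\<psi>)
  moreover have "linear_map K K (\<lambda>x. \<psi> (T (g x)))"
    using C linear_mapD(2,3)[OF bounded_operatorD(1)[OF T]]
    by (auto simp: linear_map_def transport_simps)
  ultimately show ?thesis unfolding bounded_operator_def by blast
qed

lemma normal_operator_transport:
  assumes N: "bounded_operator H N" and S: "is_adjoint H N S" and comm: "commuting H N S"
    and CN: "\<And>x. x \<in> C \<Longrightarrow> N x \<in> C" and CS: "\<And>x. x \<in> C \<Longrightarrow> S x \<in> C"
  shows "normal_operator K (\<lambda>x. \<psi> (N (g x)))"
  unfolding normal_operator_def
proof (intro conjI exI)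
  show "bounded_operator K (\<lambda>x. \<psi> (N (g x)))"
    by (rule bounded_operator_transport[OF N CN])
  show "is_adjoint K (\<lambda>x. \<psi> (N (g x))) (\<lambda>x. \<psi> (S (g x)))"
    using bounded_operator_transport[of S, OF _ CS] S CN CS
    by (auto simp: is_adjoint_def transport_simps)
  show "commuting K (\<lambda>x. \<psi> (N (g x))) (\<lambda>x. \<psi> (S (g x)))"
    using comm CN CS by (auto simp: commuting_def transport_simps)
qed

end

section \<open>Totality of the basis vectors and the size of a universe\<close>

lemma basis_vec_closed [simp]: "basis_vec k \<in> carrier ell2"
proof -
  have "(\<lambda>j. (cmod (basis_vec k j))\<^sup>2) summable_on UNIV \<longleftrightarrow> (\<lambda>j. (cmod (basis_vec k j))\<^sup>2) summable_on {k}"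
    by (rule summable_on_cong_neutral) (auto simp: basis_vec_def)
  then show ?thesis by (simp add: ell2_simps)
qed

lemma hnorm_basis_vec [simp]: "hnorm ell2 (basis_vec k) = 1"
proof -
  have "(\<Sum>\<^sub>\<infinity>j. (cmod (basis_vec k j))\<^sup>2) = (\<Sum>\<^sub>\<infinity>j\<in>{k}. (cmod (basis_vec k j))\<^sup>2)"
    by (rule infsum_cong_neutral) (auto simp: basis_vec_def)
  then show ?thesis by (simp add: ell2_hnorm) (simp add: basis_vec_def)
qed

lemma ell2_restrict_closed:
  assumes "x \<in> carrier ell2"
  shows "(\<lambda>k. if k \<in> F then x k else 0) \<in> carrier ell2"
  using ell2_bound_summable[of x x "\<lambda>k. if k \<in> F then x k else 0" 1 0] assms
  by (simp add: ell2_simps)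

text \<open>Finite truncations are combinations of basis vectors, and the norms of the tails tend to
  0. It is used to place the range of an isometry inside a closed subspace by looking at basis
  vectors alone.\<close>

lemma ell2_functional_eqI:
  fixes l :: "('i \<Rightarrow> complex) \<Rightarrow> complex"
  assumes add: "\<And>x y. x \<in> carrier ell2 \<Longrightarrow> y \<in> carrier ell2 \<Longrightarrow> l (\<lambda>k. x k + y k) = l x + l y"
    and smult: "\<And>c x. x \<in> carrier ell2 \<Longrightarrow> l (\<lambda>k. c * x k) = c * l x"
    and bound: "\<And>x. x \<in> carrier ell2 \<Longrightarrow> cmod (l x) \<le> D * hnorm ell2 x" and D: "D \<ge> 0"
    and basis: "\<And>k. l (basis_vec k) = 0" and x: "x \<in> carrier ell2"
  shows "l x = 0"
proof -
  have l0: "l (\<lambda>_. 0) = 0" using smult[OF x, of 0] by simp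
  have fin: "l (\<lambda>k. if k \<in> F then x k else 0) = 0" if "finite F" for F
    using that
  proof (induction F rule: finite_induct)
    case (insert k F)
    have "(\<lambda>j. if j \<in> insert k F then x j else 0) = (\<lambda>j. x k * basis_vec k j + (if j \<in> F then x j else 0))"
      using insert by (auto simp: basis_vec_def fun_eq_iff)
    moreover have "(\<lambda>j. x k * basis_vec k j) \<in> carrier ell2"
      using basis_vec_closed[of k] by (simp add: ell2_simps ell2_smult_summable)
    ultimately show ?case
      using insert add[of "\<lambda>j. x k * basis_vec k j"] smult[OF basis_vec_closed] basis ell2_restrict_closed[OF x] by simp
  qed (use l0 in simp)
  define s where "s = (\<lambda>k. (cmod (x k))\<^sup>2)"
  have s: "s summable_on UNIV" using x by (simp add: ell2_simps s_def)
  have sm: "cmod (l x) \<le> D * sqrt e" if e: "e > 0" for e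
  proof -
    obtain F where F: "finite F" "sum s F > infsum s UNIV - e"
    proof (rule ccontr)
      assume "\<not> thesis"
      then have "sum s F \<le> infsum s UNIV - e" if "finite F" for F
        using that \<open>\<And>F. finite F \<Longrightarrow> infsum s UNIV - e < sum s F \<Longrightarrow> thesis\<close> by force
      then have "infsum s UNIV \<le> infsum s UNIV - e"
        by (intro infsum_le_finite_sums[OF s]) auto
      then show False using e by simp
    qed
    let ?y = "\<lambda>k. if k \<in> - F then x k else 0"
    have y: "?y \<in> carrier ell2" by (rule ell2_restrict_closed[OF x])
    have "(\<lambda>k. (if k \<in> F then x k else 0) + ?y k) = x" by (auto simp: fun_eq_iff)
    then have "l x = l ?y"
      using add[OF ell2_restrict_closed[OF x, of F] y] fin[OF F(1)] by simp
    also have "cmod (l ?y) \<le> D * hnorm ell2 ?y" by (rule bound[OF y])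
    also have "hnorm ell2 ?y = sqrt (infsum s (- F))"
      unfolding ell2_hnorm[OF y] by (intro arg_cong[of _ _ sqrt] infsum_cong_neutral) (auto simp: s_def)
    also have "infsum s (- F) = infsum s UNIV - sum s F"
      using infsum_Diff[OF s, of F] F(1) by (simp add: Compl_eq_Diff_UNIV)
    also have "D * sqrt (infsum s UNIV - sum s F) \<le> D * sqrt e"
      using F D by (intro mult_left_mono real_sqrt_le_mono) auto
    finally show ?thesis .
  qed
  have "(\<lambda>n. D * sqrt (1 / Suc n)) \<longlonglongrightarrow> D * sqrt 0"
    by (intro tendsto_intros LIMSEQ_Suc[OF lim_const_over_n])
  then have "cmod (l x) \<le> D * sqrt 0"
    by (rule LIMSEQ_le_const) (use sm in auto)
  then show ?thesis by simp
qed

text \<open>The map z / (1 + |z|) is injective and bounded by 1; square-summable weights 2^-m, with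
  m the code of the index, then force the image into \<open>ell2\<close>. Hence a type that carries
  an isometric copy of \<open>ell2\<close> has room for all functions in the domain of
  \<open>\<phi>\<close>, as \<open>H_infinity_universe\<close> demands.\<close>

lemma ell2_geometric_embedding:
  "\<exists>\<phi> :: (nat \<times> nat \<Rightarrow> complex) \<Rightarrow> (nat \<times> nat \<Rightarrow> complex). inj \<phi> \<and> range \<phi> \<subseteq> carrier ell2"
proof -
  define \<phi> where "\<phi> f k = of_real ((1/2) ^ prod_encode k) * (of_real (1 / (1 + cmod (f k))) * f k)"
    for f :: "nat \<times> nat \<Rightarrow> complex" and k
  have "inj \<phi>"
  proof (rule injI, rule ext)
    fix f g k
    assume "\<phi> f = \<phi> g"
    then have "\<phi> f k = \<phi> g k" by simp
    then have e: "of_real (1 / (1 + cmod (f k))) * f k = of_real (1 / (1 + cmod (g k))) * g k"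
      unfolding \<phi>_def by (subst (asm) mult_cancel_left) simp
    have pos: "1 + cmod (f k) > 0" "1 + cmod (g k) > 0" by (simp_all add: add_pos_nonneg)
    have "cmod (f k) / (1 + cmod (f k)) = cmod (g k) / (1 + cmod (g k))"
      using arg_cong[OF e, of cmod] pos by (simp only: norm_mult norm_of_real) simp
    then have "cmod (f k) = cmod (g k)" using pos by (simp add: field_simps)
    then show "f k = g k"
      using e pos by (simp del: of_real_divide of_real_add)
  qed
  moreover have "\<phi> f \<in> carrier ell2" for f
  proof -
    have "summable (\<lambda>n. ((1/2::real) ^ n)\<^sup>2)"
      by (simp add: power2_eq_square flip: power_mult_distrib)
    then have "(\<lambda>n. ((1/2::real) ^ n)\<^sup>2) summable_on UNIV"
      by (intro norm_summable_imp_summable_on) simp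
    then have s: "(\<lambda>k. ((1/2::real) ^ prod_encode k)\<^sup>2) summable_on UNIV"
      using summable_on_reindex_bij_betw[of prod_encode UNIV UNIV "\<lambda>n. ((1/2::real) ^ n)\<^sup>2"]
        bij_prod_encode by simp
    have "(\<lambda>k. (cmod (\<phi> f k))\<^sup>2) summable_on UNIV"
    proof (rule summable_on_comparison_test[OF s])
      fix k
      have "cmod (f k) / (1 + cmod (f k)) \<le> 1" by (simp add: add_pos_nonneg)
      then have "(1/2) ^ prod_encode k * (cmod (f k) / (1 + cmod (f k))) \<le> (1/2) ^ prod_encode k * 1"
        by (intro mult_left_mono) auto
      moreover have "cmod (\<phi> f k) = (1/2) ^ prod_encode k * (cmod (f k) / (1 + cmod (f k)))"
        unfolding \<phi>_def norm_mult norm_of_real by simp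
      ultimately show "(cmod (\<phi> f k))\<^sup>2 \<le> ((1/2) ^ prod_encode k)\<^sup>2"
        by (intro power_mono) auto
    qed simp
    then show ?thesis by (simp add: ell2_simps)
  qed
  ultimately show ?thesis by blast
qed

lemma isometry_inj_on:
  assumes H: "hilbert_space H" and K: "hilbert_space K" and V: "isometry H K V"
  shows "inj_on V (carrier H)"
proof (rule inj_onI)
  interpret H: hilbert_space H by (rule H)
  interpret K: hilbert_space K by (rule K)
  fix x y
  assume x: "x \<in> carrier H" and y: "y \<in> carrier H" and e: "V x = V y"
  have lin: "linear_map H K V" using V by (simp add: isometry_def)
  note Vc = H.linear_mapD(1)[OF lin]
  have "V (x \<oplus>\<^bsub>H\<^esub> (-1) \<odot>\<^bsub>H\<^esub> y) = V x \<oplus>\<^bsub>K\<^esub> (-1) \<odot>\<^bsub>K\<^esub> V y"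
    using x y by (simp add: H.linear_mapD(2,3)[OF lin])
  also have "\<dots> = \<zero>\<^bsub>K\<^esub>"
    unfolding e using Vc[OF y] by (intro K.hinner_ext) (auto simp: K.hinner_simps)
  finally have "hnorm H (x \<ominus>\<^bsub>H\<^esub> y) = 0"
    using V x y K.hnorm_zero unfolding isometry_def by (metis H.minus_eq_add_smult H.minus_closed)
  then have "x \<ominus>\<^bsub>H\<^esub> y = \<zero>\<^bsub>H\<^esub>" using x y by (intro H.hnorm_eq_zero) auto
  then have "hinner H x z = hinner H y z" if "z \<in> carrier H" for z
    using H.hinner_minus_left[OF x y that] that by simp
  then show "x = y" using x y by (intro H.hinner_ext) auto
qed

text \<open>A minimal normal extension is separable, so its universe is immaterial as long as the
  universe is large enough to contain a separable Hilbert space.\<close>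

theorem H_infinity_universe:
  fixes T1 T2 :: "('i :: countable \<Rightarrow> complex) \<Rightarrow> ('i \<Rightarrow> complex)"
    and \<phi> :: "(nat \<times> nat \<Rightarrow> complex) \<Rightarrow> 'k"
  assumes T: "(T1, T2) \<in> H_infinity TYPE('a) ell2" and \<phi>: "inj \<phi>"
  shows "(T1, T2) \<in> H_infinity TYPE('k) ell2"
proof -
  let ?E = "ell2 :: ('i \<Rightarrow> complex) cinner_space"
  interpret E: hilbert_space ?E by (rule hilbert_space_ell2)
  from T obtain K :: "'a cinner_space" and V N1 N2 where K: "hilbert_space K" and V: "isometry ell2 K V"
    and N: "normal_operator K N1" "normal_operator K N2" "commuting K N1 N2"
    and VN: "\<And>x. x \<in> carrier ell2 \<Longrightarrow> N1 (V x) = V (T1 x)" "\<And>x. x \<in> carrier ell2 \<Longrightarrow> N2 (V x) = V (T2 x)"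
    and bT: "bounded_operator ell2 T1" "bounded_operator ell2 T2"
    by (auto simp: H_infinity_def)
  interpret K: hilbert_space K by (rule K)
  from N obtain S1 S2 where S: "is_adjoint K N1 S1" "commuting K N1 S1" "is_adjoint K N2 S2" "commuting K N2 S2"
    by (auto simp: normal_operator_def)
  have bN: "bounded_operator K N1" "bounded_operator K N2" and bS: "bounded_operator K S1" "bounded_operator K S2"
    using N S by (auto simp: normal_operator_def is_adjoint_def)
  have adj: "hinner K (N1 x) y = hinner K x (S1 y)" "hinner K (N2 x) y = hinner K x (S2 y)"
    if "x \<in> carrier K" "y \<in> carrier K" for x y
    using S that by (auto simp: is_adjoint_def)
  have adj': "hinner K (S1 x) y = hinner K x (N1 y)" "hinner K (S2 x) y = hinner K x (N2 y)"
    if "x \<in> carrier K" "y \<in> carrier K" for x y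
    using that adj K.bounded_operatorD(2)[OF bN(1)] K.bounded_operatorD(2)[OF bN(2)]
      K.bounded_operatorD(2)[OF bS(1)] K.bounded_operatorD(2)[OF bS(2)]
    by (metis K.hinner_commute)+
  have lV: "linear_map ell2 K V" using V by (simp add: isometry_def)
  note cl [simp] = K.bounded_operatorD(2)[OF bN(1)] K.bounded_operatorD(2)[OF bN(2)]
    K.bounded_operatorD(2)[OF bS(1)] K.bounded_operatorD(2)[OF bS(2)] E.linear_mapD(1)[OF lV]
    E.bounded_operatorD(2)[OF bT(1)] E.bounded_operatorD(2)[OF bT(2)]
  \<comment> \<open>The letters are the two normal operators and their adjoints. Words in them
    applied to basis vectors form a countable family whose closed span reduces both
    operators.\<close>
  define op where "op i = (if i = 0 then N1 else if i = 1 then S1 else if i = 2 then N2 else S2)" for i :: nat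
  define word where "word p = foldr op (fst p) (V (basis_vec (snd p)))" for p :: "nat list \<times> 'i"
  have opc: "op i x \<in> carrier K" if "x \<in> carrier K" for i x using that by (simp add: op_def)
  have wc [simp]: "word p \<in> carrier K" for p
  proof -
    have "foldr op is x \<in> carrier K" if "x \<in> carrier K" for "is" x
      using that by (induction "is") (auto simp: opc)
    then show ?thesis by (simp add: word_def)
  qed
  have wop: "op i (word p) = word (i # fst p, snd p)" for i p by (simp add: word_def)
  \<comment> \<open>\<open>C\<close> is the double orthogonal complement of the words, that is,
    their closed span.\<close>
  define Z where "Z = {z \<in> carrier K. \<forall>p. hinner K z (word p) = 0}"
  define C where "C = orthogonal_complement K Z"
  \<comment> \<open>A vector of \<open>C\<close> is determined by its inner products with the
    countably many words. This sequence of complex numbers, re-indexed by pairs, is what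
    \<open>\<phi>\<close> can encode.\<close>
  define \<psi> where "\<psi> x = \<phi> (\<lambda>k. hinner K x (word (from_nat (prod_encode k))))" for x
  have CI: "x \<in> C" if "x \<in> carrier K" "\<And>z. z \<in> Z \<Longrightarrow> hinner K x z = 0" for x
    using that by (simp add: C_def orthogonal_complement_def)
  have CD: "x \<in> carrier K" "\<And>z. z \<in> Z \<Longrightarrow> hinner K x z = 0" if "x \<in> C" for x
    using that by (simp_all add: C_def orthogonal_complement_def)
  have Zc: "Z \<subseteq> carrier K" by (auto simp: Z_def)
  have wZ: "hinner K (word p) z = 0" if "z \<in> Z" for z p
    using that K.hinner_commute[of z "word p"] by (simp add: Z_def del: split_paired_All)
  have inj: "inj_on \<psi> C"
  proof (rule inj_onI)
    fix x y
    assume x: "x \<in> C" and y: "y \<in> C" and e: "\<psi> x = \<psi> y"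
    note xy = CD(1)[OF x] CD(1)[OF y]
    have f: "(\<lambda>k. hinner K x (word (from_nat (prod_encode k)))) = (\<lambda>k. hinner K y (word (from_nat (prod_encode k))))"
      using e by (simp only: \<psi>_def inj_eq[OF \<phi>])
    have "hinner K x (word p) = hinner K y (word p)" for p
      using fun_cong[OF f, of "prod_decode (to_nat p)"] by simp
    then have z: "x \<ominus>\<^bsub>K\<^esub> y \<in> Z" using xy by (simp add: Z_def K.hinner_simps)
    have "hinner K (x \<ominus>\<^bsub>K\<^esub> y) (x \<ominus>\<^bsub>K\<^esub> y) = 0"
      using CD(2)[OF x z] CD(2)[OF y z] xy by (simp add: K.hinner_minus_left)
    then have "x \<ominus>\<^bsub>K\<^esub> y = \<zero>\<^bsub>K\<^esub>" using xy by (intro K.hinner_definite) auto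
    then have "hinner K x z = hinner K y z" if "z \<in> carrier K" for z
      using K.hinner_minus_left[OF xy that] that by simp
    then show "x = y" using xy by (intro K.hinner_ext) auto
  qed
  interpret L: transported_subspace K Z C \<psi>
    by unfold_locales (use C_def Zc inj in auto)
  \<comment> \<open>The adjoint of a letter is again a letter (0 and 1 swap, and so do 2 and 3), so
    the complement of the words is invariant, and by the same reasoning so is
    \<open>C\<close>.\<close>
  have zop: "op i z \<in> Z" if "z \<in> Z" for i z
  proof -
    have z: "z \<in> carrier K" using that Zc by blast
    have "\<exists>j. \<forall>x\<in>carrier K. \<forall>y\<in>carrier K. hinner K (op i x) y = hinner K x (op j y)"
      by (rule exI[of _ "if i = 0 then 1 else if i = 1 then 0 else if i = 2 then 3 else 2"])
        (simp add: op_def adj adj')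
    then obtain j where "hinner K (op i z) (word p) = hinner K z (op j (word p))" for p
      using z wc by blast
    then show ?thesis using that z opc unfolding Z_def by (simp add: wop)
  qed
  have Cop: "op i x \<in> C" if x: "x \<in> C" for i x
  proof -
    have "\<exists>j. \<forall>x\<in>carrier K. \<forall>y\<in>carrier K. hinner K (op i x) y = hinner K x (op j y)"
      by (rule exI[of _ "if i = 0 then 1 else if i = 1 then 0 else if i = 2 then 3 else 2"])
        (simp add: op_def adj adj')
    then obtain j where j: "\<And>x y. x \<in> carrier K \<Longrightarrow> y \<in> carrier K \<Longrightarrow> hinner K (op i x) y = hinner K x (op j y)"
      by blast
    show ?thesis
    proof (rule CI)
      show "op i x \<in> carrier K" by (rule opc[OF CD(1)[OF x]])
      show "hinner K (op i x) z = 0" if "z \<in> Z" for z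
        using j[OF CD(1)[OF x], of z] CD(2)[OF x zop[OF that]] that Zc by (simp add: subset_iff)
    qed
  qed
  have CN: "N1 x \<in> C" "S1 x \<in> C" "N2 x \<in> C" "S2 x \<in> C" if "x \<in> C" for x
    using Cop[OF that, of 0] Cop[OF that, of 1] Cop[OF that, of 2] Cop[OF that, of 3]
    by (simp_all add: op_def)
  have VC: "V x \<in> C" if x: "x \<in> carrier ell2" for x
  proof -
    have "hinner K (V x) z = 0" if z: "z \<in> Z" for z
    proof (rule ell2_functional_eqI[where l = "\<lambda>x. hinner K (V x) z" and D = "hnorm K z"])
      have zc: "z \<in> carrier K" using z Zc by blast
      show "hinner K (V (\<lambda>k. x k + y k)) z = hinner K (V x) z + hinner K (V y) z"
        if "x \<in> carrier ell2" "y \<in> carrier ell2" for x y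
        using E.linear_mapD(2)[OF lV that] that zc by (simp add: ell2_simps(3) K.hinner_simps)
      show "hinner K (V (\<lambda>k. c * x k)) z = c * hinner K (V x) z" if "x \<in> carrier ell2" for c x
        using E.linear_mapD(3)[OF lV that, of c] that zc by (simp add: ell2_simps(4) K.hinner_simps)
      show "cmod (hinner K (V x) z) \<le> hnorm K z * hnorm ell2 x" if "x \<in> carrier ell2" for x
        using K.hinner_cauchy_schwarz[of "V x" z] V that zc by (simp add: isometry_def mult.commute)
      show "hinner K (V (basis_vec k)) z = 0" for k
        using wZ[OF z, of "([], k)"] by (simp add: word_def)
    qed (use x z Zc in auto)
    then show ?thesis using x by (intro CI) auto
  qed
  let ?L = "transport_space K C \<psi>" and ?g = "inv_into C \<psi>"
  have "isometry ell2 ?L (\<lambda>x. \<psi> (V x))"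
    unfolding isometry_def linear_map_def
  proof (intro conjI ballI allI)
    show "(\<lambda>x. \<psi> (V x)) \<in> carrier ell2 \<rightarrow> carrier ?L" using VC by (auto simp: transport_simps)
  qed (use V VC in \<open>simp_all add: isometry_def linear_map_def L.add_\<psi> L.smult_\<psi> L.hnorm_\<psi>\<close>)
  moreover have "normal_operator ?L (\<lambda>x. \<psi> (N1 (?g x)))" "normal_operator ?L (\<lambda>x. \<psi> (N2 (?g x)))"
    using L.normal_operator_transport[OF bN(1) S(1,2)] L.normal_operator_transport[OF bN(2) S(3,4)] CN by blast+
  moreover have "commuting ?L (\<lambda>x. \<psi> (N1 (?g x))) (\<lambda>x. \<psi> (N2 (?g x)))"
    using N(3) CN by (auto simp: commuting_def transport_simps)
  moreover have "\<forall>x\<in>carrier ell2. \<psi> (N1 (?g (\<psi> (V x)))) = \<psi> (V (T1 x)) \<and> \<psi> (N2 (?g (\<psi> (V x)))) = \<psi> (V (T2 x))"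
    using VC VN by simp
  ultimately show ?thesis
    using bT L.hilbert_space_K unfolding H_infinity_def by blast
qed

section \<open>Subnormality and moments\<close>

text \<open>The vectors N^a Q^b x0 have the norms wanted but need not be orthogonal. Placing them,
  normalised, at the index (a, b) of a direct sum makes them so; lifting N and Q along the index
  shifts then reproduces the weights as ratios of the norms \<open>G\<close>. Indices are integers
  because the shifts must be bijective for the lifts to be normal.\<close>

theorem H_infinity_model:
  fixes K :: "'a cinner_space"
  assumes K: "hilbert_space K" and N: "normal_operator K N" and Q: "normal_operator K Q"
    and NQ: "commuting K N Q" and x0: "x0 \<in> carrier K"
    and T: "bounded_operator ell2 (shift1 \<alpha>)" "bounded_operator ell2 (shift2 \<beta>)"
    and G: "\<And>a b. hnorm K ((N ^^ a) ((Q ^^ b) x0)) = G (a, b)" "\<And>k. G k > 0"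
    and \<alpha>: "\<And>a b. G (Suc a, b) = \<alpha> (a, b) * G (a, b)"
    and \<beta>: "\<And>a b. G (a, Suc b) = \<beta> (a, b) * G (a, b)"
  shows "(shift1 \<alpha>, shift2 \<beta>) \<in> H_infinity TYPE(int \<times> int \<Rightarrow> 'a) ell2"
proof -
  interpret K: hilbert_space K by (rule K)
  have bN: "bounded_operator K N" and bQ: "bounded_operator K Q"
    using N Q by (auto simp: normal_operator_def)
  note cl [simp] = K.bounded_operatorD(2)[OF bN] K.bounded_operatorD(2)[OF bQ]
  define v where "v a b = (N ^^ a) ((Q ^^ b) x0)" for a b
  have vc [simp]: "v a b \<in> carrier K" for a b
    using x0 by (simp add: v_def K.funpow_closed)
  have vN: "N (v a b) = v (Suc a) b" for a b by (simp add: v_def)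
  have vQ: "Q (v a b) = v a (Suc b)" for a b
    unfolding v_def
    using K.funpow_commute_carrier[of N Q "(Q ^^ b) x0" a] NQ x0 by (simp add: commuting_def K.funpow_closed)
  note lN = K.linear_mapD[OF K.bounded_operatorD(1)[OF bN]] and lQ = K.linear_mapD[OF K.bounded_operatorD(1)[OF bQ]]
  have zero_smult: "0 \<odot>\<^bsub>K\<^esub> x = \<zero>\<^bsub>K\<^esub>" if "x \<in> carrier K" for x
    using that by (intro K.hinner_ext) (auto simp: K.hinner_simps)
  have N0: "N \<zero>\<^bsub>K\<^esub> = \<zero>\<^bsub>K\<^esub>" "Q \<zero>\<^bsub>K\<^esub> = \<zero>\<^bsub>K\<^esub>"
    using lN(3)[of x0 0] lQ(3)[of x0 0] x0 by (simp_all add: zero_smult)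
  let ?E = "ell2 :: (nat \<times> nat \<Rightarrow> complex) cinner_space"
  let ?L = "ell2_sum K :: (int \<times> int \<Rightarrow> 'a) cinner_space"
  interpret E: hilbert_space ?E by (rule hilbert_space_ell2)
  define V where "V f = (\<lambda>(i, j). if 0 \<le> i \<and> 0 \<le> j then
      (f (nat i, nat j) / of_real (G (nat i, nat j))) \<odot>\<^bsub>K\<^esub> v (nat i) (nat j) else \<zero>\<^bsub>K\<^esub>)"
    for f :: "nat \<times> nat \<Rightarrow> complex"
  define h where "h = (\<lambda>(a, b). (int a, int b))"
  have h: "inj h" by (auto simp: h_def inj_on_def)
  have Vc: "V f i \<in> carrier K" for f i by (auto simp: V_def split: prod.split)
  have vG: "hnorm K (v a b) = G (a, b)" for a b by (simp add: v_def G(1))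
  have Vh: "(hnorm K (V f (h k)))\<^sup>2 = (cmod (f k))\<^sup>2" for f k
    using G(2)[of k] by (cases k) (auto simp: h_def V_def K.hnorm_smult norm_divide vG)
  have V0: "V f i = \<zero>\<^bsub>K\<^esub>" if "i \<notin> range h" for f i
  proof (rule ccontr)
    assume "V f i \<noteq> \<zero>\<^bsub>K\<^esub>"
    then have "0 \<le> fst i" "0 \<le> snd i" by (auto simp: V_def split: prod.splits if_splits)
    then have "i = h (nat (fst i), nat (snd i))" by (simp add: h_def)
    then show False using that by blast
  qed
  have sum_V: "(\<lambda>i. (hnorm K (V f i))\<^sup>2) summable_on UNIV \<and>
      (\<Sum>\<^sub>\<infinity>i. (hnorm K (V f i))\<^sup>2) = (\<Sum>\<^sub>\<infinity>k. (cmod (f k))\<^sup>2)" if f: "f \<in> carrier ?E" for f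
  proof
    have f': "(\<lambda>k. (cmod (f k))\<^sup>2) summable_on UNIV" using f by (simp add: ell2_simps)
    have "(\<lambda>i. (hnorm K (V f i))\<^sup>2) summable_on range h"
      using summable_on_reindex[OF h, of "\<lambda>i. (hnorm K (V f i))\<^sup>2"] f' by (simp add: comp_def Vh)
    then show "(\<lambda>i. (hnorm K (V f i))\<^sup>2) summable_on UNIV"
      by (subst summable_on_cong_neutral[of "range h" UNIV]) (auto simp: V0)
    have "(\<Sum>\<^sub>\<infinity>i. (hnorm K (V f i))\<^sup>2) = (\<Sum>\<^sub>\<infinity>i\<in>range h. (hnorm K (V f i))\<^sup>2)"
      by (rule infsum_cong_neutral) (auto simp: V0)
    also have "\<dots> = (\<Sum>\<^sub>\<infinity>k. (cmod (f k))\<^sup>2)"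
      using infsum_reindex[OF h, of "\<lambda>i. (hnorm K (V f i))\<^sup>2"] by (simp add: comp_def Vh)
    finally show "(\<Sum>\<^sub>\<infinity>i. (hnorm K (V f i))\<^sup>2) = (\<Sum>\<^sub>\<infinity>k. (cmod (f k))\<^sup>2)" .
  qed
  have VL: "V f \<in> carrier ?L" if "f \<in> carrier ?E" for f
    using sum_V[OF that] Vc by (simp add: ell2_sum_simps)
  have "isometry ?E ?L V"
    unfolding isometry_def linear_map_def
  proof (intro conjI ballI allI)
    show "V \<in> carrier ?E \<rightarrow> carrier ?L" using VL by auto
    fix x assume x: "x \<in> carrier ?E"
    show "hnorm ?L (V x) = hnorm ?E x"
      using sum_V[OF x] by (simp add: K.ell2_sum_hnorm[OF VL[OF x]] ell2_hnorm[OF x])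
    show "V (x \<oplus>\<^bsub>?E\<^esub> y) = V x \<oplus>\<^bsub>?L\<^esub> V y" for y
      by (auto simp: V_def ell2_simps ell2_sum_simps fun_eq_iff intro!: K.hinner_ext)
        (simp add: K.hinner_simps add_divide_distrib algebra_simps)
    show "V (c \<odot>\<^bsub>?E\<^esub> x) = c \<odot>\<^bsub>?L\<^esub> V x" for c
      by (auto simp: V_def ell2_simps ell2_sum_simps fun_eq_iff K.hinner_simps intro!: K.hinner_ext)
  qed
  moreover have b1: "bij (\<lambda>(i::int, j::int). (i - 1, j))"
    by (rule bij_betw_byWitness[where f' = "\<lambda>(i, j). (i + 1, j)"]) auto
  have b2: "bij (\<lambda>(i::int, j::int). (i, j - 1))"
    by (rule bij_betw_byWitness[where f' = "\<lambda>(i, j). (i, j + 1)"]) auto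
  let ?N1 = "lift_op N (\<lambda>(i::int, j::int). (i - 1, j))" and ?N2 = "lift_op Q (\<lambda>(i::int, j::int). (i, j - 1))"
  have "normal_operator ?L ?N1" "normal_operator ?L ?N2"
    using K.normal_operator_lift_op[OF N b1] K.normal_operator_lift_op[OF Q b2] .
  moreover have "commuting ?L ?N1 ?N2"
    using NQ by (auto simp: commuting_def lift_op_def fun_eq_iff K.ell2_sum_closed)
  moreover have "?N1 (V x) = V (shift1 \<alpha> x)" for x
  proof (rule ext, clarify)
    fix i j :: int
    \<comment> \<open>At the edge i = 0 the lift reads index -1, where \<open>V x\<close> is zero;
      this matches the zero that the shift itself puts there.\<close>
    consider "i \<ge> 1" "j \<ge> 0" | "i = 0" | "i < 0 \<or> j < 0" by linarith
    then show "?N1 (V x) (i, j) = V (shift1 \<alpha> x) (i, j)"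
    proof cases
      case 1
      define a b where "a = nat (i - 1)" and "b = nat j"
      have ij: "nat i = Suc a" "nat (i - 1) = a" "nat j = b" using 1 by (auto simp: a_def b_def)
      have "G (a, b) > 0" "G (Suc a, b) > 0" using G(2) by auto
      then have "x (a, b) / of_real (G (a, b)) = of_real (\<alpha> (a, b)) * x (a, b) / of_real (G (Suc a, b))"
        unfolding \<alpha> by auto
      then show ?thesis using 1 by (simp add: lift_op_def V_def ij shift1_def lN vN)
    qed (auto simp: lift_op_def V_def N0 shift1_def zero_smult)
  qed
  moreover have "?N2 (V x) = V (shift2 \<beta> x)" for x
  proof (rule ext, clarify)
    fix i j :: int
    consider "i \<ge> 0" "j \<ge> 1" | "j = 0" | "i < 0 \<or> j < 0" by linarith
    then show "?N2 (V x) (i, j) = V (shift2 \<beta> x) (i, j)"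
    proof cases
      case 1
      define a b where "a = nat i" and "b = nat (j - 1)"
      have ij: "nat j = Suc b" "nat (j - 1) = b" "nat i = a" using 1 by (auto simp: a_def b_def)
      have "G (a, b) > 0" "G (a, Suc b) > 0" using G(2) by auto
      then have "x (a, b) / of_real (G (a, b)) = of_real (\<beta> (a, b)) * x (a, b) / of_real (G (a, Suc b))"
        unfolding \<beta> by auto
      then show ?thesis using 1 by (simp add: lift_op_def V_def ij shift2_def lQ vQ)
    qed (auto simp: lift_op_def V_def N0 shift2_def zero_smult)
  qed
  ultimately show ?thesis
    using T K.hilbert_space_ell2_sum unfolding H_infinity_def by blast
qed

context hilbert_space
begin

text \<open>Normality makes \<open>N\<close> commute with \<open>T\<close>, so one factor S N of
  T^(k+1) can be split across the inner product and the induction continued at \<open>N z\<close>.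
  Norms of powers of a normal operator thus become moments of a positive one.\<close>

lemma selfadjoint_product_powers:
  assumes N: "\<And>x. x \<in> carrier H \<Longrightarrow> N x \<in> carrier H" and S: "\<And>x. x \<in> carrier H \<Longrightarrow> S x \<in> carrier H"
    and adj: "\<And>x y. x \<in> carrier H \<Longrightarrow> y \<in> carrier H \<Longrightarrow> hinner H (N x) y = hinner H x (S y)"
    and lN: "linear_map H H N"
    and NS: "\<And>x. x \<in> carrier H \<Longrightarrow> N (S x) = S (N x)"
    and T: "\<And>x. x \<in> carrier H \<Longrightarrow> T x = of_real c \<odot>\<^bsub>H\<^esub> S (N x)"
    and z: "z \<in> carrier H"
  shows "Re (hinner H ((T ^^ k) z) z) = c ^ k * (hnorm H ((N ^^ k) z))\<^sup>2"
  using z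
proof (induction k arbitrary: z)
  case 0
  then show ?case by (simp add: hnorm_sq)
next
  case (Suc k)
  have Tc: "T x \<in> carrier H" if "x \<in> carrier H" for x using that by (simp add: T N S)
  have NT: "N (T x) = T (N x)" if "x \<in> carrier H" for x
    using that by (simp add: T N S NS linear_mapD(3)[OF lN])
  have NTk: "N ((T ^^ k) z) = (T ^^ k) (N z)"
    by (rule funpow_commute_carrier) (use Suc Tc NT N in auto)
  let ?u = "(T ^^ k) z"
  have u: "?u \<in> carrier H" using Suc Tc by (intro funpow_closed) auto
  have u': "(T ^^ k) (N z) \<in> carrier H" using N[OF u] NTk by simp
  have "hinner H (S (N ?u)) z = hinner H (N ?u) (N z)"
    using adj[of z "N ?u"] hinner_commute[of "S (N ?u)" z] hinner_commute[of "N ?u" "N z"] u Suc N S by simp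
  then have "hinner H ((T ^^ Suc k) z) z = of_real c * hinner H ((T ^^ k) (N z)) (N z)"
    using u u' Suc.prems N S by (simp add: T hinner_simps NTk)
  then have "Re (hinner H ((T ^^ Suc k) z) z) = c * Re (hinner H ((T ^^ k) (N z)) (N z))" by simp
  also have "\<dots> = c * (c ^ k * (hnorm H ((N ^^ k) (N z)))\<^sup>2)" using Suc N by simp
  finally show ?case by (simp add: funpow_swap1)
qed

lemma unit_positive_operator_normal_square:
  assumes N: "\<And>x. x \<in> carrier H \<Longrightarrow> N x \<in> carrier H" and S: "\<And>x. x \<in> carrier H \<Longrightarrow> S x \<in> carrier H"
    and adj: "\<And>x y. x \<in> carrier H \<Longrightarrow> y \<in> carrier H \<Longrightarrow> hinner H (N x) y = hinner H x (S y)"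
    and \<kappa>: "\<kappa> > 0" "\<And>x. x \<in> carrier H \<Longrightarrow> hnorm H (N x) \<le> \<kappa> * hnorm H x"
  shows "unit_positive_operator H (\<lambda>x. of_real (1 / \<kappa>\<^sup>2) \<odot>\<^bsub>H\<^esub> S (N x))"
proof
  have adj': "hinner H (S x) y = hinner H x (N y)" if "x \<in> carrier H" "y \<in> carrier H" for x y
    using that adj N S by (metis hinner_commute)
  fix x y assume x: "x \<in> carrier H"
  show "of_real (1 / \<kappa>\<^sup>2) \<odot>\<^bsub>H\<^esub> S (N x) \<in> carrier H" using x N S by simp
  show "hinner H (of_real (1 / \<kappa>\<^sup>2) \<odot>\<^bsub>H\<^esub> S (N x)) y = hinner H x (of_real (1 / \<kappa>\<^sup>2) \<odot>\<^bsub>H\<^esub> S (N y))"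
    if y: "y \<in> carrier H"
    using x y N S by (simp add: hinner_simps adj' adj)
  have e: "Re (hinner H (of_real (1 / \<kappa>\<^sup>2) \<odot>\<^bsub>H\<^esub> S (N x)) x) = (hnorm H (N x))\<^sup>2 / \<kappa>\<^sup>2"
  proof -
    have "hinner H (of_real (1 / \<kappa>\<^sup>2) \<odot>\<^bsub>H\<^esub> S (N x)) x = of_real (1 / \<kappa>\<^sup>2) * of_real ((hnorm H (N x))\<^sup>2)"
      using x N S by (simp add: hinner_smult_left adj' hinner_self)
    also have "\<dots> = of_real ((hnorm H (N x))\<^sup>2 / \<kappa>\<^sup>2)" by simp
    finally show ?thesis by simp
  qed
  show "0 \<le> Re (hinner H (of_real (1 / \<kappa>\<^sup>2) \<odot>\<^bsub>H\<^esub> S (N x)) x)" unfolding e by simp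
  have "(hnorm H (N x))\<^sup>2 \<le> \<kappa>\<^sup>2 * (hnorm H x)\<^sup>2"
    using power_mono[OF \<kappa>(2)[OF x], of 2] x N by (simp add: power_mult_distrib)
  then show "Re (hinner H (of_real (1 / \<kappa>\<^sup>2) \<odot>\<^bsub>H\<^esub> S (N x)) x) \<le> Re (hinner H x x)"
    unfolding e using \<kappa>(1) x by (simp add: field_simps hnorm_sq)
qed

end

text \<open>\<open>L\<close> stands for integration against the spectral measure of \<open>T\<close>
  at \<open>z\<close>; these are the properties that \<open>positive_functional_determinate\<close>
  consumes.\<close>

lemma (in unit_positive_operator) moment_functional:
  assumes z: "z \<in> carrier H"
  defines "L \<equiv> \<lambda>p. Re (hinner H (P p z) z)"
  shows "L (p + q) = L p + L q" "L (Polynomial.smult c p) = c * L p"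
    "p \<in> unit_cone \<Longrightarrow> 0 \<le> L p" "L (Polynomial.monom 1 k) = Re (hinner H ((T ^^ k) z) z)"
  using z by (simp_all add: L_def P_add P_smult P_monom hinner_simps P_nonneg)

lemma intertwining_funpow:
  assumes "\<And>x. x \<in> carrier H \<Longrightarrow> N (V x) = V (T x)"
    "\<And>x. x \<in> carrier H \<Longrightarrow> T x \<in> carrier H" "x \<in> carrier H"
  shows "(N ^^ n) (V x) = V ((T ^^ n) x)"
proof -
  have "(T ^^ n) x \<in> carrier H \<and> (N ^^ n) (V x) = V ((T ^^ n) x)"
    using assms by (induction n) auto
  then show ?thesis by blast
qed

theorem subnormal_of_subnormal_square:
  fixes \<alpha> \<beta> :: weights
  assumes pos: "\<And>k. 0 < \<alpha> k" "\<And>k. 0 < \<beta> k"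
    and comm: "commuting ell2 (shift1 \<alpha>) (shift2 \<beta>)"
    and sub: "subnormal TYPE('k) ell2 (shift2 \<beta>)"
    and sq: "(shift1 \<alpha>, shift2 \<beta> ^^ 2) \<in> H_infinity TYPE('k) ell2"
  shows "(shift1 \<alpha>, shift2 \<beta>) \<in> H_infinity TYPE('k) ell2"
proof -
  let ?E = "ell2 :: (nat \<times> nat \<Rightarrow> complex) cinner_space"
  interpret E: hilbert_space ?E by (rule hilbert_space_ell2)
  define T1 where "T1 = shift1 \<alpha>"
  define T2 where "T2 = shift2 \<beta>"
  note sub = sub[folded T2_def] and sq = sq[folded T1_def T2_def] and comm = comm[folded T1_def T2_def]
  from sub obtain K' :: "'k cinner_space" and V' D where K': "hilbert_space K'" and V': "isometry ell2 K' V'"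
    and D: "normal_operator K' D" and VD: "\<And>x. x \<in> carrier ell2 \<Longrightarrow> D (V' x) = V' (T2 x)"
    and bT2: "bounded_operator ell2 T2"
    by (auto simp: subnormal_def)
  from sq obtain K :: "'k cinner_space" and V N M where K: "hilbert_space K" and V: "isometry ell2 K V"
    and N: "normal_operator K N" and M: "normal_operator K M" and NM: "commuting K N M"
    and VN: "\<And>x. x \<in> carrier ell2 \<Longrightarrow> N (V x) = V (T1 x)"
    and VM: "\<And>x. x \<in> carrier ell2 \<Longrightarrow> M (V x) = V ((T2 ^^ 2) x)"
    and bT1: "bounded_operator ell2 T1"
    by (auto simp: H_infinity_def)
  interpret K: hilbert_space K by (rule K)
  interpret K': hilbert_space K' by (rule K')
  note Tc [simp] = E.bounded_operatorD(2)[OF bT1] E.bounded_operatorD(2)[OF bT2]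
  note Tpc [simp] = E.funpow_closed[of T1, OF Tc(1)] E.funpow_closed[of T2, OF Tc(2)]
  have lV: "linear_map ?E K V" and lV': "linear_map ?E K' V'" using V V' by (auto simp: isometry_def)
  note Vc [simp] = E.linear_mapD(1)[OF lV] E.linear_mapD(1)[OF lV']
  obtain S where S: "is_adjoint K M S" "commuting K M S" and bM: "bounded_operator K M"
    using M by (auto simp: normal_operator_def)
  have bS: "bounded_operator K S" and bN: "bounded_operator K N" using S N by (auto simp: is_adjoint_def normal_operator_def)
  obtain D' where D': "is_adjoint K' D D'" "commuting K' D D'" and bD: "bounded_operator K' D"
    using D by (auto simp: normal_operator_def)
  have bD': "bounded_operator K' D'" using D' by (auto simp: is_adjoint_def)
  note Kc [simp] = K.bounded_operatorD(2)[OF bM] K.bounded_operatorD(2)[OF bS] K.bounded_operatorD(2)[OF bN]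
    K'.bounded_operatorD(2)[OF bD] K'.bounded_operatorD(2)[OF bD']
  note Npc [simp] = K.funpow_closed[of N, OF Kc(3)]
  have adjM: "hinner K (M x) y = hinner K x (S y)" if "x \<in> carrier K" "y \<in> carrier K" for x y
    using S that by (auto simp: is_adjoint_def)
  have adjD: "hinner K' (D x) y = hinner K' x (D' y)" if "x \<in> carrier K'" "y \<in> carrier K'" for x y
    using D' that by (auto simp: is_adjoint_def)
  have MS: "M (S x) = S (M x)" if "x \<in> carrier K" for x using S that by (auto simp: commuting_def)
  have DD: "D (D' x) = D' (D x)" if "x \<in> carrier K'" for x using D' that by (auto simp: commuting_def)
  have NMx: "N (M x) = M (N x)" if "x \<in> carrier K" for x using NM that by (auto simp: commuting_def)
  have NS: "N (S x) = S (N x)" if "x \<in> carrier K" for x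
    by (rule K.fuglede[OF bM bS adjM MS bN NMx that])

  obtain \<kappa>1 \<kappa>2 where \<kappa>12: "\<kappa>1 > 0" "\<forall>x\<in>carrier K. hnorm K (M x) \<le> \<kappa>1 * hnorm K x"
      "\<kappa>2 > 0" "\<forall>x\<in>carrier K'. hnorm K' (D x) \<le> \<kappa>2 * hnorm K' x"
    using K.bounded_operatorD(3)[OF bM] K'.bounded_operatorD(3)[OF bD] by blast
  \<comment> \<open>\<open>M\<close> extends T2^2 and \<open>D\<close> extends T2, so their bounds
    are to be \<kappa>^2 and \<kappa> for one common \<kappa>. Then \<open>B\<close>, scaled by
    \<kappa>^-4, and \<open>A\<close>, scaled by \<kappa>^-2, fit together: \<open>A\<close> is to
    be compared with the root of \<open>B\<close>.\<close>
  define \<kappa> where "\<kappa> = max (sqrt \<kappa>1) \<kappa>2"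
  have \<kappa>: "\<kappa> > 0" "\<kappa>1 \<le> \<kappa>\<^sup>2" "\<kappa>2 \<le> \<kappa>"
  proof -
    have "sqrt \<kappa>1 \<le> \<kappa>" by (simp add: \<kappa>_def)
    then have "(sqrt \<kappa>1)\<^sup>2 \<le> \<kappa>\<^sup>2" using \<kappa>12 by (intro power_mono) auto
    then show "\<kappa>1 \<le> \<kappa>\<^sup>2" using \<kappa>12 by simp
  qed (use \<kappa>12 in \<open>auto simp: \<kappa>_def\<close>)
  have Mb: "hnorm K (M x) \<le> \<kappa>\<^sup>2 * hnorm K x" if "x \<in> carrier K" for x
    by (rule order_trans[OF \<kappa>12(2)[rule_format, OF that]]) (use \<kappa> that in \<open>simp add: mult_right_mono\<close>)
  have Db: "hnorm K' (D x) \<le> \<kappa> * hnorm K' x" if "x \<in> carrier K'" for x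
    by (rule order_trans[OF \<kappa>12(4)[rule_format, OF that]]) (use \<kappa> that in \<open>simp add: mult_right_mono\<close>)
  define B where "B x = of_real (1 / (\<kappa>\<^sup>2)\<^sup>2) \<odot>\<^bsub>K\<^esub> S (M x)" for x
  define A where "A x = of_real (1 / \<kappa>\<^sup>2) \<odot>\<^bsub>K'\<^esub> D' (D x)" for x
  interpret B: unit_positive_operator K B
    unfolding B_def[abs_def]
    by (rule K.unit_positive_operator_normal_square) (use adjM Mb \<kappa> in auto)
  interpret A: unit_positive_operator K' A
    unfolding A_def[abs_def]
    by (rule K'.unit_positive_operator_normal_square) (use adjD Db \<kappa> in auto)
  have NB: "N (B x) = B (N x)" if "x \<in> carrier K" for x
    using that by (simp add: B_def K.linear_mapD(3)[OF K.bounded_operatorD(1)[OF bN]] NS NMx)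
  \<comment> \<open>In terms of |M|, the operator \<open>R\<close> is |M| / \<kappa>^2 and its root
    \<open>Q\<close> below is |M|^(1/2) / \<kappa>. \<open>R\<close> plays the part of
    \<open>A\<close>, and \<open>Q\<close> that of |D| / \<kappa>.\<close>
  obtain R where R: "unit_positive_operator K R" and RB: "\<And>x. x \<in> carrier K \<Longrightarrow> R (R x) = B x"
    and R_comm: "\<And>S. bounded_operator K S \<Longrightarrow> \<forall>x\<in>carrier K. S (B x) = B (S x) \<Longrightarrow>
      \<forall>x\<in>carrier K. S (R x) = R (S x)"
    using B.sqrt_exists by blast
  have NR: "N (R x) = R (N x)" if "x \<in> carrier K" for x
    using R_comm[OF bN] NB that by blast
  interpret R: unit_positive_operator K R by (rule R)
  obtain Q where Q: "unit_positive_operator K Q" and QR: "\<And>x. x \<in> carrier K \<Longrightarrow> Q (Q x) = R x"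
    and Q_comm: "\<And>S. bounded_operator K S \<Longrightarrow> \<forall>x\<in>carrier K. S (R x) = R (S x) \<Longrightarrow>
      \<forall>x\<in>carrier K. S (Q x) = Q (S x)"
    using R.sqrt_exists by blast
  have NQ: "N (Q x) = Q (N x)" if "x \<in> carrier K" for x
    using Q_comm[OF bN] NR that by blast
  interpret Q: unit_positive_operator K Q by (rule Q)

  define e0 where "e0 = (basis_vec (0, 0) :: nat \<times> nat \<Rightarrow> complex)"
  have e0 [simp]: "e0 \<in> carrier ell2" by (simp add: e0_def)
  define G where "G = (\<lambda>(a, b). hnorm ell2 ((T1 ^^ a) ((T2 ^^ b) e0)))"
  have T12: "T1 (T2 x) = T2 (T1 x)" if "x \<in> carrier ell2" for x using comm that by (simp add: commuting_def)
  have T1sm: "T1 (\<lambda>j. c * x j) = (\<lambda>j. c * T1 x j)" "T2 (\<lambda>j. c * x j) = (\<lambda>j. c * T2 x j)" for c x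
    by (auto simp: T1_def T2_def shift1_def shift2_def fun_eq_iff)
  \<comment> \<open>Only the sign of the coefficient is tracked in the induction;
    \<open>norm_bv\<close> identifies it with the norm \<open>G (a, b)\<close> afterwards.\<close>
  have vec: "\<exists>c>0. (T1 ^^ a) ((T2 ^^ b) e0) = (\<lambda>j. of_real c * basis_vec (a, b) j)" for a b
  proof (induction a)
    case 0
    show ?case
    proof (induction b)
      case 0
      show ?case by (intro exI[of _ 1]) (simp add: e0_def)
    next
      case (Suc b)
      then obtain c where c: "c > 0" "(T2 ^^ b) e0 = (\<lambda>j. of_real c * basis_vec (0, b) j)" by auto
      then show ?case using pos(2)[of "(0, b)"] unfolding T2_def[symmetric]
        by (intro exI[of _ "c * \<beta> (0, b)"])
          (simp add: T1sm shift2_basis_vec[of \<beta>, folded T2_def] mult.assoc)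
    qed
  next
    case (Suc a)
    then obtain c where c: "c > 0" "(T1 ^^ a) ((T2 ^^ b) e0) = (\<lambda>j. of_real c * basis_vec (a, b) j)" by auto
    then show ?case using pos(1)[of "(a, b)"]
      by (intro exI[of _ "c * \<alpha> (a, b)"])
        (simp add: T1sm shift1_basis_vec[of \<alpha>, folded T1_def] mult.assoc)
  qed
  have norm_bv: "hnorm ell2 (\<lambda>j. of_real c * basis_vec k j) = c" if "c > 0" for c and k :: "nat \<times> nat"
    using E.hnorm_smult[of "basis_vec k" "of_real c"] that by (simp add: ell2_simps(4))
  have Gvec: "(T1 ^^ a) ((T2 ^^ b) e0) = (\<lambda>j. of_real (G (a, b)) * basis_vec (a, b) j)" and Gpos: "G (a, b) > 0" for a b
    using vec[of a b] norm_bv by (auto simp: G_def)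
  have G1: "G (Suc a, b) = \<alpha> (a, b) * G (a, b)" for a b
  proof -
    have "(T1 ^^ Suc a) ((T2 ^^ b) e0) = (\<lambda>j. of_real (\<alpha> (a, b) * G (a, b)) * basis_vec (Suc a, b) j)"
      by (simp add: Gvec T1sm shift1_basis_vec[of \<alpha>, folded T1_def]) (simp add: mult_ac)
    then show ?thesis using norm_bv[of "\<alpha> (a, b) * G (a, b)" "(Suc a, b)"] pos Gpos
      by (simp add: G_def del: funpow.simps of_real_mult)
  qed
  have T12p: "T2 ((T1 ^^ a) x) = (T1 ^^ a) (T2 x)" if "x \<in> carrier ell2" for a x
    by (rule E.funpow_commute_carrier) (use that T12 in auto)
  have G2: "G (a, Suc b) = \<beta> (a, b) * G (a, b)" for a b
  proof -
    have "(T1 ^^ a) ((T2 ^^ Suc b) e0) = T2 ((T1 ^^ a) ((T2 ^^ b) e0))" by (simp add: T12p)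
    also have "\<dots> = (\<lambda>j. of_real (\<beta> (a, b) * G (a, b)) * basis_vec (a, Suc b) j)"
      by (simp add: Gvec T1sm shift2_basis_vec[of \<beta>, folded T2_def]) (simp add: mult_ac)
    finally show ?thesis using norm_bv[of "\<beta> (a, b) * G (a, b)" "(a, Suc b)"] pos Gpos
      by (simp add: G_def del: funpow.simps of_real_mult)
  qed
  have G': "hnorm ell2 ((T2 ^^ b) ((T1 ^^ a) e0)) = G (a, b)" for a b
  proof -
    have "(T1 ^^ a) ((T2 ^^ b) e0) = (T2 ^^ b) ((T1 ^^ a) e0)"
      by (rule E.funpow_commute_carrier) (use T12p in auto)
    then show ?thesis by (simp add: G_def)
  qed

  define x0 where "x0 = V e0"
  have x0 [simp]: "x0 \<in> carrier K" by (simp add: x0_def)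
  have Nx: "(N ^^ a) x0 = V ((T1 ^^ a) e0)" for a
    unfolding x0_def by (rule intertwining_funpow[where H = ell2]) (use VN in auto)
  have M_mom: "hnorm K ((M ^^ j) ((N ^^ a) x0)) = G (a, 2 * j)" for a j
  proof -
    have "(M ^^ j) (V ((T1 ^^ a) e0)) = V (((T2 ^^ 2) ^^ j) ((T1 ^^ a) e0))"
      by (rule intertwining_funpow[where H = ell2]) (use VM in auto)
    also have "(T2 ^^ 2) ^^ j = T2 ^^ (2 * j)" by (simp add: funpow_mult)
    finally show ?thesis using V G'[of "2 * j" a] by (simp add: Nx isometry_def)
  qed
  have D_mom: "hnorm K' ((D ^^ b) (V' ((T1 ^^ a) e0))) = G (a, b)" for a b
  proof -
    have "(D ^^ b) (V' ((T1 ^^ a) e0)) = V' ((T2 ^^ b) ((T1 ^^ a) e0))"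
      by (rule intertwining_funpow[where H = ell2]) (use VD in auto)
    then show ?thesis using V' G' by (simp add: isometry_def)
  qed
  \<comment> \<open>For fixed a, the vectors \<open>z\<close> and \<open>w\<close> both represent
    T1^a e0, but in two different extension spaces. Even moments of \<open>R\<close> at
    \<open>z\<close> come from \<open>M\<close>, all moments of \<open>A\<close> at \<open>w\<close>
    from \<open>D\<close>; determinacy extends the agreement to odd b.\<close>
  have Q_mom: "\<kappa> ^ b * hnorm K ((Q ^^ b) ((N ^^ a) x0)) = G (a, b)" for a b
  proof -
    define z where "z = (N ^^ a) x0"
    define w where "w = V' ((T1 ^^ a) e0)"
    have z: "z \<in> carrier K" and w: "w \<in> carrier K'" by (simp_all add: z_def w_def)
    note LR = R.moment_functional[OF z] and LA = A.moment_functional[OF w]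
    have A_mom: "Re (hinner K' ((A ^^ k) w) w) = (1 / \<kappa>\<^sup>2) ^ k * (G (a, k))\<^sup>2" for k
    proof -
      have "Re (hinner K' ((A ^^ k) w) w) = (1 / \<kappa>\<^sup>2) ^ k * (hnorm K' ((D ^^ k) w))\<^sup>2"
        by (rule K'.selfadjoint_product_powers[where S = D'])
          (use w adjD DD K'.bounded_operatorD(1)[OF bD] in \<open>auto simp: A_def\<close>)
      then show ?thesis by (simp add: w_def D_mom)
    qed
    \<comment> \<open>Even powers of \<open>R\<close> are powers of \<open>B\<close>, hence are
      governed by \<open>M\<close> alone, that is, by even powers of T2.\<close>
    have even: "Re (hinner K ((R ^^ (2 * j)) z) z) = Re (hinner K' ((A ^^ (2 * j)) w) w)" for j
    proof -
      have "(R ^^ (2 * j)) z = (B ^^ j) z"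
      proof (induction j)
        case (Suc j)
        have "(R ^^ (2 * Suc j)) z = R (R ((R ^^ (2 * j)) z))" by simp
        also have "\<dots> = B ((R ^^ (2 * j)) z)" using z by (intro RB K.funpow_closed) auto
        finally show ?case using Suc by simp
      qed simp
      moreover have "Re (hinner K ((B ^^ j) z) z) = (1 / (\<kappa>\<^sup>2)\<^sup>2) ^ j * (hnorm K ((M ^^ j) z))\<^sup>2"
        by (rule K.selfadjoint_product_powers[where S = S])
          (use z adjM MS K.bounded_operatorD(1)[OF bM] in \<open>auto simp: B_def\<close>)
      moreover have "(1 / (\<kappa>\<^sup>2)\<^sup>2) ^ j = (1 / \<kappa>\<^sup>2) ^ (2 * j)"
        by (simp add: power_mult power_divide)
      ultimately show ?thesis by (simp add: A_mom z_def M_mom)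
    qed
    have "Re (hinner K ((R ^^ b) z) z) = Re (hinner K' ((A ^^ b) w) w)"
      using positive_functional_determinate[of "\<lambda>p. Re (hinner K (R.P p z) z)" "\<lambda>p. Re (hinner K' (A.P p w) w)" b]
        LR LA even by simp
    \<comment> \<open>The self-adjoint \<open>Q\<close> is its own adjoint, so the formula for
      powers applies to R = Q Q with constant 1 and converts moments of \<open>R\<close> into
      norms.\<close>
    moreover have "Re (hinner K ((R ^^ b) z) z) = 1 ^ b * (hnorm K ((Q ^^ b) z))\<^sup>2"
    proof (rule K.selfadjoint_product_powers[where S = Q])
      show "R x = of_real 1 \<odot>\<^bsub>K\<^esub> Q (Q x)" if "x \<in> carrier K" for x
        using that by (intro K.hinner_ext) (auto simp: K.hinner_simps QR)
    qed (use z Q.selfadj Q.lin in auto)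
    ultimately have "(hnorm K ((Q ^^ b) z))\<^sup>2 = (1 / \<kappa>\<^sup>2) ^ b * (G (a, b))\<^sup>2"
      by (simp add: A_mom)
    then have "(\<kappa> ^ b * hnorm K ((Q ^^ b) z))\<^sup>2 = (G (a, b))\<^sup>2"
      using \<kappa>(1) by (simp add: power_mult_distrib power_divide field_simps flip: power_mult)
    moreover have "(Q ^^ b) z \<in> carrier K" using z by (intro K.funpow_closed) auto
    ultimately show ?thesis
      using \<kappa>(1) Gpos[of a b] unfolding z_def[symmetric] by (simp add: power2_eq_iff_nonneg)
  qed
  \<comment> \<open>Undoes the normalisation by \<kappa>, so that the norms become exactly
    \<open>G\<close>.\<close>
  define Q' where "Q' x = of_real \<kappa> \<odot>\<^bsub>K\<^esub> Q x" for x
  have Q'c [simp]: "Q' x \<in> carrier K" if "x \<in> carrier K" for x using that by (simp add: Q'_def)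
  have Q'n: "normal_operator K Q'"
  proof -
    have "bounded_operator K Q'" unfolding Q'_def[abs_def] by (rule K.bounded_operator_smult[OF Q.bounded])
    moreover have "is_adjoint K Q' Q'"
      using calculation by (simp add: is_adjoint_def Q'_def K.hinner_simps Q.selfadj)
    ultimately show ?thesis by (auto simp: normal_operator_def commuting_def)
  qed
  have NQ': "N (Q' x) = Q' (N x)" if "x \<in> carrier K" for x
    using that by (simp add: Q'_def K.linear_mapD(3)[OF K.bounded_operatorD(1)[OF bN]] NQ)
  have Q'p: "hnorm K ((Q' ^^ b) y) = \<kappa> ^ b * hnorm K ((Q ^^ b) y)" if y: "y \<in> carrier K" for b y
    using y
  proof (induction b arbitrary: y)
    case (Suc b)
    have lin: "linear_map K K (Q ^^ b)" by (rule K.linear_map_funpow[OF Q.lin])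
    have "hnorm K ((Q' ^^ Suc b) y) = \<kappa> ^ b * hnorm K ((Q ^^ b) (Q' y))"
      using Suc by (simp add: funpow_Suc_right del: funpow.simps)
    also have "(Q ^^ b) (Q' y) = of_real \<kappa> \<odot>\<^bsub>K\<^esub> (Q ^^ b) (Q y)"
      unfolding Q'_def using Suc.prems by (simp add: K.linear_mapD(3)[OF lin])
    also have "hnorm K \<dots> = \<kappa> * hnorm K ((Q ^^ b) (Q y))"
      using Suc.prems \<kappa>(1) K.linear_mapD(1)[OF lin] by (simp add: K.hnorm_smult)
    finally show ?case by (simp add: funpow_swap1)
  qed simp
  have mom: "hnorm K ((N ^^ a) ((Q' ^^ b) x0)) = G (a, b)" for a b
  proof -
    have NQ'p: "N ((Q' ^^ b) x) = (Q' ^^ b) (N x)" if "x \<in> carrier K" for x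
      by (rule K.funpow_commute_carrier) (use that NQ' in auto)
    have "(N ^^ a) ((Q' ^^ b) x0) = (Q' ^^ b) ((N ^^ a) x0)"
      by (rule K.funpow_commute_carrier[symmetric]) (use NQ'p in \<open>auto intro: K.funpow_closed\<close>)
    then show ?thesis by (simp add: Q'p Q_mom)
  qed
  have "(shift1 \<alpha>, shift2 \<beta>) \<in> H_infinity TYPE(int \<times> int \<Rightarrow> 'k) ell2"
  proof (rule H_infinity_model[OF K N Q'n _ x0 _ _ mom])
    show "commuting K N Q'" using NQ' by (simp add: commuting_def)
  qed (use bT1 bT2 G1 G2 Gpos in \<open>auto simp: T1_def T2_def\<close>)
  moreover obtain \<phi> :: "(nat \<times> nat \<Rightarrow> complex) \<Rightarrow> (nat \<times> nat \<Rightarrow> complex)"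
    where \<phi>: "inj \<phi>" "range \<phi> \<subseteq> carrier ell2" using ell2_geometric_embedding by blast
  \<comment> \<open>The given extension space already holds an isometric copy of \<open>ell2\<close>
    in the type 'k, so composing with \<phi> certifies that this universe is large enough for the
    model built over a bigger type.\<close>
  have "inj (\<lambda>f. V (\<phi> f))"
    using comp_inj_on[OF \<phi>(1) inj_on_subset[OF isometry_inj_on[OF hilbert_space_ell2 K V] \<phi>(2)]]
    by (simp add: comp_def)
  ultimately show ?thesis by (rule H_infinity_universe)
qed

section \<open>Permanence of joint subnormality under exchange and powers\<close>

lemma H_infinity_commute: "(T1, T2) \<in> H_infinity k H \<Longrightarrow> (T2, T1) \<in> H_infinity k H"
  unfolding H_infinity_def commuting_def by auto metis

lemma normal_operator_funpow:
  assumes K: "hilbert_space K" and N: "normal_operator K N"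
  shows "normal_operator K (N ^^ n)"
proof -
  interpret K: hilbert_space K by (rule K)
  obtain S where S: "is_adjoint K N S" "commuting K N S" and bN: "bounded_operator K N"
    using N by (auto simp: normal_operator_def)
  have bS: "bounded_operator K S" using S by (simp add: is_adjoint_def)
  note cl = K.bounded_operatorD(2)[OF bN] K.bounded_operatorD(2)[OF bS]
  have "is_adjoint K (N ^^ n) (S ^^ n)"
    unfolding is_adjoint_def
    using K.bounded_operator_funpow[OF bS] K.funpow_adjoint[of N S] S cl by (auto simp: is_adjoint_def)
  moreover have "commuting K (N ^^ n) (S ^^ n)"
    unfolding commuting_def
  proof
    fix x assume x: "x \<in> carrier K"
    have SN: "S ((N ^^ n) x) = (N ^^ n) (S x)" if "x \<in> carrier K" for x
      by (rule K.funpow_commute_carrier) (use that S cl in \<open>auto simp: commuting_def\<close>)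
    show "(N ^^ n) ((S ^^ n) x) = (S ^^ n) ((N ^^ n) x)"
      by (rule K.funpow_commute_carrier) (use x SN cl in \<open>auto intro: K.funpow_closed\<close>)
  qed
  ultimately show ?thesis
    using K.bounded_operator_funpow[OF bN] by (auto simp: normal_operator_def)
qed

lemma H_infinity_power:
  assumes H: "hilbert_space H" and T: "(T1, T2) \<in> H_infinity TYPE('k) H"
  shows "(T1, T2 ^^ n) \<in> H_infinity TYPE('k) H"
proof -
  interpret H: hilbert_space H by (rule H)
  from T obtain K :: "'k cinner_space" and V N1 N2 where K: "hilbert_space K" and V: "isometry H K V"
    and N: "normal_operator K N1" "normal_operator K N2" "commuting K N1 N2"
    and VN: "\<And>x. x \<in> carrier H \<Longrightarrow> N1 (V x) = V (T1 x)" "\<And>x. x \<in> carrier H \<Longrightarrow> N2 (V x) = V (T2 x)"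
    and bT: "bounded_operator H T1" "bounded_operator H T2"
    by (auto simp: H_infinity_def)
  interpret K: hilbert_space K by (rule K)
  have bN: "bounded_operator K N1" "bounded_operator K N2" using N by (auto simp: normal_operator_def)
  have "commuting K N1 (N2 ^^ n)"
    unfolding commuting_def
    using K.funpow_commute_carrier[of N2 N1] N(3) K.bounded_operatorD(2)[OF bN(1)] K.bounded_operatorD(2)[OF bN(2)]
    by (auto simp: commuting_def)
  moreover have "(N2 ^^ n) (V x) = V ((T2 ^^ n) x)" if "x \<in> carrier H" for x
    by (rule intertwining_funpow[where H = H]) (use that VN H.bounded_operatorD(2)[OF bT(2)] in auto)
  ultimately show ?thesis
    unfolding H_infinity_def
    using K V N VN bT normal_operator_funpow[OF K N(2)] H.bounded_operator_funpow[OF bT(2)] by blast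
qed

section \<open>Exchanging the two variables\<close>

text \<open>The unitary exchange of the coordinates. Conjugation by it turns shifts in one direction
  into shifts in the other, so a result about squaring the second operator also covers squaring the
  first.\<close>

definition flip :: "(nat \<times> nat \<Rightarrow> complex) \<Rightarrow> nat \<times> nat \<Rightarrow> complex" where
  "flip f = (\<lambda>(a, b). f (b, a))"

lemma flip_flip [simp]: "flip (flip f) = f"
  by (auto simp: flip_def fun_eq_iff)

lemma flip_shift:
  "flip (shift1 \<alpha> (flip f)) = shift2 (\<alpha> \<circ> prod.swap) f"
  "flip (shift2 \<alpha> (flip f)) = shift1 (\<alpha> \<circ> prod.swap) f"
  by (auto simp: flip_def shift1_def shift2_def fun_eq_iff)

lemma flip_closed [simp]: "f \<in> carrier ell2 \<Longrightarrow> flip f \<in> carrier ell2"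
  and hnorm_flip: "f \<in> carrier ell2 \<Longrightarrow> hnorm ell2 (flip f) = hnorm ell2 f"
proof -
  assume f: "f \<in> carrier ell2"
  have b: "bij_betw prod.swap (UNIV :: (nat \<times> nat) set) UNIV" by simp
  have e: "(\<lambda>k. (cmod (flip f k))\<^sup>2) = (\<lambda>k. (cmod (f (prod.swap k)))\<^sup>2)"
    by (auto simp: flip_def fun_eq_iff)
  show c: "flip f \<in> carrier ell2"
    using f summable_on_reindex_bij_betw[OF b, of "\<lambda>k. (cmod (f k))\<^sup>2"]
    by (simp add: ell2_simps e)
  show "hnorm ell2 (flip f) = hnorm ell2 f"
    unfolding ell2_hnorm[OF c] ell2_hnorm[OF f] e
    using infsum_reindex_bij_betw[OF b, of "\<lambda>k. (cmod (f k))\<^sup>2"] by simp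
qed

lemma flip_linear:
  "flip (f \<oplus>\<^bsub>ell2\<^esub> g) = flip f \<oplus>\<^bsub>ell2\<^esub> flip g" "flip (c \<odot>\<^bsub>ell2\<^esub> f) = c \<odot>\<^bsub>ell2\<^esub> flip f"
  by (auto simp: flip_def ell2_simps fun_eq_iff)

lemma bounded_operator_flip:
  assumes "bounded_operator ell2 T"
  shows "bounded_operator ell2 (\<lambda>f. flip (T (flip f)))"
proof -
  interpret hilbert_space "ell2 :: (nat \<times> nat \<Rightarrow> complex) cinner_space" by (rule hilbert_space_ell2)
  note T = bounded_operatorD(1,2)[OF assms]
  obtain C where C: "\<forall>x\<in>carrier ell2. hnorm ell2 (T x) \<le> C * hnorm ell2 x"
    using bounded_operatorD(3)[OF assms] by blast
  have "hnorm ell2 (flip (T (flip f))) \<le> C * hnorm ell2 f" if "f \<in> carrier ell2" for f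
    using C[rule_format, OF flip_closed[OF that]] that T(2) by (simp add: hnorm_flip)
  moreover have "linear_map ell2 ell2 (\<lambda>f. flip (T (flip f)))"
    using T(2) linear_mapD(2,3)[OF T(1)] by (simp add: linear_map_def flip_linear)
  ultimately show ?thesis unfolding bounded_operator_def by blast
qed

lemma H_infinity_flip:
  assumes "(T1, T2) \<in> H_infinity TYPE('k) ell2"
  shows "(\<lambda>f. flip (T1 (flip f)), \<lambda>f. flip (T2 (flip f))) \<in> H_infinity TYPE('k) ell2"
proof -
  from assms obtain K :: "'k cinner_space" and V N1 N2 where K: "hilbert_space K" and V: "isometry ell2 K V"
    and N: "normal_operator K N1" "normal_operator K N2" "commuting K N1 N2"
    and VN: "\<forall>x\<in>carrier ell2. N1 (V x) = V (T1 x) \<and> N2 (V x) = V (T2 x)"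
    and bT: "bounded_operator ell2 T1" "bounded_operator ell2 T2"
    by (auto simp: H_infinity_def)
  have "isometry ell2 K (\<lambda>f. V (flip f))"
    using V by (auto simp: isometry_def linear_map_def flip_linear hnorm_flip)
  moreover have "\<forall>x\<in>carrier ell2. N1 (V (flip x)) = V (flip (flip (T1 (flip x)))) \<and>
      N2 (V (flip x)) = V (flip (flip (T2 (flip x))))"
    using VN by simp
  ultimately show ?thesis
    unfolding H_infinity_def using K N bounded_operator_flip[OF bT(1)] bounded_operator_flip[OF bT(2)]
    by blast
qed

text \<open>A normal operator commutes with itself, so the diagonal pair needs no further extension.
  This lets \<open>H_infinity_flip\<close> act on single subnormal operators.\<close>

lemma subnormal_iff_H_infinity: "subnormal k H T \<longleftrightarrow> (T, T) \<in> H_infinity k H"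
  unfolding subnormal_def H_infinity_def commuting_def by (rule iffI; clarsimp; blast)

theorem theorem3p9:
  fixes T1 T2 :: "(nat \<times> nat \<Rightarrow> complex) \<Rightarrow> (nat \<times> nat \<Rightarrow> complex)"
  assumes "(T1, T2) \<in> tensor_core_class TYPE('k)"
  shows "((T1, T2 ^^ 2) \<in> H_infinity TYPE('k) ell2 \<longleftrightarrow>
          (T1 ^^ 2, T2) \<in> H_infinity TYPE('k) ell2) \<and>
         ((T1 ^^ 2, T2) \<in> H_infinity TYPE('k) ell2 \<longleftrightarrow>
          (T1, T2) \<in> H_infinity TYPE('k) ell2)"
proof -
  from assms obtain \<alpha> \<beta> where T: "T1 = shift1 \<alpha>" "T2 = shift2 \<beta>"
    and pos: "\<And>k. 0 < \<alpha> k" "\<And>k. 0 < \<beta> k" and comm: "commuting ell2 T1 T2"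
    and sub: "subnormal TYPE('k) ell2 T1" "subnormal TYPE('k) ell2 T2"
    by (auto simp: tensor_core_class_def weight_family_def H_zero_def)
  have up2: "(T1, T2 ^^ 2) \<in> H_infinity TYPE('k) ell2" if "(T1, T2) \<in> H_infinity TYPE('k) ell2"
    by (rule H_infinity_power[OF hilbert_space_ell2 that])
  have up1: "(T1 ^^ 2, T2) \<in> H_infinity TYPE('k) ell2" if "(T1, T2) \<in> H_infinity TYPE('k) ell2"
    by (rule H_infinity_commute, rule H_infinity_power[OF hilbert_space_ell2], rule H_infinity_commute)
      (rule that)
  have down2: "(T1, T2) \<in> H_infinity TYPE('k) ell2" if "(T1, T2 ^^ 2) \<in> H_infinity TYPE('k) ell2"
    using subnormal_of_subnormal_square[of \<alpha> \<beta>] pos comm sub that by (simp add: T)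
  have down1: "(T1, T2) \<in> H_infinity TYPE('k) ell2" if sq: "(T1 ^^ 2, T2) \<in> H_infinity TYPE('k) ell2"
  proof -
    \<comment> \<open>Conjugation by \<open>flip\<close> makes T2 the shift in the first variable,
      so the pair is also reordered: the square then falls on the second operator, as
      \<open>subnormal_of_subnormal_square\<close> expects.\<close>
    define \<alpha>' \<beta>' where "\<alpha>' = \<beta> \<circ> prod.swap" and "\<beta>' = \<alpha> \<circ> prod.swap"
    have c1: "(\<lambda>f. flip (T2 (flip f))) = shift1 \<alpha>'" and c2: "(\<lambda>f. flip (T1 (flip f))) = shift2 \<beta>'"
      by (simp_all add: T flip_shift \<alpha>'_def \<beta>'_def)
    have c3: "(\<lambda>f. flip ((T1 ^^ 2) (flip f))) = shift2 \<beta>' ^^ 2"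
      by (simp add: c2[symmetric] numeral_2_eq_2 fun_eq_iff)
    have "(shift1 \<alpha>', shift2 \<beta>' ^^ 2) \<in> H_infinity TYPE('k) ell2"
      using H_infinity_flip[OF H_infinity_commute[OF sq]] by (simp only: c1 c3)
    moreover have "subnormal TYPE('k) ell2 (shift2 \<beta>')"
      using H_infinity_flip[of T1 T1] sub(1) by (simp only: c2 subnormal_iff_H_infinity)
    moreover have "commuting ell2 (shift1 \<alpha>') (shift2 \<beta>')"
      using comm by (simp add: commuting_def flip: c1 c2)
    ultimately have *: "(shift1 \<alpha>', shift2 \<beta>') \<in> H_infinity TYPE('k) ell2"
      using pos by (intro subnormal_of_subnormal_square) (auto simp: \<alpha>'_def \<beta>'_def)
    have "(\<lambda>f. flip (shift1 \<alpha>' (flip f))) = T2" "(\<lambda>f. flip (shift2 \<beta>' (flip f))) = T1"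
      by (simp_all flip: c1 c2)
    then show ?thesis
      using H_infinity_commute[OF H_infinity_flip[OF *]] by simp
  qed
  show ?thesis using up1 up2 down1 down2 by blast
qed

end
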